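(* Let $(X_n,Y_n)_{n\ge 0}$ be a Markov chain in $E\times F$ with transition kernel $P$ and invariant probability $\lambda$, where $E,F$ are Polish and $E\subseteq\prod_{i\in I}E^i$ is contained in a countable product of Polish spaces. Suppose that $(X_n,Y_n)_{n\ge 0}$ is locally mixing, that is, $$\|\mathbf{P}^{x,y}-\mathbf{P}\|_{\mathcal{F}^J_{n,\infty}}\to 0\ \text{ as }n\to\infty\text{ for all }(x,y)\in E\times F\text{ and }J\subseteq I,\ |J|<\infty,$$ and that the following nondegeneracy assumption holds: there exist Markov transition kernels $P_0:E\times\mathcal{B}(E)\to[0,1]$ and $Q:F\times\mathcal{B}(F)\to[0,1]$ and a strictly positive measurable function $g:E\times F\times E\times F\to\,]0,\infty[$ such that $P(x,y,dx',dy')=g(x,y,x',y')\,P_0(x,dx')\,Q(y,dy')$. Then for any $\mu\in\mathcal{P}(E\times F)$ such that $\mu(E\times\cdot)\ll\lambda(E\times\cdot)$, and for any $r\in\mathbb{N}$, we have $$\|\Pi_n^\mu-\Pi_n\|_{\mathcal{F}^J_{n-r,\infty}}\to 0\ \text{ as }n\to\infty,\ \mathbf{P}^\mu\text{-a.s. for all }J\subseteq I,\ |J|<\infty.$$ In particular, the filter is stable in the sense $$\|\pi_n^\mu-\pi_n\|_{\mathcal{E}^J}\to 0\ \text{ as }n\to\infty,\ \mathbf{P}^\mu\text{-a.s. for all }J\subseteq I,\ |J|<\infty.$$ If $\mu(E\times\cdot)\sim\lambda(E\times\cdot)$, the convergence holds also $\mathbf{P}$-a.s.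
   Context: $E,F$ are Polish spaces; $\mathcal{B}(\cdot)$ is the Borel $\sigma$-field and $\mathcal{P}(\cdot)$ the set of Borel probability measures. $I$ is countable, each $E^i$ is Polish, and $E\subseteq\prod_{i\in I}E^i$ as measurable spaces (i.e. $\mathcal{B}(E)$ is the trace of the product $\sigma$-field). For $x=(x^i)_{i\in I}\in E$ and $J\subseteq I$, $x^J=(x^i)_{i\in J}$; $\mathcal{E}^J\subseteq\mathcal{B}(E)$ is the $\sigma$-field generated by $x\mapsto x^J$. $(X_n,Y_n)$ is the coordinate process on the canonical path space $E^{\mathbb{Z}}\times F^{\mathbb{Z}}$. $P:E\times F\times\mathcal{B}(E\times F)\to[0,1]$ is a Markov transition kernel, and $\mathbf{P}^\mu$ is the law of the Markov chain $(X_n,Y_n)_{n\ge 0}$ with transition kernel $P$ and initial law $(X_0,Y_0)\sim\mu$; $\mathbf{P}^{x,y}=\mathbf{P}^{\delta_x\otimes\delta_y}$. $\lambda$ is a fixed invariant probability of $P$, and $\mathbf{P}=\mathbf{P}^\lambda$. $\mathcal{F}^Y_{m,n}=\sigma\{Y_k:m\le k\le n\}$ and $\mathcal{F}^J_{m,n}=\sigma\{X_k^J,Y_k:m\le k\le n\}$ ($n=\infty$ allowed). $\Pi_n^\mu=\mathbf{P}^\mu[\,\cdot\,|\mathcal{F}^Y_{0,n}]$ and $\pi_n^\mu=\mathbf{P}^\mu[X_n\in\cdot\,|\mathcal{F}^Y_{0,n}]$ (regular conditional probabilities, regarded as kernels that are functions of $Y_0,\ldots,Y_n$; versions are fixed arbitrarily),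 $\Pi_n=\Pi_n^\lambda$, $\pi_n=\pi_n^\lambda$. For probability measures $\rho,\rho'$ and a $\sigma$-field $\mathcal{G}$, $\|\rho-\rho'\|_{\mathcal{G}}=2\sup_{A\in\mathcal{G}}|\rho(A)-\rho'(A)|$. $\mu(E\times\cdot)$ is the marginal of $\mu$ on $F$; $\ll$ and $\sim$ denote absolute continuity and equivalence. *)

theory Defs
  imports "HOL-Probability.Probability"
begin

section \<open>Polish coordinate spaces\<close>

definition polish_topology :: "'a topology \<Rightarrow> bool" where
  "polish_topology T \<longleftrightarrow> completely_metrizable_space T \<and> second_countable T"

definition borel_of :: "'a topology \<Rightarrow> 'a measure" where
  "borel_of T = sigma (topspace T) {U. openin T U}"

text \<open>
  The inclusion of \<open>E\<close> into the product of the \<open>E\<^sup>i\<close> is represented by an injective map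
  \<open>emb\<close> on the type \<open>'e\<close>, so that \<open>emb x i\<close> is the coordinate \<open>x\<^sup>i\<close>; the Polish spaces
  \<open>E\<^sup>i\<close> are topologies \<open>T i\<close> on subsets of one type, hence may differ from each other.
  Only the Borel structure of \<open>E\<close> is tied to that of the product, not its topology.
\<close>

definition coordinate_inclusion ::
  "'i set \<Rightarrow> ('i \<Rightarrow> 'b topology) \<Rightarrow> ('e::topological_space \<Rightarrow> 'i \<Rightarrow> 'b) \<Rightarrow> bool" where
  "coordinate_inclusion I T emb \<longleftrightarrow>
     inj emb \<and> range emb \<subseteq> (\<Pi>\<^sub>E i\<in>I. topspace (T i)) \<and>
     sets (borel :: 'e measure) = sets (vimage_algebra UNIV emb (\<Pi>\<^sub>M i\<in>I. borel_of (T i)))"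

definition local_field ::
  "('i \<Rightarrow> 'b topology) \<Rightarrow> ('e \<Rightarrow> 'i \<Rightarrow> 'b) \<Rightarrow> 'i set \<Rightarrow> 'e measure" where
  "local_field T emb J =
     vimage_algebra UNIV (\<lambda>x. restrict (emb x) J) (\<Pi>\<^sub>M i\<in>J. borel_of (T i))"


section \<open>The canonical Markov chain\<close>

text \<open>
  A path \<open>\<omega>\<close> is a function of type \<open>nat \<Rightarrow> 'e \<times> 'f\<close>, with \<open>X\<^sub>n = fst (\<omega> n)\<close> and
  \<open>Y\<^sub>n = snd (\<omega> n)\<close>. Only nonnegative times occur below.
\<close>

abbreviation path_space :: "(nat \<Rightarrow> 'a::topological_space) measure" where
  "path_space \<equiv> \<Pi>\<^sub>M n\<in>UNIV. borel"

definition transition ::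
  "('a \<Rightarrow> 'a measure) \<Rightarrow> 'a measure \<Rightarrow> nat \<Rightarrow> (nat \<Rightarrow> 'a) \<Rightarrow> 'a measure" where
  "transition P \<mu> n \<omega> = (case n of 0 \<Rightarrow> \<mu> | Suc m \<Rightarrow> P (\<omega> m))"

text \<open>The law on path space, built with the Ionescu-Tulcea theorem.\<close>

definition chain_law ::
  "('a::topological_space \<Rightarrow> 'a measure) \<Rightarrow> 'a measure \<Rightarrow> (nat \<Rightarrow> 'a) measure" where
  "chain_law P \<mu> =
     projective_family.lim UNIV (Ionescu_Tulcea.CI (transition P \<mu>) (\<lambda>_. borel)) (\<lambda>_. borel)"

lemma Ionescu_Tulcea_transition:
  fixes P :: "'a::topological_space \<Rightarrow> 'a measure"
  assumes P: "P \<in> borel \<rightarrow>\<^sub>M prob_algebra borel" and \<mu>: "\<mu> \<in> space (prob_algebra borel)"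
  shows "Ionescu_Tulcea (transition P \<mu>) (\<lambda>_. borel)"
proof (rule Ionescu_Tulcea.intro)
  have P': "P \<in> borel \<rightarrow>\<^sub>M subprob_algebra borel"
    by (rule measurable_prob_algebraD[OF P])
  show "transition P \<mu> n \<in> (\<Pi>\<^sub>M i\<in>{0..<n}. borel) \<rightarrow>\<^sub>M subprob_algebra borel" for n
  proof (cases n)
    case 0
    have "\<mu> \<in> space (subprob_algebra borel)"
      using \<mu> by (auto simp: space_prob_algebra space_subprob_algebra prob_space_imp_subprob_space)
    then have "(\<lambda>_. \<mu>) \<in> (\<Pi>\<^sub>M i\<in>{0..<n}. borel) \<rightarrow>\<^sub>M subprob_algebra borel"
      by (rule measurable_const)
    moreover have "transition P \<mu> n = (\<lambda>_. \<mu>)"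
      using 0 by (simp add: transition_def fun_eq_iff)
    ultimately show ?thesis by simp
  next
    case (Suc m)
    have "(\<lambda>\<omega>. P (\<omega> m)) \<in> (\<Pi>\<^sub>M i\<in>{0..<n}. borel) \<rightarrow>\<^sub>M subprob_algebra borel"
      using Suc by (intro measurable_compose[OF measurable_component_singleton[of m "{0..<n}" "\<lambda>_. borel"] P']) simp
    moreover have "transition P \<mu> n = (\<lambda>\<omega>. P (\<omega> m))"
      using Suc by (simp add: transition_def fun_eq_iff)
    ultimately show ?thesis by simp
  qed
  show "prob_space (transition P \<mu> n \<omega>)"
    if "\<omega> \<in> space (\<Pi>\<^sub>M i\<in>{0..<n}. borel)" for n \<omega>
    using \<mu> measurable_space[OF P]
    by (auto simp: transition_def space_prob_algebra split: nat.split)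
qed

lemma chain_law_in_prob_algebra:
  fixes P :: "'a::topological_space \<Rightarrow> 'a measure"
  assumes "P \<in> borel \<rightarrow>\<^sub>M prob_algebra borel" and "\<mu> \<in> space (prob_algebra borel)"
  shows "chain_law P \<mu> \<in> space (prob_algebra path_space)"
proof -
  interpret Ionescu_Tulcea "transition P \<mu>" "\<lambda>_. borel"
    by (rule Ionescu_Tulcea_transition[OF assms])
  show ?thesis
    unfolding chain_law_def space_prob_algebra
    using PF.sets_lim lim[of "{}" "{\<lambda>_. undefined}"]
      PF.prob_space_P[of "{}", THEN prob_space.emeasure_space_1]
    by (auto intro!: prob_spaceI
        simp: prod_emb_def PF.space_P space_PiM sets_PiM_empty restrict_def vimage_def)
qed

text \<open>The initial law is \<open>\<mu>\<close> and, given the path before time \<open>n + 1\<close>, the next state has law \<open>P (\<omega> n)\<close>.\<close>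

lemma chain_law_step:
  fixes P :: "'a::topological_space \<Rightarrow> 'a measure"
  assumes "P \<in> borel \<rightarrow>\<^sub>M prob_algebra borel" and "\<mu> \<in> space (prob_algebra borel)"
  shows "distr (chain_law P \<mu>) (PiM {0..<Suc n} (\<lambda>_. borel)) (\<lambda>x. restrict x {0..<Suc n}) =
     distr (chain_law P \<mu>) (PiM {0..<n} (\<lambda>_. borel)) (\<lambda>x. restrict x {0..<n}) \<bind>
       (\<lambda>\<omega>. distr (case n of 0 \<Rightarrow> \<mu> | Suc m \<Rightarrow> P (\<omega> m)) (PiM {0..<Suc n} (\<lambda>_. borel)) (fun_upd \<omega> n))"
proof -
  interpret Ionescu_Tulcea "transition P \<mu>" "\<lambda>_. borel"
    by (rule Ionescu_Tulcea_transition[OF assms])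
  have u: "up_to {0..<n} = n" for n
    using up_to_iff_Ico[of "{0..<n}" n] up_to[of "{0..<n}"] by (auto intro!: antisym)
  have "CI {0..<n} = C 0 n (\<lambda>x. undefined)" for n
    unfolding CI_def u
    using distr_C[of n n "\<lambda>x. undefined" 0] by (simp add: space_PiM)
  then show ?thesis
    unfolding chain_law_def distr_lim[OF finite_atLeastLessThan]
    by (simp add: eP_def[abs_def] transition_def)
qed

definition markov_invariant :: "('a \<Rightarrow> 'a measure) \<Rightarrow> 'a measure \<Rightarrow> bool" where
  "markov_invariant P \<mu> \<longleftrightarrow> \<mu> \<bind> P = \<mu>"

text \<open>The set \<open>K\<close> of times is \<open>{m..n}\<close>, or \<open>{m..}\<close> for \<open>n = \<infinity>\<close>. For
  \<open>K = {n - r..}\<close> the truncated subtraction is immaterial in the limit of large \<open>n\<close>.\<close>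

definition field_Y :: "nat set \<Rightarrow> (nat \<Rightarrow> 'e \<times> 'f::topological_space) measure" where
  "field_Y K = sigma UNIV (\<Union>k\<in>K. sets (vimage_algebra UNIV (\<lambda>\<omega>. snd (\<omega> k)) borel))"

definition field_XY ::
  "('i \<Rightarrow> 'b topology) \<Rightarrow> ('e \<Rightarrow> 'i \<Rightarrow> 'b) \<Rightarrow> 'i set \<Rightarrow> nat set
     \<Rightarrow> (nat \<Rightarrow> 'e \<times> 'f::topological_space) measure" where
  "field_XY T emb J K = sigma UNIV (\<Union>k\<in>K. sets (vimage_algebra UNIV
     (\<lambda>\<omega>. (restrict (emb (fst (\<omega> k))) J, snd (\<omega> k))) ((\<Pi>\<^sub>M i\<in>J. borel_of (T i)) \<Otimes>\<^sub>M borel)))"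


section \<open>Distances, mixing, nondegeneracy and conditioning\<close>

definition tv_dist :: "'a set set \<Rightarrow> 'a measure \<Rightarrow> 'a measure \<Rightarrow> real" where
  "tv_dist \<G> \<rho> \<rho>' = 2 * (SUP A\<in>\<G>. \<bar>measure \<rho> A - measure \<rho>' A\<bar>)"

definition locally_mixing ::
  "'i set \<Rightarrow> ('i \<Rightarrow> 'b topology) \<Rightarrow> ('e::topological_space \<Rightarrow> 'i \<Rightarrow> 'b)
     \<Rightarrow> ('e \<times> 'f::topological_space \<Rightarrow> ('e \<times> 'f) measure) \<Rightarrow> ('e \<times> 'f) measure \<Rightarrow> bool" where
  "locally_mixing I T emb P \<nu> \<longleftrightarrow>
     (\<forall>x y J. J \<subseteq> I \<longrightarrow> finite J \<longrightarrow>
        (\<lambda>n. tv_dist (sets (field_XY T emb J {n..}))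
               (chain_law P (return borel (x, y))) (chain_law P \<nu>)) \<longlonglongrightarrow> 0)"

definition nondegenerate ::
  "('e::topological_space \<times> 'f::topological_space \<Rightarrow> ('e \<times> 'f) measure) \<Rightarrow> bool" where
  "nondegenerate P \<longleftrightarrow>
     (\<exists>(P0 :: 'e \<Rightarrow> 'e measure) (Q :: 'f \<Rightarrow> 'f measure)
        (g :: ('e \<times> 'f) \<times> ('e \<times> 'f) \<Rightarrow> real).
        P0 \<in> borel \<rightarrow>\<^sub>M prob_algebra borel \<and>
        Q \<in> borel \<rightarrow>\<^sub>M prob_algebra borel \<and>
        g \<in> borel_measurable borel \<and> (\<forall>z z'. 0 < g (z, z')) \<and>
        (\<forall>x y. P (x, y) = density (P0 x \<Otimes>\<^sub>M Q y) (\<lambda>z'. ennreal (g ((x, y), z')))))"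

text \<open>
  \<open>\<kappa>\<close> is a version of the regular conditional law under \<open>M\<close> of the random variable
  \<open>Z\<close>, with values in \<open>N\<close>, given the sub-\<open>\<sigma>\<close>-field \<open>G\<close>. Measurability of \<open>\<kappa>\<close> with respect
  to \<open>G = field_Y {0..n}\<close> expresses that \<open>\<kappa>\<close> is a function of \<open>Y\<^sub>0, \<dots>, Y\<^sub>n\<close>; in particular
  \<open>\<kappa>\<close> is defined on every path and can be evaluated under other laws than \<open>M\<close>.
\<close>

definition regular_cond_law ::
  "'a measure \<Rightarrow> 'a measure \<Rightarrow> 'b measure \<Rightarrow> ('a \<Rightarrow> 'b) \<Rightarrow> ('a \<Rightarrow> 'b measure) \<Rightarrow> bool" where
  "regular_cond_law M G N Z \<kappa> \<longleftrightarrow>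
     \<kappa> \<in> G \<rightarrow>\<^sub>M prob_algebra N \<and>
     (\<forall>A\<in>sets N. AE \<omega> in M.
        measure (\<kappa> \<omega>) A = real_cond_exp M G (indicator (Z -` A \<inter> space M)) \<omega>)"

end

theory Submission
  imports Defs
begin

text \<open>
  Fix a finite set \<open>J\<close> of coordinates. Let \<open>G\<^sub>m\<close> be the field generated by all observations
  \<open>Y\<close> and by the local states \<open>X\<^sub>k\<^sup>J\<close> with \<open>k \<ge> m\<close>, let the tail field be the
  intersection of all \<open>G\<^sub>m\<close>, and let \<open>K z\<close> be the law of the chain started at \<open>z\<close>. Filter
  stability is reduced to the statement that the tail field contains no more information than the
  observations. The proof has three steps.

  First, the null events of the tail field under \<open>K (x, y)\<close> do not depend on \<open>x\<close>. By
  nondegeneracy the chain has the same null events as a decoupled one, in which the signal and the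
  observations evolve independently up to time \<open>m\<close> (\<open>null_iff_decoupled_null\<close>). In the
  decoupled chain the law of the early observations given the future after \<open>m\<close> is the same for
  all \<open>x\<close> (\<open>decoupled_common_conditional\<close>). Hence a \<open>K (x, y)\<close>-null event of \<open>G\<^sub>m\<close>
  is, up to a \<open>K (x', y)\<close>-null event, contained in an event of the local future after \<open>m\<close>
  that is \<open>K (x, y)\<close>-null (\<open>path_null_transfer\<close>), and local mixing makes the
  \<open>K (x', y)\<close>-probability of the latter small. Letting \<open>m\<close> tend to infinity gives
  \<open>tail_null_transfer\<close>.

  Second, under the stationary law every tail event \<open>A\<close> agrees almost surely with an event of the
  observations (\<open>tail_field_eq_obs_field\<close>). The conditional probability \<open>u\<^sub>n\<close> of \<open>A\<close>
  given the path up to time \<open>n\<close> converges to the indicator of \<open>A\<close>. By the Markov property it is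
  the \<open>K (X\<^sub>n, Y\<^sub>n)\<close>-probability of a section of \<open>A\<close>, and the section depends on the
  past observations only. Let \<open>v\<^sub>n\<close> be obtained by starting from
  \<open>(x\<^sub>0, Y\<^sub>n)\<close> instead, with a fixed point \<open>x\<^sub>0\<close>; this is a function of the observations.
  A quantitative form of the first step (\<open>tail_domination\<close>) bounds \<open>v\<^sub>n\<close> by
  \<open>m * u\<^sub>n + a\<^sub>m (X\<^sub>n, Y\<^sub>n)\<close> with \<open>a\<^sub>m\<close> tending to zero, and the same for the complement of
  \<open>A\<close>. By stationarity the mean of \<open>a\<^sub>m (X\<^sub>n, Y\<^sub>n)\<close> is the same for all \<open>n\<close>, so \<open>v\<^sub>n\<close>
  converges to the indicator of \<open>A\<close> too.

  Third, let \<open>P\<^sub>1\<close>, \<open>P\<^sub>2\<close> be the laws of the chain for two initial laws and \<open>D\<close> the density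
  of \<open>P\<^sub>1\<close> with respect to \<open>M = (P\<^sub>1 + P\<^sub>2) / 2\<close>. By Bayes' formula the distance on
  \<open>G\<^sub>n\<^sub>-\<^sub>r\<close> between the two conditional laws given \<open>Y\<^sub>0, \<dots>, Y\<^sub>n\<close> is controlled by the
  conditional \<open>M\<close>-mean of the distance between \<open>E (D | G\<^sub>n\<^sub>-\<^sub>r)\<close> and
  \<open>E (D | Y\<^sub>0, \<dots>, Y\<^sub>n)\<close>. By the second step and Levy's theorems in both directions of
  time these two martingales have the same limit \<open>E (D | Y)\<close>, which gives
  \<open>conditional_laws_merge\<close>. The smoothing and the filtering statement are both instances of it.
\<close>

section \<open>Convergence of bounded martingales\<close>

context prob_space begin

lemma sigma_finite_subalgebra_of_prob: "subalgebra M F \<Longrightarrow> sigma_finite_subalgebra M F"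
  by (intro finite_measure_subalgebra_is_sigma_finite finite_measure_subalgebra.intro
      finite_measure_subalgebra_axioms.intro finite_measure_axioms)

lemma integrable_AE_bounded:
  fixes U :: "'a \<Rightarrow> real"
  assumes "U \<in> borel_measurable M" "AE \<omega> in M. \<bar>U \<omega>\<bar> \<le> C"
  shows "integrable M U"
  using assms by (intro integrable_const_bound[of _ C]) auto

lemma AE_bounded_cond_exp:
  assumes F: "subalgebra M F" and U[measurable]: "U \<in> borel_measurable M" and C: "AE \<omega> in M. \<bar>U \<omega>\<bar> \<le> C"
  shows "AE \<omega> in M. \<bar>real_cond_exp M F U \<omega>\<bar> \<le> C"
proof -
  interpret F: sigma_finite_subalgebra M F by (rule sigma_finite_subalgebra_of_prob[OF F])
  have int: "integrable M U" by (rule integrable_AE_bounded[OF U C])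
  have "AE \<omega> in M. U \<omega> \<le> C" "AE \<omega> in M. U \<omega> \<ge> - C"
    using C by (eventually_elim, auto)+
  from F.real_cond_exp_le_c[OF int this(1)] F.real_cond_exp_ge_c[OF int this(2)]
  show ?thesis by eventually_elim auto
qed

text \<open>
  Because \<open>U - E (U | F)\<close> is orthogonal to the functions measurable with respect to \<open>F\<close>.
\<close>

lemma cond_exp_sq_integral_le:
  assumes F: "subalgebra M F" and U[measurable]: "U \<in> borel_measurable M" and C: "AE \<omega> in M. \<bar>U \<omega>\<bar> \<le> C"
    and A: "A \<in> sets F"
  shows "(\<integral>\<omega>. indicator A \<omega> * (real_cond_exp M F U \<omega>)\<^sup>2 \<partial>M) \<le> (\<integral>\<omega>. indicator A \<omega> * (U \<omega>)\<^sup>2 \<partial>M)"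
proof -
  interpret F: sigma_finite_subalgebra M F by (rule sigma_finite_subalgebra_of_prob[OF F])
  have [measurable]: "A \<in> sets M" using A F by (auto simp: subalgebra_def)
  note A[measurable]
  let ?V = "real_cond_exp M F U"
  have V: "AE \<omega> in M. \<bar>?V \<omega>\<bar> \<le> C" by (rule AE_bounded_cond_exp[OF F U C])
  have b: "AE \<omega> in M. \<bar>indicator A \<omega> * (f \<omega> * g \<omega>)\<bar> \<le> C * C"
    if "AE \<omega> in M. \<bar>f \<omega>\<bar> \<le> C" "AE \<omega> in M. \<bar>g \<omega>\<bar> \<le> C" for f g :: "'a \<Rightarrow> real"
    using that by eventually_elim (auto simp: indicator_def abs_mult intro!: mult_mono order_trans[OF abs_ge_zero] split: if_splits)
  have i1: "integrable M (\<lambda>\<omega>. indicator A \<omega> * (?V \<omega> * ?V \<omega>))"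
    and i2: "integrable M (\<lambda>\<omega>. indicator A \<omega> * (?V \<omega> * U \<omega>))"
    and i3: "integrable M (\<lambda>\<omega>. indicator A \<omega> * (U \<omega> * U \<omega>))"
    by (rule integrable_AE_bounded[OF _ b]; (fact V | fact C | measurable))+
  have eq: "(\<integral>\<omega>. indicator A \<omega> * (?V \<omega> * ?V \<omega>) \<partial>M) = (\<integral>\<omega>. indicator A \<omega> * (?V \<omega> * U \<omega>) \<partial>M)"
    using F.real_cond_exp_intg(2)[of "\<lambda>\<omega>. indicator A \<omega> * ?V \<omega>" U] i2 by (simp add: mult.assoc)
  have "0 \<le> (\<integral>\<omega>. indicator A \<omega> * (U \<omega> - ?V \<omega>)\<^sup>2 \<partial>M)" by simp
  also have "(\<lambda>\<omega>. indicator A \<omega> * (U \<omega> - ?V \<omega>)\<^sup>2) = (\<lambda>\<omega>. indicator A \<omega> * (U \<omega> * U \<omega>)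
      - 2 * (indicator A \<omega> * (?V \<omega> * U \<omega>)) + indicator A \<omega> * (?V \<omega> * ?V \<omega>) :: real)"
    by (auto simp: power2_eq_square algebra_simps)
  finally show ?thesis using i1 i2 i3 eq by (simp add: power2_eq_square)
qed

text \<open>
  Doob's inequality, for a finite chain of fields. Only finitely many fields occur, so that it applies
  to a decreasing sequence of fields as well, after reversing the order of the indices.
\<close>

lemma maximal_inequality:
  fixes H :: "nat \<Rightarrow> 'a measure"
  assumes sub: "\<And>i. i \<le> N \<Longrightarrow> subalgebra M (H i)"
    and mono: "\<And>i j. i \<le> j \<Longrightarrow> j \<le> N \<Longrightarrow> sets (H i) \<subseteq> sets (H j)"
    and U[measurable]: "U \<in> borel_measurable M" and C: "AE \<omega> in M. \<bar>U \<omega>\<bar> \<le> C" and c: "0 < c"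
  shows "prob {\<omega> \<in> space M. \<exists>i\<le>N. c < \<bar>real_cond_exp M (H i) U \<omega>\<bar>} \<le> (\<integral>\<omega>. (U \<omega>)\<^sup>2 \<partial>M) / c\<^sup>2"
proof -
  let ?V = "\<lambda>i. real_cond_exp M (H i) U"
  \<comment> \<open>The threshold is exceeded for the first time at \<open>i\<close>.\<close>
  define A where "A i = {\<omega> \<in> space M. c < \<bar>?V i \<omega>\<bar> \<and> (\<forall>j<i. \<not> c < \<bar>?V j \<omega>\<bar>)}" for i
  have A_H: "A i \<in> sets (H i)" if "i \<le> N" for i
  proof -
    have sp: "space (H i) = space M" using sub[OF that] by (simp add: subalgebra_def)
    have "?V j \<in> borel_measurable (H i)" if "j \<le> i" for j
    proof -
      have "subalgebra (H i) (H j)"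
        using sub[of j] sub[of i] mono[of j i] \<open>i \<le> N\<close> that by (auto simp: subalgebra_def)
      then show ?thesis by (rule measurable_from_subalg) simp
    qed
    then have "{\<omega> \<in> space (H i). c < \<bar>?V i \<omega>\<bar> \<and> (\<forall>j\<in>{..<i}. \<not> c < \<bar>?V j \<omega>\<bar>)} \<in> sets (H i)"
      by (intro sets.sets_Collect_conj sets.sets_Collect_finite_All) (auto intro!: borel_measurable_less borel_measurable_const borel_measurable_abs)
    moreover have "{\<omega> \<in> space (H i). c < \<bar>?V i \<omega>\<bar> \<and> (\<forall>j\<in>{..<i}. \<not> c < \<bar>?V j \<omega>\<bar>)} = A i"
      unfolding A_def sp by blast
    ultimately show ?thesis by (simp only:)
  qed
  have A_M: "A i \<in> sets M" if "i \<le> N" for i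
    using A_H[OF that] sub[OF that] by (auto simp: subalgebra_def)
  have disj: "disjoint_family_on A {..N}"
    unfolding disjoint_family_on_def
  proof (intro ballI impI)
    fix i j :: nat assume "i \<noteq> j"
    then consider "i < j" | "j < i" by linarith
    then show "A i \<inter> A j = {}" by cases (auto simp: A_def)
  qed
  have un: "{\<omega> \<in> space M. \<exists>i\<le>N. c < \<bar>?V i \<omega>\<bar>} = (\<Union>i\<le>N. A i)"
  proof safe
    fix \<omega> i assume "\<omega> \<in> space M" "i \<le> N" "c < \<bar>?V i \<omega>\<bar>"
    then have "\<omega> \<in> A (LEAST i. c < \<bar>?V i \<omega>\<bar>)" "(LEAST i. c < \<bar>?V i \<omega>\<bar>) \<le> N"
      unfolding A_def using not_less_Least LeastI[of "\<lambda>i. c < \<bar>?V i \<omega>\<bar>" i]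
      by (auto intro: Least_le[THEN order_trans])
    then show "\<omega> \<in> (\<Union>i\<le>N. A i)" by auto
  qed (auto simp: A_def)
  have int: "integrable M (\<lambda>\<omega>. indicator (A i) \<omega> * (f \<omega>)\<^sup>2)"
    if "i \<le> N" "AE \<omega> in M. \<bar>f \<omega>\<bar> \<le> C" "f \<in> borel_measurable M" for i and f :: "'a \<Rightarrow> real"
  proof (rule integrable_AE_bounded)
    show "AE \<omega> in M. \<bar>indicator (A i) \<omega> * (f \<omega>)\<^sup>2\<bar> \<le> C\<^sup>2"
      using that(2) by eventually_elim (auto simp: indicator_def abs_le_square_iff[symmetric])
  qed (use A_M[OF that(1)] that(3) in measurable)
  have piece: "c\<^sup>2 * prob (A i) \<le> (\<integral>\<omega>. indicator (A i) \<omega> * (U \<omega>)\<^sup>2 \<partial>M)" if i: "i \<le> N" for i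
  proof -
    have "c\<^sup>2 * prob (A i) = (\<integral>\<omega>. indicator (A i) \<omega> * c\<^sup>2 \<partial>M)"
      using A_M[OF i] by simp
    also have "\<dots> \<le> (\<integral>\<omega>. indicator (A i) \<omega> * (?V i \<omega>)\<^sup>2 \<partial>M)"
    proof (rule integral_mono)
      show "integrable M (\<lambda>\<omega>. indicator (A i) \<omega> * (?V i \<omega>)\<^sup>2)"
        by (rule int[OF i AE_bounded_cond_exp[OF sub[OF i] U C]]) simp
      show "integrable M (\<lambda>\<omega>. indicator (A i) \<omega> * c\<^sup>2)"
        using A_M[OF i] by (intro integrable_mult_left integrable_real_indicator) (auto simp: emeasure_eq_measure)
      show "indicator (A i) \<omega> * c\<^sup>2 \<le> indicator (A i) \<omega> * (?V i \<omega>)\<^sup>2" for \<omega>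
        using c by (auto simp: indicator_def A_def abs_le_square_iff[symmetric])
    qed
    also have "\<dots> \<le> (\<integral>\<omega>. indicator (A i) \<omega> * (U \<omega>)\<^sup>2 \<partial>M)"
      by (rule cond_exp_sq_integral_le[OF sub[OF i] U C A_H[OF i]])
    finally show ?thesis .
  qed
  have "c\<^sup>2 * prob (\<Union>i\<le>N. A i) = (\<Sum>i\<le>N. c\<^sup>2 * prob (A i))"
    using A_M disj by (subst finite_measure_finite_Union) (auto simp: sum_distrib_left)
  also have "\<dots> \<le> (\<Sum>i\<le>N. \<integral>\<omega>. indicator (A i) \<omega> * (U \<omega>)\<^sup>2 \<partial>M)"
    by (rule sum_mono) (simp add: piece)
  also have "\<dots> = (\<integral>\<omega>. (\<Sum>i\<le>N. indicator (A i) \<omega> * (U \<omega>)\<^sup>2) \<partial>M)"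
    by (rule Bochner_Integration.integral_sum[symmetric]) (simp add: int C)
  also have "\<dots> \<le> (\<integral>\<omega>. (U \<omega>)\<^sup>2 \<partial>M)"
  proof (rule integral_mono)
    show "integrable M (\<lambda>\<omega>. (U \<omega>)\<^sup>2)"
    proof (rule integrable_AE_bounded)
      show "AE \<omega> in M. \<bar>(U \<omega>)\<^sup>2\<bar> \<le> C\<^sup>2"
        using C by eventually_elim (auto simp: abs_le_square_iff[symmetric])
    qed measurable
    show "integrable M (\<lambda>\<omega>. \<Sum>i\<le>N. indicator (A i) \<omega> * (U \<omega>)\<^sup>2)"
      by (rule Bochner_Integration.integrable_sum) (simp add: int C)
    show "(\<Sum>i\<le>N. indicator (A i) \<omega> * (U \<omega>)\<^sup>2) \<le> (U \<omega>)\<^sup>2" for \<omega>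
    proof -
      have "(\<Sum>i\<le>N. indicator (A i) \<omega> :: real) = indicator (\<Union>i\<le>N. A i) \<omega>"
        using disj by (intro indicator_UN_disjoint[symmetric]) auto
      then show ?thesis
        by (simp add: sum_distrib_right[symmetric] indicator_def)
    qed
  qed
  finally show ?thesis using c unfolding un by (simp add: field_simps)
qed

text \<open>
  The form in which estimates of probabilities are turned into almost sure statements below.
\<close>

lemma AE_ex_not_bad:
  assumes [measurable]: "\<And>k::nat. B k \<in> sets M" and small: "\<And>\<delta>. 0 < \<delta> \<Longrightarrow> \<exists>k. prob (B k) \<le> \<delta>"
  shows "AE \<omega> in M. \<exists>k. \<omega> \<notin> B k"
proof -
  have "prob (\<Inter>k. B k) \<le> 0"
  proof (rule field_le_epsilon)
    fix \<delta> :: real assume "0 < \<delta>"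
    then obtain k where "prob (B k) \<le> \<delta>" using small by blast
    moreover have "prob (\<Inter>k. B k) \<le> prob (B k)" by (rule finite_measure_mono) auto
    ultimately show "prob (\<Inter>k. B k) \<le> 0 + \<delta>" by simp
  qed
  then have "prob (\<Inter>k. B k) = 0" by (simp add: measure_le_0_iff)
  then have "(\<Inter>k. B k) \<in> null_sets M" by (auto simp: null_sets_def emeasure_eq_measure)
  then have "AE \<omega> in M. \<omega> \<notin> (\<Inter>k. B k)" by (rule AE_not_in)
  then show ?thesis by eventually_elim auto
qed

lemma prob_ex_le_bound:
  assumes [measurable]: "\<And>n::nat. Measurable.pred M (Q n)"
    and b: "\<And>N. prob {\<omega> \<in> space M. \<exists>n\<le>N. Q n \<omega>} \<le> b"
  shows "prob {\<omega> \<in> space M. \<exists>n. Q n \<omega>} \<le> b"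
proof -
  have "(\<lambda>N. prob {\<omega> \<in> space M. \<exists>n\<le>N. Q n \<omega>}) \<longlonglongrightarrow> prob (\<Union>N. {\<omega> \<in> space M. \<exists>n\<le>N. Q n \<omega>})"
    by (rule finite_Lim_measure_incseq) (auto simp: incseq_def, meson order_trans)
  moreover have "(\<Union>N. {\<omega> \<in> space M. \<exists>n\<le>N. Q n \<omega>}) = {\<omega> \<in> space M. \<exists>n. Q n \<omega>}" by auto
  ultimately show ?thesis using b by (intro LIMSEQ_le_const2) auto
qed

lemma AE_Cauchy_criterion:
  fixes X :: "nat \<Rightarrow> 'a \<Rightarrow> real"
  assumes [measurable]: "\<And>n. X n \<in> borel_measurable M"
    and small: "\<And>\<epsilon> \<delta>. 0 < \<epsilon> \<Longrightarrow> 0 < \<delta> \<Longrightarrow> \<exists>k. prob {\<omega> \<in> space M. \<exists>n. \<epsilon> < \<bar>X (k + n) \<omega> - X k \<omega>\<bar>} \<le> \<delta>"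
  shows "AE \<omega> in M. Cauchy (\<lambda>n. X n \<omega>)"
proof -
  have "AE \<omega> in M. \<exists>k. \<forall>n. \<bar>X (k + n) \<omega> - X k \<omega>\<bar> \<le> \<epsilon>" if "0 < \<epsilon>" for \<epsilon>
  proof -
    have "AE \<omega> in M. \<exists>k. \<omega> \<notin> {\<omega> \<in> space M. \<exists>n. \<epsilon> < \<bar>X (k + n) \<omega> - X k \<omega>\<bar>}"
      by (rule AE_ex_not_bad[OF _ small[OF that]]) simp
    with AE_space show ?thesis by eventually_elim (auto simp: not_less)
  qed
  then have "AE \<omega> in M. \<forall>m. \<exists>k. \<forall>n. \<bar>X (k + n) \<omega> - X k \<omega>\<bar> \<le> inverse (real (Suc m))"
    by (intro AE_all_countable[THEN iffD2]) simp
  then show ?thesis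
  proof eventually_elim
    fix \<omega> assume *: "\<forall>m. \<exists>k. \<forall>n. \<bar>X (k + n) \<omega> - X k \<omega>\<bar> \<le> inverse (real (Suc m))"
    show "Cauchy (\<lambda>n. X n \<omega>)"
    proof (rule metric_CauchyI)
      fix e :: real assume "0 < e"
      then obtain m where m: "inverse (real (Suc m)) < e / 2"
        using reals_Archimedean[of "e / 2"] by auto
      obtain k where k: "\<And>n. \<bar>X (k + n) \<omega> - X k \<omega>\<bar> \<le> inverse (real (Suc m))" using * by blast
      have "dist (X i \<omega>) (X j \<omega>) < e" if "k \<le> i" "k \<le> j" for i j
        using k[of "i - k"] k[of "j - k"] that m by (simp add: dist_real_def)
      then show "\<exists>M. \<forall>m\<ge>M. \<forall>n\<ge>M. dist (X m \<omega>) (X n \<omega>) < e" by blast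
    qed
  qed
qed

text \<open>
  Increments of a martingale are orthogonal. So the second moments are monotone along a monotone
  sequence of fields, and their convergence makes the martingale a Cauchy sequence.
\<close>

lemma cond_exp_diff_sq:
  assumes F: "subalgebra M F" and G: "subalgebra M G" and FG: "sets F \<subseteq> sets G"
    and U[measurable]: "U \<in> borel_measurable M" and C: "AE \<omega> in M. \<bar>U \<omega>\<bar> \<le> C"
  shows "(\<integral>\<omega>. (real_cond_exp M G U \<omega> - real_cond_exp M F U \<omega>)\<^sup>2 \<partial>M)
    = (\<integral>\<omega>. (real_cond_exp M G U \<omega>)\<^sup>2 \<partial>M) - (\<integral>\<omega>. (real_cond_exp M F U \<omega>)\<^sup>2 \<partial>M)"
proof -
  interpret F: sigma_finite_subalgebra M F by (rule sigma_finite_subalgebra_of_prob[OF F])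
  interpret G: sigma_finite_subalgebra M G by (rule sigma_finite_subalgebra_of_prob[OF G])
  let ?V = "real_cond_exp M F U" and ?W = "real_cond_exp M G U"
  have V: "AE \<omega> in M. \<bar>?V \<omega>\<bar> \<le> C" and W: "AE \<omega> in M. \<bar>?W \<omega>\<bar> \<le> C"
    by (rule AE_bounded_cond_exp[OF _ U C]; fact)+
  have b: "AE \<omega> in M. \<bar>f \<omega> * g \<omega>\<bar> \<le> C * C"
    if "AE \<omega> in M. \<bar>f \<omega>\<bar> \<le> C" "AE \<omega> in M. \<bar>g \<omega>\<bar> \<le> C" for f g :: "'a \<Rightarrow> real"
    using that by eventually_elim (auto simp: abs_mult intro!: mult_mono order_trans[OF abs_ge_zero])
  have VG: "?V \<in> borel_measurable G"
    using F G FG by (intro measurable_from_subalg[of G F]) (auto simp: subalgebra_def)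
  have i1: "integrable M (\<lambda>\<omega>. ?V \<omega> * ?V \<omega>)" and i2: "integrable M (\<lambda>\<omega>. ?V \<omega> * ?W \<omega>)"
    and i3: "integrable M (\<lambda>\<omega>. ?W \<omega> * ?W \<omega>)" and i4: "integrable M (\<lambda>\<omega>. ?V \<omega> * U \<omega>)"
    by (rule integrable_AE_bounded[OF _ b]; (fact V | fact W | fact C | measurable))+
  have "(\<integral>\<omega>. ?V \<omega> * ?W \<omega> \<partial>M) = (\<integral>\<omega>. ?V \<omega> * U \<omega> \<partial>M)"
    by (rule G.real_cond_exp_intg(2)[OF i4 VG]) simp
  also have "\<dots> = (\<integral>\<omega>. ?V \<omega> * ?V \<omega> \<partial>M)"
    by (rule F.real_cond_exp_intg(2)[OF i4, symmetric]) simp_all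
  finally have eq: "(\<integral>\<omega>. ?V \<omega> * ?W \<omega> \<partial>M) = (\<integral>\<omega>. ?V \<omega> * ?V \<omega> \<partial>M)" .
  have "(\<lambda>\<omega>. (?W \<omega> - ?V \<omega>)\<^sup>2) = (\<lambda>\<omega>. ?W \<omega> * ?W \<omega> - 2 * (?V \<omega> * ?W \<omega>) + ?V \<omega> * ?V \<omega>)"
    by (auto simp: power2_eq_square algebra_simps)
  then show ?thesis using i1 i2 i3 eq by (simp add: power2_eq_square)
qed

text \<open>
  Both directions of time are covered at once: filtrations and reverse filtrations.
\<close>

definition monotone_fields :: "(nat \<Rightarrow> 'a measure) \<Rightarrow> bool" where
  "monotone_fields H \<longleftrightarrow> (\<forall>i j. i \<le> j \<longrightarrow> sets (H i) \<subseteq> sets (H j)) \<or> (\<forall>i j. i \<le> j \<longrightarrow> sets (H j) \<subseteq> sets (H i))"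

text \<open>
  The oscillation of the martingale between the times \<open>k\<close> and \<open>k + N\<close> is bounded by the increment
  of its second moment.
\<close>

lemma cond_exp_oscillation:
  assumes sub: "\<And>n. subalgebra M (H n)" and mono: "monotone_fields H"
    and U[measurable]: "U \<in> borel_measurable M" and C: "AE \<omega> in M. \<bar>U \<omega>\<bar> \<le> C" and \<epsilon>: "0 < \<epsilon>"
  shows "prob {\<omega> \<in> space M. \<exists>n\<le>N. 2 * \<epsilon> < \<bar>real_cond_exp M (H (k + n)) U \<omega> - real_cond_exp M (H k) U \<omega>\<bar>}
    \<le> \<bar>(\<integral>\<omega>. (real_cond_exp M (H (k + N)) U \<omega>)\<^sup>2 \<partial>M) - (\<integral>\<omega>. (real_cond_exp M (H k) U \<omega>)\<^sup>2 \<partial>M)\<bar> / \<epsilon>\<^sup>2"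
proof -
  let ?V = "\<lambda>n. real_cond_exp M (H n) U"
  have V: "AE \<omega> in M. \<bar>?V n \<omega>\<bar> \<le> C" for n by (rule AE_bounded_cond_exp[OF sub U C])
  have D: "AE \<omega> in M. \<bar>?V i \<omega> - ?V j \<omega>\<bar> \<le> 2 * C" for i j
    using V[of i] V[of j] by eventually_elim auto
  have intU: "integrable M U" by (rule integrable_AE_bounded[OF U C])
  have intV: "integrable M (?V n)" for n by (rule integrable_AE_bounded[OF _ V]) simp
  have nested: "AE \<omega> in M. real_cond_exp M (H i) (\<lambda>\<omega>. ?V j \<omega> - ?V l \<omega>) \<omega> = ?V i \<omega> - ?V l \<omega>"
    if "sets (H i) \<subseteq> sets (H j)" "sets (H l) \<subseteq> sets (H i)" for i j l
  proof -
    interpret H: sigma_finite_subalgebra M "H i" by (rule sigma_finite_subalgebra_of_prob[OF sub])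
    have ij: "subalgebra (H j) (H i)" and li: "subalgebra (H i) (H l)"
      using that sub[of i] sub[of j] sub[of l] by (auto simp: subalgebra_def)
    have "?V l \<in> borel_measurable (H i)" by (rule measurable_from_subalg[OF li]) simp
    then have 1: "AE \<omega> in M. real_cond_exp M (H i) (?V l) \<omega> = ?V l \<omega>"
      by (intro H.real_cond_exp_F_meas intV)
    have 2: "AE \<omega> in M. real_cond_exp M (H i) (?V j) \<omega> = ?V i \<omega>"
      by (rule H.real_cond_exp_nested_subalg[OF sub ij intU])
    show ?thesis
      using H.real_cond_exp_diff[OF intV[of j] intV[of l]] 1 2 by eventually_elim auto
  qed
  consider (inc) "\<And>i j. i \<le> j \<Longrightarrow> sets (H i) \<subseteq> sets (H j)" | (dec) "\<And>i j. i \<le> j \<Longrightarrow> sets (H j) \<subseteq> sets (H i)"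
    using mono unfolding monotone_fields_def by blast
  then show ?thesis
  proof cases
    case inc
    let ?U = "\<lambda>\<omega>. ?V (k + N) \<omega> - ?V k \<omega>"
    have eq: "AE \<omega> in M. \<forall>n\<in>{..N}. real_cond_exp M (H (k + n)) ?U \<omega> = ?V (k + n) \<omega> - ?V k \<omega>"
      by (rule AE_finite_allI) (auto intro!: nested inc)
    have "prob {\<omega> \<in> space M. \<exists>n\<le>N. 2 * \<epsilon> < \<bar>?V (k + n) \<omega> - ?V k \<omega>\<bar>}
        \<le> prob {\<omega> \<in> space M. \<exists>n\<le>N. \<epsilon> < \<bar>real_cond_exp M (H (k + n)) ?U \<omega>\<bar>}"
    proof (rule finite_measure_mono_AE)
      show "AE \<omega> in M. \<omega> \<in> {\<omega> \<in> space M. \<exists>n\<le>N. 2 * \<epsilon> < \<bar>?V (k + n) \<omega> - ?V k \<omega>\<bar>} \<longrightarrow>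
          \<omega> \<in> {\<omega> \<in> space M. \<exists>n\<le>N. \<epsilon> < \<bar>real_cond_exp M (H (k + n)) ?U \<omega>\<bar>}"
        using eq by eventually_elim (use \<epsilon> in fastforce)
    qed measurable
    also have "\<dots> \<le> (\<integral>\<omega>. (?U \<omega>)\<^sup>2 \<partial>M) / \<epsilon>\<^sup>2"
      by (rule maximal_inequality[where H="\<lambda>n. H (k + n)", OF sub inc _ D \<epsilon>]) auto
    finally show ?thesis
      unfolding cond_exp_diff_sq[OF sub sub inc[of k "k + N"] U C, simplified]
      by (rule order_trans) (auto intro!: divide_right_mono)
  next
    case dec
    \<comment> \<open>In reversed time \<open>k + N\<close> is the initial time, so the oscillation is compared with the value there.\<close>
    let ?U = "\<lambda>\<omega>. ?V k \<omega> - ?V (k + N) \<omega>"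
    have eq: "AE \<omega> in M. \<forall>n\<in>{..N}. real_cond_exp M (H (k + N - n)) ?U \<omega> = ?V (k + N - n) \<omega> - ?V (k + N) \<omega>"
      by (rule AE_finite_allI) (auto intro!: nested dec)
    have "prob {\<omega> \<in> space M. \<exists>n\<le>N. 2 * \<epsilon> < \<bar>?V (k + n) \<omega> - ?V k \<omega>\<bar>}
        \<le> prob {\<omega> \<in> space M. \<exists>n\<le>N. \<epsilon> < \<bar>real_cond_exp M (H (k + N - n)) ?U \<omega>\<bar>}"
    proof (rule finite_measure_mono_AE)
      show "AE \<omega> in M. \<omega> \<in> {\<omega> \<in> space M. \<exists>n\<le>N. 2 * \<epsilon> < \<bar>?V (k + n) \<omega> - ?V k \<omega>\<bar>} \<longrightarrow>
          \<omega> \<in> {\<omega> \<in> space M. \<exists>n\<le>N. \<epsilon> < \<bar>real_cond_exp M (H (k + N - n)) ?U \<omega>\<bar>}"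
        using eq
      proof eventually_elim
        case (elim \<omega>)
        show ?case
        proof safe
          fix n assume w: "\<omega> \<in> space M" and n: "n \<le> N" "2 * \<epsilon> < \<bar>?V (k + n) \<omega> - ?V k \<omega>\<bar>"
          then have split: "\<epsilon> < \<bar>?V (k + n) \<omega> - ?V (k + N) \<omega>\<bar> \<or> \<epsilon> < \<bar>?V k \<omega> - ?V (k + N) \<omega>\<bar>" by linarith
          have eq_n: "real_cond_exp M (H (k + n)) ?U \<omega> = ?V (k + n) \<omega> - ?V (k + N) \<omega>"
            using bspec[OF elim, of "N - n"] n by simp
          have eq_N: "real_cond_exp M (H k) ?U \<omega> = ?V k \<omega> - ?V (k + N) \<omega>"
            using bspec[OF elim, of N] by simp
          show "\<exists>n\<le>N. \<epsilon> < \<bar>real_cond_exp M (H (k + N - n)) ?U \<omega>\<bar>"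
            using split
          proof (elim disjE)
            assume "\<epsilon> < \<bar>?V (k + n) \<omega> - ?V (k + N) \<omega>\<bar>"
            then show ?thesis using n eq_n by (intro exI[of _ "N - n"]) simp
          next
            assume "\<epsilon> < \<bar>?V k \<omega> - ?V (k + N) \<omega>\<bar>"
            then show ?thesis using eq_N by (intro exI[of _ N]) simp
          qed
        qed
      qed
    qed measurable
    also have "\<dots> \<le> (\<integral>\<omega>. (?U \<omega>)\<^sup>2 \<partial>M) / \<epsilon>\<^sup>2"
      by (rule maximal_inequality[where H="\<lambda>n. H (k + N - n)", OF sub dec _ D \<epsilon>]) auto
    finally show ?thesis
      unfolding cond_exp_diff_sq[OF sub sub dec[of k "k + N"] U C, simplified]
      by (rule order_trans) (auto intro!: divide_right_mono)
  qed
qed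

lemma AE_Cauchy_cond_exp:
  assumes sub: "\<And>n. subalgebra M (H n)" and mono: "monotone_fields H"
    and U[measurable]: "U \<in> borel_measurable M" and C: "AE \<omega> in M. \<bar>U \<omega>\<bar> \<le> C"
  shows "AE \<omega> in M. Cauchy (\<lambda>n. real_cond_exp M (H n) U \<omega>)"
proof (rule AE_Cauchy_criterion)
  let ?V = "\<lambda>n. real_cond_exp M (H n) U"
  let ?e = "\<lambda>n. \<integral>\<omega>. (?V n \<omega>)\<^sup>2 \<partial>M"
  fix \<epsilon> \<delta> :: real assume \<epsilon>: "0 < \<epsilon>" and \<delta>: "0 < \<delta>"
  have V: "AE \<omega> in M. \<bar>?V n \<omega>\<bar> \<le> C" for n by (rule AE_bounded_cond_exp[OF sub U C])
  have le: "?e n \<le> C\<^sup>2" for n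
  proof -
    have "?e n \<le> (\<integral>\<omega>. C\<^sup>2 \<partial>M)"
    proof (rule integral_mono_AE)
      show "AE \<omega> in M. (?V n \<omega>)\<^sup>2 \<le> C\<^sup>2"
        using V[of n] by eventually_elim (auto simp: abs_le_square_iff[symmetric])
      then show "integrable M (\<lambda>\<omega>. (?V n \<omega>)\<^sup>2)" by (intro integrable_AE_bounded[of _ "C\<^sup>2"]) auto
    qed simp
    then show ?thesis by (simp add: prob_space)
  qed
  have step: "?e i \<le> ?e j" if "sets (H i) \<subseteq> sets (H j)" for i j
  proof -
    have "0 \<le> (\<integral>\<omega>. (?V j \<omega> - ?V i \<omega>)\<^sup>2 \<partial>M)" by simp
    then show ?thesis unfolding cond_exp_diff_sq[OF sub sub that U C] by simp
  qed
  have "Cauchy ?e"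
  proof (rule convergent_Cauchy)
    show "convergent ?e"
    proof (cases "\<forall>i j. i \<le> j \<longrightarrow> sets (H i) \<subseteq> sets (H j)")
      case True
      then show ?thesis using step le by (intro Bseq_mono_convergent BseqI'[of _ "C\<^sup>2"]) auto
    next
      case False
      then have "\<And>m n. m \<le> n \<Longrightarrow> ?e n \<le> ?e m" using mono step unfolding monotone_fields_def by blast
      then show ?thesis using le by (intro Bseq_monoseq_convergent BseqI'[of _ "C\<^sup>2"]) (auto simp: monoseq_def)
    qed
  qed
  then obtain k where k: "\<And>n. k \<le> n \<Longrightarrow> \<bar>?e n - ?e k\<bar> < \<delta> * (\<epsilon> / 2)\<^sup>2"
    using metric_CauchyD[of ?e "\<delta> * (\<epsilon> / 2)\<^sup>2"] \<epsilon> \<delta> by (auto simp: dist_real_def)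
  have "prob {\<omega> \<in> space M. \<exists>n. \<epsilon> < \<bar>?V (k + n) \<omega> - ?V k \<omega>\<bar>} \<le> \<delta>"
  proof (rule prob_ex_le_bound)
    fix N
    have "prob {\<omega> \<in> space M. \<exists>n\<le>N. \<epsilon> < \<bar>?V (k + n) \<omega> - ?V k \<omega>\<bar>} \<le> \<bar>?e (k + N) - ?e k\<bar> / (\<epsilon> / 2)\<^sup>2"
      using cond_exp_oscillation[OF sub mono U C, of "\<epsilon> / 2" N k] \<epsilon> by simp
    also have "\<dots> \<le> \<delta>" using k[of "k + N"] \<epsilon> by (simp add: divide_le_eq less_imp_le)
    finally show "prob {\<omega> \<in> space M. \<exists>n\<le>N. \<epsilon> < \<bar>?V (k + n) \<omega> - ?V k \<omega>\<bar>} \<le> \<delta>" .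
  qed measurable
  then show "\<exists>k. prob {\<omega> \<in> space M. \<exists>n. \<epsilon> < \<bar>?V (k + n) \<omega> - ?V k \<omega>\<bar>} \<le> \<delta>" ..
qed simp

lemma lim_shift: "lim (\<lambda>n. X (n + k)) = lim (X :: nat \<Rightarrow> real)"
  unfolding lim_def by (rule arg_cong[where f=The]) (auto simp: fun_eq_iff intro: LIMSEQ_ignore_initial_segment LIMSEQ_offset)

text \<open>
  Identifies an almost sure limit of the martingale on events that lie in almost all of the fields.
\<close>

lemma set_integral_cond_exp_limit:
  assumes sub: "\<And>n. subalgebra M (H n)" and U[measurable]: "U \<in> borel_measurable M" and C: "AE \<omega> in M. \<bar>U \<omega>\<bar> \<le> C"
    and lim: "AE \<omega> in M. (\<lambda>n. real_cond_exp M (H n) U \<omega>) \<longlonglongrightarrow> L \<omega>" and [measurable]: "L \<in> borel_measurable M"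
    and A: "\<And>n. k \<le> n \<Longrightarrow> A \<in> sets (H n)"
  shows "(\<integral>\<omega>\<in>A. U \<omega> \<partial>M) = (\<integral>\<omega>\<in>A. L \<omega> \<partial>M)"
proof -
  have [measurable]: "A \<in> sets M" using A[of k] sub[of k] by (auto simp: subalgebra_def)
  have conv: "(\<lambda>n. \<integral>\<omega>. indicator A \<omega> *\<^sub>R real_cond_exp M (H n) U \<omega> \<partial>M) \<longlonglongrightarrow> (\<integral>\<omega>. indicator A \<omega> *\<^sub>R L \<omega> \<partial>M)"
  proof (rule integral_dominated_convergence[where w="\<lambda>_. C"])
    show "AE \<omega> in M. (\<lambda>n. indicator A \<omega> *\<^sub>R real_cond_exp M (H n) U \<omega>) \<longlonglongrightarrow> indicator A \<omega> *\<^sub>R L \<omega>"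
      using lim by eventually_elim (auto intro: tendsto_intros)
    show "AE \<omega> in M. norm (indicator A \<omega> *\<^sub>R real_cond_exp M (H n) U \<omega>) \<le> C" for n
      using AE_bounded_cond_exp[OF sub U C, of n] by eventually_elim (auto simp: indicator_def)
  qed auto
  have eq: "(\<integral>\<omega>. indicator A \<omega> *\<^sub>R real_cond_exp M (H n) U \<omega> \<partial>M) = (\<integral>\<omega>\<in>A. U \<omega> \<partial>M)" if "k \<le> n" for n
  proof -
    interpret H: sigma_finite_subalgebra M "H n" by (rule sigma_finite_subalgebra_of_prob[OF sub])
    show ?thesis
      using H.real_cond_exp_intA[OF integrable_AE_bounded[OF U C] A[OF that]]
      by (simp add: set_lebesgue_integral_def)
  qed
  have "(\<lambda>n. \<integral>\<omega>\<in>A. U \<omega> \<partial>M) \<longlonglongrightarrow> (\<integral>\<omega>. indicator A \<omega> *\<^sub>R L \<omega> \<partial>M)"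
    by (rule Lim_transform_eventually[OF conv]) (use eq in \<open>auto simp: eventually_sequentially\<close>)
  then show ?thesis unfolding set_lebesgue_integral_def[of M A L]
    using LIMSEQ_unique tendsto_const by blast
qed

lemma AE_cond_exp_lim:
  assumes sub: "\<And>n. subalgebra M (H n)" and mono: "monotone_fields H"
    and U[measurable]: "U \<in> borel_measurable M" and C: "AE \<omega> in M. \<bar>U \<omega>\<bar> \<le> C"
  shows "AE \<omega> in M. (\<lambda>n. real_cond_exp M (H n) U \<omega>) \<longlonglongrightarrow> lim (\<lambda>n. real_cond_exp M (H n) U \<omega>)"
    and "AE \<omega> in M. \<bar>lim (\<lambda>n. real_cond_exp M (H n) U \<omega>)\<bar> \<le> C"
proof -
  show *: "AE \<omega> in M. (\<lambda>n. real_cond_exp M (H n) U \<omega>) \<longlonglongrightarrow> lim (\<lambda>n. real_cond_exp M (H n) U \<omega>)"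
    using AE_Cauchy_cond_exp[OF sub mono U C]
    by eventually_elim (simp add: Cauchy_convergent_iff convergent_LIMSEQ_iff)
  have "AE \<omega> in M. \<forall>n. \<bar>real_cond_exp M (H n) U \<omega>\<bar> \<le> C"
    using AE_bounded_cond_exp[OF sub U C] by (simp add: AE_all_countable)
  with * show "AE \<omega> in M. \<bar>lim (\<lambda>n. real_cond_exp M (H n) U \<omega>)\<bar> \<le> C"
    by eventually_elim (rule LIMSEQ_le_const2[OF tendsto_rabs], auto)
qed

text \<open>
  The almost sure limit can be computed from any tail of the sequence, hence it is measurable with
  respect to every field of the sequence.
\<close>

theorem levy_downward:
  assumes sub: "\<And>n. subalgebra M (H n)" and dec: "\<And>i j. i \<le> j \<Longrightarrow> sets (H j) \<subseteq> sets (H i)"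
    and U[measurable]: "U \<in> borel_measurable M" and C: "AE \<omega> in M. \<bar>U \<omega>\<bar> \<le> C"
    and K: "subalgebra M K" "sets K = (\<Inter>n. sets (H n))"
  shows "AE \<omega> in M. (\<lambda>n. real_cond_exp M (H n) U \<omega>) \<longlonglongrightarrow> real_cond_exp M K U \<omega>"
proof -
  interpret K: sigma_finite_subalgebra M K by (rule sigma_finite_subalgebra_of_prob[OF K(1)])
  let ?L = "\<lambda>\<omega>. lim (\<lambda>n. real_cond_exp M (H n) U \<omega>)"
  have mono: "monotone_fields H" using dec by (auto simp: monotone_fields_def)
  note lim = AE_cond_exp_lim[OF sub mono U C]
  have spK: "space K = space M" and spH: "space (H n) = space M" for n
    using K(1) sub[of n] by (auto simp: subalgebra_def)
  have L_H: "?L \<in> borel_measurable (H n)" for n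
  proof -
    have "real_cond_exp M (H (i + n)) U \<in> borel_measurable (H n)" for i
      using sub dec[of n "i + n"] by (intro measurable_from_subalg[of "H n" "H (i + n)"]) (auto simp: subalgebra_def)
    then have "(\<lambda>\<omega>. lim (\<lambda>i. real_cond_exp M (H (i + n)) U \<omega>)) \<in> borel_measurable (H n)" by measurable
    then show ?thesis by (simp add: lim_shift[of "\<lambda>n. real_cond_exp M (H n) U _"])
  qed
  have L_K: "?L \<in> borel_measurable K"
    using measurable_sets[OF L_H] unfolding measurable_def spK K(2) spH by auto
  have L_M [measurable]: "?L \<in> borel_measurable M" by measurable
  have "AE \<omega> in M. real_cond_exp M K U \<omega> = ?L \<omega>"
  proof (rule K.real_cond_exp_charact)
    show "(\<integral>\<omega>\<in>A. U \<omega> \<partial>M) = (\<integral>\<omega>\<in>A. ?L \<omega> \<partial>M)" if "A \<in> sets K" for A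
      by (rule set_integral_cond_exp_limit[OF sub U C lim(1) L_M, of 0]) (use that K(2) in auto)
  qed (use L_K integrable_AE_bounded[OF U C] integrable_AE_bounded[OF L_M lim(2)] in auto)
  with lim(1) show ?thesis by eventually_elim simp
qed

text \<open>
  The limit is determined on the union of the fields, which is stable under intersection.
\<close>

theorem levy_upward:
  assumes sub: "\<And>n. subalgebra M (H n)" and inc: "\<And>i j. i \<le> j \<Longrightarrow> sets (H i) \<subseteq> sets (H j)"
    and U[measurable]: "U \<in> borel_measurable M" and C: "AE \<omega> in M. \<bar>U \<omega>\<bar> \<le> C"
    and K: "subalgebra M K" "sets K = sigma_sets (space M) (\<Union>n. sets (H n))"
  shows "AE \<omega> in M. (\<lambda>n. real_cond_exp M (H n) U \<omega>) \<longlonglongrightarrow> real_cond_exp M K U \<omega>"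
proof -
  interpret K: sigma_finite_subalgebra M K by (rule sigma_finite_subalgebra_of_prob[OF K(1)])
  let ?L = "\<lambda>\<omega>. lim (\<lambda>n. real_cond_exp M (H n) U \<omega>)"
  have mono: "monotone_fields H" using inc by (auto simp: monotone_fields_def)
  note lim = AE_cond_exp_lim[OF sub mono U C]
  have spK: "space K = space M" and spH: "space (H n) = space M" for n
    using K(1) sub[of n] by (auto simp: subalgebra_def)
  have HK: "subalgebra K (H n)" for n
    unfolding subalgebra_def K(2) spK spH by auto
  have "real_cond_exp M (H n) U \<in> borel_measurable K" for n
    by (rule measurable_from_subalg[OF HK[of n]]) simp
  then have L_K: "?L \<in> borel_measurable K" by measurable
  have L_M [measurable]: "?L \<in> borel_measurable M" by measurable
  have iU: "integrable M U" and iL: "integrable M ?L"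
    using integrable_AE_bounded[OF U C] integrable_AE_bounded[OF L_M lim(2)] by auto
  have iA: "integrable M (\<lambda>\<omega>. indicator A \<omega> *\<^sub>R f \<omega>)" if "A \<in> sets K" "integrable M f" for A and f :: "'a \<Rightarrow> real"
    using that K(1) by (intro integrable_mult_indicator) (auto simp: subalgebra_def)
    have Int: "Int_stable (\<Union>n. sets (H n))"
    proof (rule Int_stableI)
      fix a b assume "a \<in> (\<Union>n. sets (H n))" "b \<in> (\<Union>n. sets (H n))"
      then obtain i j where "a \<in> sets (H i)" "b \<in> sets (H j)" by auto
      then have "a \<in> sets (H (max i j))" "b \<in> sets (H (max i j))"
        using inc[of i "max i j"] inc[of j "max i j"] by auto
      then show "a \<inter> b \<in> (\<Union>n. sets (H n))" by auto
    qed
    have Pow: "(\<Union>n. sets (H n)) \<subseteq> Pow (space M)"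
      using sets.sets_into_space spH by fastforce
  have "(\<integral>\<omega>\<in>A. U \<omega> \<partial>M) = (\<integral>\<omega>\<in>A. ?L \<omega> \<partial>M)" if "A \<in> sigma_sets (space M) (\<Union>n. sets (H n))" for A
    using Int Pow that
  proof (induction rule: sigma_sets_induct_disjoint)
    case (basic A)
    then obtain k where k: "A \<in> sets (H k)" by auto
    show ?case
      by (rule set_integral_cond_exp_limit[OF sub U C lim(1) L_M, of k]) (use k inc in auto)
  next
    case empty then show ?case by (simp add: set_lebesgue_integral_def)
  next
    case (compl A)
    have A: "A \<in> sets K" using compl(1) K(2) by simp
    have "(\<integral>\<omega>\<in>space M. U \<omega> \<partial>M) = (\<integral>\<omega>\<in>space M. ?L \<omega> \<partial>M)"
      by (rule set_integral_cond_exp_limit[OF sub U C lim(1) L_M, of 0]) (metis sets.top spH)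
    then have tot: "(\<integral>\<omega>. U \<omega> \<partial>M) = (\<integral>\<omega>. ?L \<omega> \<partial>M)"
      by (simp only: set_integral_space[OF iU] set_integral_space[OF iL])
    have "(\<integral>\<omega>\<in>space M - A. f \<omega> \<partial>M) = (\<integral>\<omega>. f \<omega> \<partial>M) - (\<integral>\<omega>\<in>A. f \<omega> \<partial>M)" if "integrable M f" for f :: "'a \<Rightarrow> real"
    proof -
      have "(\<integral>\<omega>\<in>space M - A. f \<omega> \<partial>M) = (\<integral>\<omega>. f \<omega> - indicator A \<omega> *\<^sub>R f \<omega> \<partial>M)"
        unfolding set_lebesgue_integral_def
        by (rule Bochner_Integration.integral_cong) (auto simp: indicator_def)
      then show ?thesis using iA[OF A that] that by (simp add: set_lebesgue_integral_def)
    qed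
    from this[OF iU] this[OF iL] show ?case using compl(2) tot by simp
  next
    case (union A)
    have AM: "A i \<in> sets M" for i using union(2) K by (auto simp: subalgebra_def)
    have int: "set_integrable M (\<Union>i. A i) f" if "integrable M f" for f :: "'a \<Rightarrow> real"
      unfolding set_integrable_def using AM that by (intro integrable_mult_indicator) auto
    have "(\<integral>\<omega>\<in>(\<Union>i. A i). f \<omega> \<partial>M) = (\<Sum>i. \<integral>\<omega>\<in>A i. f \<omega> \<partial>M)" if "integrable M f" for f :: "'a \<Rightarrow> real"
      by (rule lebesgue_integral_countable_add[OF AM _ int[OF that]]) (use union(1) in \<open>auto simp: disjoint_family_on_def\<close>)
    from this[OF iU] this[OF iL] show ?case using union(3) by simp
  qed
  then have "AE \<omega> in M. real_cond_exp M K U \<omega> = ?L \<omega>"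
    by (intro K.real_cond_exp_charact) (use K(2) L_K iU iL in auto)
  with lim(1) show ?thesis by eventually_elim simp
qed

text \<open>
  A dominated convergence theorem for conditional expectations in which the field moves together with
  the integrand (Hunt's lemma). The supremum over the remaining times dominates all the
  integrands by a single function, to which the maximal inequality applies.
\<close>

theorem cond_exp_tendsto_zero:
  assumes sub: "\<And>n. subalgebra M (H n)" and inc: "\<And>i j. i \<le> j \<Longrightarrow> sets (H i) \<subseteq> sets (H j)"
    and f[measurable]: "\<And>n. f n \<in> borel_measurable M" and C: "\<And>n. AE \<omega> in M. \<bar>f n \<omega>\<bar> \<le> C" and C0: "0 \<le> C"
    and lim: "AE \<omega> in M. (\<lambda>n. f n \<omega>) \<longlonglongrightarrow> 0"
  shows "AE \<omega> in M. (\<lambda>n. real_cond_exp M (H n) (f n) \<omega>) \<longlonglongrightarrow> 0"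
proof -
  \<comment> \<open>Truncation at the almost sure bound \<open>C\<close> makes the supremum finite everywhere.\<close>
  define g where "g k \<omega> = (SUP n. min C \<bar>f (n + k) \<omega>\<bar>)" for k \<omega>
  have bdd: "bdd_above (range (\<lambda>n. min C \<bar>f (n + k) \<omega>\<bar>))" for k \<omega>
    by (auto intro!: bdd_aboveI[of _ C])
  have g_meas [measurable]: "g k \<in> borel_measurable M" for k
    unfolding g_def by (rule borel_measurable_cSUP) (auto simp: bdd)
  have g0: "0 \<le> g k \<omega>" for k \<omega>
    unfolding g_def by (rule cSUP_upper2[OF bdd]) (auto simp: C0)
  have gC: "g k \<omega> \<le> C" for k \<omega>
    unfolding g_def by (rule cSUP_least) auto
  have g_lim: "AE \<omega> in M. (\<lambda>k. g k \<omega>) \<longlonglongrightarrow> 0"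
    using lim
  proof eventually_elim
    case (elim \<omega>)
    show ?case
    proof (rule LIMSEQ_I)
      fix r :: real assume "0 < r"
      then obtain k where k: "\<And>n. k \<le> n \<Longrightarrow> \<bar>f n \<omega>\<bar> < r / 2"
        using LIMSEQ_D[OF elim, of "r / 2"] by auto
      have "g m \<omega> \<le> r / 2" if "k \<le> m" for m
        unfolding g_def
      proof (rule cSUP_least)
        show "min C \<bar>f (n + m) \<omega>\<bar> \<le> r / 2" for n
          using k[of "n + m"] that by linarith
      qed simp
      then have "norm (g m \<omega> - 0) < r" if "k \<le> m" for m
        using g0[of m \<omega>] \<open>0 < r\<close> that by fastforce
      then show "\<exists>k. \<forall>m\<ge>k. norm (g m \<omega> - 0) < r" by blast
    qed
  qed
  have "(\<lambda>k. \<integral>\<omega>. (g k \<omega>)\<^sup>2 \<partial>M) \<longlonglongrightarrow> (\<integral>\<omega>. 0 \<partial>M)"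
  proof (rule integral_dominated_convergence[where w="\<lambda>_. C\<^sup>2"])
    show "AE \<omega> in M. (\<lambda>k. (g k \<omega>)\<^sup>2) \<longlonglongrightarrow> 0"
      using g_lim by eventually_elim (auto intro: tendsto_eq_intros)
  qed (use g0 gC in \<open>auto simp: power_mono\<close>)
  then have gsq: "(\<lambda>k. \<integral>\<omega>. (g k \<omega>)\<^sup>2 \<partial>M) \<longlonglongrightarrow> 0" by simp
  have gAE: "AE \<omega> in M. \<bar>g k \<omega>\<bar> \<le> C" for k using g0 gC by simp
  have dom: "AE \<omega> in M. \<bar>real_cond_exp M (H (n + k)) (f (n + k)) \<omega>\<bar> \<le> real_cond_exp M (H (n + k)) (g k) \<omega>" for n k
  proof -
    interpret H: sigma_finite_subalgebra M "H (n + k)" by (rule sigma_finite_subalgebra_of_prob[OF sub])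
    have ig: "integrable M (g k)" by (rule integrable_AE_bounded[OF _ gAE]) simp
    have fi: "integrable M (f (n + k))" by (rule integrable_AE_bounded[OF _ C]) simp
    have "AE \<omega> in M. \<bar>f (n + k) \<omega>\<bar> \<le> g k \<omega>"
      using C[of "n + k"]
    proof eventually_elim
      case (elim \<omega>)
      then show ?case unfolding g_def by (intro cSUP_upper2[OF bdd, of n]) auto
    qed
    then have 1: "AE \<omega> in M. f (n + k) \<omega> \<le> g k \<omega>" and 2: "AE \<omega> in M. - 1 * g k \<omega> \<le> f (n + k) \<omega>"
      by (eventually_elim, auto)+
    have ig': "integrable M (\<lambda>\<omega>. - 1 * g k \<omega>)" using ig by simp
    from H.real_cond_exp_mono[OF 1 fi ig] H.real_cond_exp_mono[OF 2 ig' fi]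
      H.real_cond_exp_cmult[OF ig, of "- 1"]
    show ?thesis by eventually_elim auto
  qed
  have "AE \<omega> in M. \<exists>k. \<forall>n. \<bar>real_cond_exp M (H (n + k)) (f (n + k)) \<omega>\<bar> \<le> \<epsilon>" if \<epsilon>: "0 < \<epsilon>" for \<epsilon>
  proof -
    let ?B = "\<lambda>k. {\<omega> \<in> space M. \<exists>n. \<epsilon> < \<bar>real_cond_exp M (H (n + k)) (f (n + k)) \<omega>\<bar>}"
    have "AE \<omega> in M. \<exists>k. \<omega> \<notin> ?B k"
    proof (rule AE_ex_not_bad)
      fix \<delta> :: real assume \<delta>: "0 < \<delta>"
      then obtain k where k: "(\<integral>\<omega>. (g k \<omega>)\<^sup>2 \<partial>M) < \<delta> * \<epsilon>\<^sup>2"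
        using LIMSEQ_D[OF gsq, of "\<delta> * \<epsilon>\<^sup>2"] \<epsilon> by (auto simp: abs_less_iff)
      have "prob (?B k) \<le> prob {\<omega> \<in> space M. \<exists>n. \<epsilon> < \<bar>real_cond_exp M (H (n + k)) (g k) \<omega>\<bar>}"
      proof (rule finite_measure_mono_AE)
        have "AE \<omega> in M. \<forall>n. \<bar>real_cond_exp M (H (n + k)) (f (n + k)) \<omega>\<bar> \<le> real_cond_exp M (H (n + k)) (g k) \<omega>"
          using dom by (simp add: AE_all_countable)
        then show "AE \<omega> in M. \<omega> \<in> ?B k \<longrightarrow> \<omega> \<in> {\<omega> \<in> space M. \<exists>n. \<epsilon> < \<bar>real_cond_exp M (H (n + k)) (g k) \<omega>\<bar>}"
        proof eventually_elim
          case (elim \<omega>)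
          have "\<epsilon> < \<bar>real_cond_exp M (H (n + k)) (g k) \<omega>\<bar>" if "\<epsilon> < \<bar>real_cond_exp M (H (n + k)) (f (n + k)) \<omega>\<bar>" for n
            using elim[rule_format, of n] that by linarith
          then show ?case by blast
        qed
      qed measurable
      also have "\<dots> \<le> (\<integral>\<omega>. (g k \<omega>)\<^sup>2 \<partial>M) / \<epsilon>\<^sup>2"
      proof (rule prob_ex_le_bound)
        show "prob {\<omega> \<in> space M. \<exists>n\<le>N. \<epsilon> < \<bar>real_cond_exp M (H (n + k)) (g k) \<omega>\<bar>} \<le> (\<integral>\<omega>. (g k \<omega>)\<^sup>2 \<partial>M) / \<epsilon>\<^sup>2" for N
          by (rule maximal_inequality[where H="\<lambda>n. H (n + k)", OF sub inc _ gAE \<epsilon>]) auto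
      qed measurable
      also have "\<dots> \<le> \<delta>" using k \<epsilon> by (simp add: divide_le_eq)
      finally show "\<exists>k. prob (?B k) \<le> \<delta>" ..
    qed measurable
    with AE_space show ?thesis by eventually_elim (auto simp: not_less)
  qed
  then have "AE \<omega> in M. \<forall>m. \<exists>k. \<forall>n. \<bar>real_cond_exp M (H (n + k)) (f (n + k)) \<omega>\<bar> \<le> inverse (real (Suc m))"
    by (simp add: AE_all_countable)
  then show ?thesis
  proof eventually_elim
    case (elim \<omega>)
    show ?case
    proof (rule LIMSEQ_I)
      fix r :: real assume "0 < r"
      then obtain m where m: "inverse (real (Suc m)) < r" using reals_Archimedean by blast
      obtain k where k: "\<And>n. \<bar>real_cond_exp M (H (n + k)) (f (n + k)) \<omega>\<bar> \<le> inverse (real (Suc m))" using elim by blast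
      have "norm (real_cond_exp M (H n) (f n) \<omega> - 0) < r" if "k \<le> n" for n
        using k[of "n - k"] m that by simp
      then show "\<exists>k. \<forall>n\<ge>k. norm (real_cond_exp M (H n) (f n) \<omega> - 0) < r" by blast
    qed
  qed
qed

end

section \<open>Countably generated fields and approximation of events\<close>

definition countably_generated :: "'a measure \<Rightarrow> bool" where
  "countably_generated M \<longleftrightarrow>
    (\<exists>\<C>. countable \<C> \<and> \<C> \<subseteq> Pow (space M) \<and> sets M = sigma_sets (space M) \<C>)"

text \<open>
  The stages of the algebra generated by \<open>\<C>\<close>; each stage of a countable family is countable.
\<close>

primrec boolean_closure :: "'a set \<Rightarrow> 'a set set \<Rightarrow> nat \<Rightarrow> 'a set set" where
  "boolean_closure \<Omega> \<C> 0 = insert {} \<C>"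
| "boolean_closure \<Omega> \<C> (Suc n) = boolean_closure \<Omega> \<C> n \<union> (\<lambda>a. \<Omega> - a) ` boolean_closure \<Omega> \<C> n
    \<union> (\<lambda>(a, b). a \<union> b) ` (boolean_closure \<Omega> \<C> n \<times> boolean_closure \<Omega> \<C> n)"

text \<open>
  A supremum over a field is not measurable in a parameter of the measures, a supremum over a
  countable algebra is.
\<close>

lemma countably_generated_algebra:
  assumes "countably_generated M"
  obtains \<A> where "countable \<A>" "algebra (space M) \<A>" "sets M = sigma_sets (space M) \<A>"
proof -
  let ?\<Omega> = "space M"
  obtain \<C> where \<C>: "countable \<C>" "\<C> \<subseteq> Pow ?\<Omega>" "sets M = sigma_sets ?\<Omega> \<C>"
    using assms unfolding countably_generated_def by auto
  let ?B = "boolean_closure ?\<Omega> \<C>"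
  let ?\<A> = "\<Union>n. ?B n"
  have mono: "?B n \<subseteq> ?B m" if "n \<le> m" for n m
    using that by (induction rule: dec_induct) auto
  have cnt: "countable (?B n)" for n by (induction n) (auto simp: \<C>)
  have sub: "?B n \<subseteq> sets M" for n
  proof (induction n)
    case 0 then show ?case using \<C>(3) by auto
  next
    case (Suc n) then show ?case by (auto simp: subset_iff)
  qed
  show thesis
  proof (rule that[of ?\<A>])
    show "countable ?\<A>" using cnt by simp
    show "algebra ?\<Omega> ?\<A>"
      unfolding algebra_iff_Un
    proof (intro conjI ballI)
      show "?\<A> \<subseteq> Pow ?\<Omega>" using sub sets.space_closed[of M] by blast
      show "{} \<in> ?\<A>" by (rule UN_I[of 0]) simp_all
    next
      fix a assume "a \<in> ?\<A>"
      then obtain n where "a \<in> ?B n" by auto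
      then have "?\<Omega> - a \<in> ?B (Suc n)" by (auto intro: imageI)
      then show "?\<Omega> - a \<in> ?\<A>" by blast
    next
      fix a b assume "a \<in> ?\<A>" "b \<in> ?\<A>"
      then obtain i j where "a \<in> ?B i" "b \<in> ?B j" by auto
      then have "a \<in> ?B (max i j)" "b \<in> ?B (max i j)"
        using mono[of i "max i j"] mono[of j "max i j"] by auto
      then have "a \<union> b \<in> ?B (Suc (max i j))" unfolding boolean_closure.simps by blast
      then show "a \<union> b \<in> ?\<A>" by blast
    qed
    show "sets M = sigma_sets ?\<Omega> ?\<A>"
    proof
      have "\<C> \<subseteq> ?\<A>" by (rule subsetI, rule UN_I[of 0]) simp_all
      then show "sets M \<subseteq> sigma_sets ?\<Omega> ?\<A>" unfolding \<C>(3) by (rule sigma_sets_mono')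
      show "sigma_sets ?\<Omega> ?\<A> \<subseteq> sets M" using sub by (intro sets.sigma_sets_subset) auto
    qed
  qed
qed

text \<open>
  The approximating event is the same for both measures, so that inequalities between the two measures
  pass from the algebra to the field.
\<close>

lemma algebra_approximation:
  assumes alg: "algebra \<Omega> \<A>" and A: "A \<in> sigma_sets \<Omega> \<A>"
    and M: "finite_measure M" "space M = \<Omega>" "\<A> \<subseteq> sets M"
    and N: "finite_measure N" "space N = \<Omega>" "\<A> \<subseteq> sets N" and "0 < \<epsilon>"
  shows "\<exists>B\<in>\<A>. measure M ((A - B) \<union> (B - A)) < \<epsilon> \<and> measure N ((A - B) \<union> (B - A)) < (\<epsilon>::real)"
  using A \<open>0 < \<epsilon>\<close>
proof (induction arbitrary: \<epsilon> rule: sigma_sets.induct)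
  case (Basic a)
  then show ?case by (intro bexI[of _ a]) auto
next
  case Empty
  interpret algebra \<Omega> \<A> by fact
  show ?case by (intro bexI[of _ "{}"]) (auto simp: Empty)
next
  case (Compl a)
  interpret algebra \<Omega> \<A> by fact
  obtain B where B: "B \<in> \<A>" "measure M ((a - B) \<union> (B - a)) < \<epsilon>" "measure N ((a - B) \<union> (B - a)) < \<epsilon>"
    using Compl by blast
  have "a \<subseteq> \<Omega>" "B \<subseteq> \<Omega>"
    using sigma_sets_into_sp[OF space_closed Compl(1)] sets_into_space[OF B(1)] by auto
  then have "((\<Omega> - a) - (\<Omega> - B)) \<union> ((\<Omega> - B) - (\<Omega> - a)) = (a - B) \<union> (B - a)" by auto
  then show ?case using B by (intro bexI[of _ "\<Omega> - B"]) auto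
next
  case (Union a)
  interpret algebra \<Omega> \<A> by fact
  interpret M: finite_measure M by fact
  interpret N: finite_measure N by fact
  have sM: "sigma_sets \<Omega> \<A> \<subseteq> sets M" and sN: "sigma_sets \<Omega> \<A> \<subseteq> sets N"
    using M(2,3) N(2,3) sets.sigma_sets_subset[of \<A> M] sets.sigma_sets_subset[of \<A> N] by auto
  have aM [measurable]: "a i \<in> sets M" and aN [measurable]: "a i \<in> sets N" for i
    using Union(1) sM sN by auto
  have tail: "\<exists>n0. \<forall>n\<ge>n0. measure L ((\<Union>i. a i) - (\<Union>i<n. a i)) < \<epsilon> / 2"
    if "finite_measure L" and [measurable]: "\<And>i. a i \<in> sets L" for L :: "'a measure"
  proof -
    interpret L: finite_measure L by fact
    have "(\<lambda>n. measure L (\<Union>i<n. a i)) \<longlonglongrightarrow> measure L (\<Union>n. \<Union>i<n. a i)"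
      by (rule L.finite_Lim_measure_incseq) (auto simp: incseq_def, fastforce)
    moreover have "(\<Union>n. \<Union>i<n. a i) = (\<Union>i. a i)" by auto
    ultimately have "(\<lambda>n. measure L (\<Union>i<n. a i)) \<longlonglongrightarrow> measure L (\<Union>i. a i)" by simp
    then obtain n0 where n0: "\<And>n. n0 \<le> n \<Longrightarrow> \<bar>measure L (\<Union>i<n. a i) - measure L (\<Union>i. a i)\<bar> < \<epsilon> / 2"
      using LIMSEQ_D[of "\<lambda>n. measure L (\<Union>i<n. a i)" "measure L (\<Union>i. a i)" "\<epsilon> / 2"] Union(3) by auto
    have diff: "measure L ((\<Union>i. a i) - (\<Union>i<n. a i)) = measure L (\<Union>i. a i) - measure L (\<Union>i<n. a i)" for n
      by (rule L.finite_measure_Diff) auto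
    have "measure L ((\<Union>i. a i) - (\<Union>i<n. a i)) < \<epsilon> / 2" if "n0 \<le> n" for n
      using n0[OF that] unfolding diff by linarith
    then show ?thesis by blast
  qed
  obtain n1 n2 where n1: "\<And>n. n1 \<le> n \<Longrightarrow> measure M ((\<Union>i. a i) - (\<Union>i<n. a i)) < \<epsilon> / 2"
    and n2: "\<And>n. n2 \<le> n \<Longrightarrow> measure N ((\<Union>i. a i) - (\<Union>i<n. a i)) < \<epsilon> / 2"
    using tail[OF M(1) aM] tail[OF N(1) aN] by auto
  define n where "n = Suc (max n1 n2)"
  have "\<exists>B\<in>\<A>. measure M ((a i - B) \<union> (B - a i)) < \<epsilon> / (2 * real n) \<and> measure N ((a i - B) \<union> (B - a i)) < \<epsilon> / (2 * real n)" for i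
    using Union(3) by (intro Union(2)) (simp add: n_def)
  then obtain B where B: "\<And>i. B i \<in> \<A>" "\<And>i. measure M ((a i - B i) \<union> (B i - a i)) < \<epsilon> / (2 * real n)"
      "\<And>i. measure N ((a i - B i) \<union> (B i - a i)) < \<epsilon> / (2 * real n)" by metis
  have *: "measure L (((\<Union>i. a i) - (\<Union>i<n. B i)) \<union> ((\<Union>i<n. B i) - (\<Union>i. a i))) < \<epsilon>"
    if "finite_measure L" and [measurable]: "\<And>i. a i \<in> sets L" "\<And>i. B i \<in> sets L"
      and t: "measure L ((\<Union>i. a i) - (\<Union>i<n. a i)) < \<epsilon> / 2"
      and b: "\<And>i. measure L ((a i - B i) \<union> (B i - a i)) < \<epsilon> / (2 * real n)" for L :: "'a measure"
  proof -
    interpret L: finite_measure L by fact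
    let ?D = "\<lambda>i. (a i - B i) \<union> (B i - a i)"
    have "measure L (((\<Union>i. a i) - (\<Union>i<n. B i)) \<union> ((\<Union>i<n. B i) - (\<Union>i. a i)))
        \<le> measure L (((\<Union>i. a i) - (\<Union>i<n. a i)) \<union> (\<Union>i<n. ?D i))"
      by (rule L.finite_measure_mono) auto
    also have "\<dots> \<le> measure L ((\<Union>i. a i) - (\<Union>i<n. a i)) + measure L (\<Union>i<n. ?D i)"
      by (rule measure_Un_le) auto
    also have "measure L (\<Union>i<n. ?D i) \<le> (\<Sum>i<n. measure L (?D i))"
      by (rule L.finite_measure_subadditive_finite) auto
    also have "\<dots> \<le> (\<Sum>i<n. \<epsilon> / (2 * real n))" by (intro sum_mono less_imp_le b)
    also have "\<dots> = \<epsilon> / 2"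
    proof -
      have "n > 0" by (simp add: n_def)
      then show ?thesis by simp
    qed
    finally show ?thesis using t by simp
  qed
  show ?case
  proof (intro bexI[of _ "\<Union>i<n. B i"] conjI)
    show "(\<Union>i<n. B i) \<in> \<A>" using B(1) by (intro finite_UN) auto
    have "B i \<in> sets M" "B i \<in> sets N" for i using B(1) M(3) N(3) by auto
    then show "measure M (((\<Union>i. a i) - (\<Union>i<n. B i)) \<union> ((\<Union>i<n. B i) - (\<Union>i. a i))) < \<epsilon>"
      "measure N (((\<Union>i. a i) - (\<Union>i<n. B i)) \<union> ((\<Union>i<n. B i) - (\<Union>i. a i))) < \<epsilon>"
      using *[OF M(1) aM _ n1 B(2)] *[OF N(1) aN _ n2 B(3)] by (auto simp: n_def)
  qed
qed

lemma (in finite_measure) abs_measure_diff_le: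
  assumes [measurable]: "A \<in> sets M" "B \<in> sets M"
  shows "\<bar>measure M A - measure M B\<bar> \<le> measure M ((A - B) \<union> (B - A))"
proof -
  have "measure M A \<le> measure M (B \<union> ((A - B) \<union> (B - A)))" "measure M B \<le> measure M (A \<union> ((A - B) \<union> (B - A)))"
    by (intro finite_measure_mono; auto)+
  moreover have "measure M (B \<union> ((A - B) \<union> (B - A))) \<le> measure M B + measure M ((A - B) \<union> (B - A))"
    "measure M (A \<union> ((A - B) \<union> (B - A))) \<le> measure M A + measure M ((A - B) \<union> (B - A))"
    by (intro measure_Un_le; auto)+
  ultimately show ?thesis by linarith
qed

lemma measure_bound_from_algebra:
  assumes alg: "algebra \<Omega> \<A>" and A: "A \<in> sigma_sets \<Omega> \<A>"
    and M: "finite_measure M" "space M = \<Omega>" "\<A> \<subseteq> sets M"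
    and N: "finite_measure N" "space N = \<Omega>" "\<A> \<subseteq> sets N"
    and bound: "\<And>B. B \<in> \<A> \<Longrightarrow> measure M B \<le> K * measure N B + c" and K: "0 \<le> (K::real)"
  shows "measure M A \<le> K * measure N A + c"
proof (rule field_le_epsilon)
  fix e :: real assume e: "0 < e"
  interpret M: finite_measure M by fact
  interpret N: finite_measure N by fact
  have sM: "sigma_sets \<Omega> \<A> \<subseteq> sets M" and sN: "sigma_sets \<Omega> \<A> \<subseteq> sets N"
    using M(2,3) N(2,3) sets.sigma_sets_subset[of \<A> M] sets.sigma_sets_subset[of \<A> N] by auto
  obtain B where B: "B \<in> \<A>" "measure M ((A - B) \<union> (B - A)) < e / (1 + K)" "measure N ((A - B) \<union> (B - A)) < e / (1 + K)"
    using algebra_approximation[OF alg A M N, of "e / (1 + K)"] e K by auto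
  have mem: "A \<in> sets M" "B \<in> sets M" "A \<in> sets N" "B \<in> sets N" using A B(1) sM sN M(3) N(3) by auto
  have "measure M A \<le> measure M B + e / (1 + K)" "measure N B \<le> measure N A + e / (1 + K)"
    using M.abs_measure_diff_le[OF mem(1,2)] N.abs_measure_diff_le[OF mem(3,4)] B by linarith+
  then have "measure M A \<le> (K * measure N B + c) + e / (1 + K)" "K * measure N B \<le> K * (measure N A + e / (1 + K))"
    using bound[OF B(1)] K by (auto intro: mult_left_mono)
  moreover have "K * (e / (1 + K)) + e / (1 + K) = e"
    using K by (simp add: divide_simps) (simp add: algebra_simps)
  ultimately show "measure M A \<le> K * measure N A + c + e" by (simp add: distrib_left)
qed

lemma countably_generated_sigma_Un:
  assumes K: "countable K" and g: "\<And>k. k \<in> K \<Longrightarrow> countably_generated (M k)" and sp: "\<And>k. k \<in> K \<Longrightarrow> space (M k) = \<Omega>"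
  shows "countably_generated (sigma \<Omega> (\<Union>k\<in>K. sets (M k)))"
proof -
  have "\<exists>\<C>. countable \<C> \<and> \<C> \<subseteq> Pow \<Omega> \<and> sets (M k) = sigma_sets \<Omega> \<C>" if "k \<in> K" for k
    using g[OF that] sp[OF that] by (auto simp: countably_generated_def)
  then obtain \<C> where \<C>: "\<And>k. k \<in> K \<Longrightarrow> countable (\<C> k) \<and> \<C> k \<subseteq> Pow \<Omega> \<and> sets (M k) = sigma_sets \<Omega> (\<C> k)"
    by metis
  have pow: "(\<Union>k\<in>K. sets (M k)) \<subseteq> Pow \<Omega>" using sets.space_closed sp by blast
  have powC: "(\<Union>k\<in>K. \<C> k) \<subseteq> Pow \<Omega>" using \<C> by blast
  have eq: "sigma_sets \<Omega> (\<Union>k\<in>K. sets (M k)) = sigma_sets \<Omega> (\<Union>k\<in>K. \<C> k)"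
  proof (rule sigma_sets_eqI)
    fix a assume "a \<in> (\<Union>k\<in>K. sets (M k))"
    then obtain k where k: "k \<in> K" "a \<in> sigma_sets \<Omega> (\<C> k)" using \<C> by auto
    then show "a \<in> sigma_sets \<Omega> (\<Union>k\<in>K. \<C> k)"
      using sigma_sets_mono'[of "\<C> k" "\<Union>k\<in>K. \<C> k" \<Omega>] by auto
  next
    fix b assume "b \<in> (\<Union>k\<in>K. \<C> k)"
    then obtain k where k: "k \<in> K" "b \<in> \<C> k" by auto
    then have "b \<in> sets (M k)" using \<C> by auto
    then show "b \<in> sigma_sets \<Omega> (\<Union>k\<in>K. sets (M k))" using k(1) by (intro sigma_sets.Basic) auto
  qed
  show ?thesis unfolding countably_generated_def
    by (rule exI[of _ "\<Union>k\<in>K. \<C> k"]) (use powC pow eq K \<C> in auto)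
qed

lemma countably_generated_vimage_algebra:
  assumes "countably_generated N" and f: "f \<in> \<Omega> \<rightarrow> space N"
  shows "countably_generated (vimage_algebra \<Omega> f N)"
proof -
  obtain \<C> where \<C>: "countable \<C>" "\<C> \<subseteq> Pow (space N)" "sets N = sigma_sets (space N) \<C>"
    using assms unfolding countably_generated_def by auto
  have "sets (vimage_algebra \<Omega> f N) = {f -` A \<inter> \<Omega> |A. A \<in> sigma_sets (space N) \<C>}"
    using sets_vimage_algebra2[OF f] \<C>(3) by simp
  also have "\<dots> = sigma_sets \<Omega> {f -` A \<inter> \<Omega> |A. A \<in> \<C>}"
    by (rule sigma_sets_vimage_commute[OF f])
  finally show ?thesis using \<C>(1) unfolding countably_generated_def
    by (intro exI[of _ "{f -` A \<inter> \<Omega> |A. A \<in> \<C>}"]) (auto simp: Setcompr_eq_image)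
qed

lemma countably_generated_cong: "sets M = sets N \<Longrightarrow> countably_generated M \<Longrightarrow> countably_generated N"
  using sets_eq_imp_space_eq[of M N] by (simp add: countably_generated_def)

lemma countably_generated_borel: "countably_generated (borel :: 'a::second_countable_topology measure)"
proof -
  obtain B :: "'a set set" where B: "countable B" "topological_basis B"
    using ex_countable_basis by blast
  show ?thesis
    unfolding countably_generated_def
    by (rule exI[of _ B]) (use B arg_cong[OF borel_eq_countable_basis[OF B], of sets] in simp)
qed

lemma countably_generated_borel_of:
  assumes "second_countable T"
  shows "countably_generated (borel_of T)"
proof -
  obtain \<B> where \<B>: "countable \<B>" "\<And>V. V \<in> \<B> \<Longrightarrow> openin T V"
      "\<And>U x. openin T U \<Longrightarrow> x \<in> U \<Longrightarrow> \<exists>V\<in>\<B>. x \<in> V \<and> V \<subseteq> U"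
    using assms unfolding second_countable_def by metis
  have "sigma_sets (topspace T) {U. openin T U} = sigma_sets (topspace T) \<B>"
  proof (rule sigma_sets_eqI)
    fix U assume "U \<in> {U. openin T U}"
    then have U: "openin T U" by simp
    have "U = \<Union>{V\<in>\<B>. V \<subseteq> U}" using \<B>(3)[OF U] by blast
    moreover have "\<Union>{V\<in>\<B>. V \<subseteq> U} \<in> sigma_sets (topspace T) \<B>"
      by (rule sigma_sets_UNION) (use \<B>(1) in \<open>auto intro: countable_subset[of _ \<B>]\<close>)
    ultimately show "U \<in> sigma_sets (topspace T) \<B>" by simp
  qed (use \<B>(2) in auto)
  moreover have "\<B> \<subseteq> Pow (topspace T)" "{U. openin T U} \<subseteq> Pow (topspace T)"
    using \<B>(2) openin_subset by blast+
  ultimately show ?thesis unfolding countably_generated_def borel_of_def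
    using \<B>(1) by (intro exI[of _ \<B>]) simp
qed

lemma countably_generated_pair:
  assumes M: "countably_generated M" and N: "countably_generated N"
  shows "countably_generated (M \<Otimes>\<^sub>M N)"
proof (rule countably_generated_cong)
  let ?\<Omega> = "space M \<times> space N"
  let ?V = "\<lambda>b. if b then vimage_algebra ?\<Omega> fst M else vimage_algebra ?\<Omega> snd N"
  show "countably_generated (sigma ?\<Omega> (\<Union>b\<in>UNIV. sets (?V b)))"
    by (rule countably_generated_sigma_Un) (auto intro!: countably_generated_vimage_algebra M N)
  have "sets (M \<Otimes>\<^sub>M N) = sets (Sup {vimage_algebra ?\<Omega> fst M, vimage_algebra ?\<Omega> snd N})"
    by (rule sets_pair_eq_sets_fst_snd)
  also have "\<dots> = sigma_sets ?\<Omega> (\<Union>b\<in>UNIV. sets (?V b))"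
    by (subst sets_Sup_eq[where X="?\<Omega>"]) (auto simp: UNIV_bool Un_commute)
  finally show "sets (sigma ?\<Omega> (\<Union>b\<in>UNIV. sets (?V b))) = sets (M \<Otimes>\<^sub>M N)"
    using sets.space_closed[of "vimage_algebra ?\<Omega> fst M"] sets.space_closed[of "vimage_algebra ?\<Omega> snd N"]
    by (subst sets_measure_of) (simp_all add: UNIV_bool)
qed

lemma countably_generated_PiM:
  assumes J: "countable J" and M: "\<And>i. i \<in> J \<Longrightarrow> countably_generated (M i)"
  shows "countably_generated (PiM J M)"
proof (rule countably_generated_cong)
  let ?\<Omega> = "\<Pi>\<^sub>E i\<in>J. space (M i)"
  show "countably_generated (sigma ?\<Omega> (\<Union>i\<in>J. sets (vimage_algebra ?\<Omega> (\<lambda>x. x i) (M i))))"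
    by (rule countably_generated_sigma_Un) (auto intro!: countably_generated_vimage_algebra J M)
  have "sets (PiM J M) = sigma_sets ?\<Omega> {{f\<in>?\<Omega>. f i \<in> A} | i A. i \<in> J \<and> A \<in> sets (M i)}"
    by (rule sets_PiM_single)
  also have "{{f\<in>?\<Omega>. f i \<in> A} | i A. i \<in> J \<and> A \<in> sets (M i)} = (\<Union>i\<in>J. sets (vimage_algebra ?\<Omega> (\<lambda>x. x i) (M i)))"
  proof -
    have "sets (vimage_algebra ?\<Omega> (\<lambda>x. x i) (M i)) = {{f\<in>?\<Omega>. f i \<in> A} | A. A \<in> sets (M i)}" if "i \<in> J" for i
      by (subst sets_vimage_algebra2) (use that in \<open>auto simp: Int_commute Collect_conj_eq vimage_def intro!: exI\<close>)
    then show ?thesis by auto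
  qed
  finally show "sets (sigma ?\<Omega> (\<Union>i\<in>J. sets (vimage_algebra ?\<Omega> (\<lambda>x. x i) (M i)))) = sets (PiM J M)"
  proof (subst sets_measure_of)
    show "(\<Union>i\<in>J. sets (vimage_algebra ?\<Omega> (\<lambda>x. x i) (M i))) \<subseteq> Pow ?\<Omega>"
    proof (rule UN_least)
      fix i
      show "sets (vimage_algebra ?\<Omega> (\<lambda>x. x i) (M i)) \<subseteq> Pow ?\<Omega>"
        using sets.space_closed[of "vimage_algebra ?\<Omega> (\<lambda>x. x i) (M i)"] by (simp only: space_vimage_algebra)
    qed
  qed simp
qed

section \<open>Conditional laws under two different measures\<close>

lemma tv_dist_le:
  assumes "\<G> \<noteq> {}" "\<And>A. A \<in> \<G> \<Longrightarrow> \<bar>measure \<rho> A - measure \<rho>' A\<bar> \<le> c"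
  shows "tv_dist \<G> \<rho> \<rho>' \<le> 2 * c"
  unfolding tv_dist_def using assms by (auto intro!: cSUP_least)

lemma abs_measure_diff_le_tv_dist:
  assumes "prob_space \<rho>" "prob_space \<rho>'" "A \<in> \<G>"
  shows "2 * \<bar>measure \<rho> A - measure \<rho>' A\<bar> \<le> tv_dist \<G> \<rho> \<rho>'"
proof -
  interpret r: prob_space \<rho> by fact
  interpret r': prob_space \<rho>' by fact
  have "\<bar>measure \<rho> A - measure \<rho>' A\<bar> \<le> 1" for A
    using r.prob_le_1[of A] r'.prob_le_1[of A] measure_nonneg[of \<rho> A] measure_nonneg[of \<rho>' A] by linarith
  then show ?thesis
    unfolding tv_dist_def using assms(3) by (auto intro!: cSUP_upper bdd_aboveI[of _ 1])
qed

lemma tv_dist_commute: "tv_dist \<G> \<rho> \<rho>' = tv_dist \<G> \<rho>' \<rho>"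
  by (simp add: tv_dist_def abs_minus_commute)

text \<open>
  The hypothesis \<open>bayes\<close> says that \<open>p\<close> is the conditional probability of \<open>a\<close> given \<open>F\<close> under the
  measure with density \<open>D\<close>. If \<open>D\<close> were measurable with respect to \<open>F\<close>, then \<open>p\<close> would
  coincide with the conditional probability under \<open>M\<close>; the error is the conditional mean distance
  between the conditional expectations of \<open>D\<close> given \<open>F\<close> and given the larger field \<open>G\<close>, in
  which \<open>a\<close> lies.
\<close>

lemma (in prob_space) conditional_bayes_bound:
  assumes F: "subalgebra M F" and G: "subalgebra M G" and FG: "sets F \<subseteq> sets G"
    and D[measurable]: "D \<in> borel_measurable M" and C: "AE \<omega> in M. \<bar>D \<omega>\<bar> \<le> C"
    and a: "a \<in> sets G" and p[measurable]: "p \<in> borel_measurable F" and p1: "\<And>\<omega>. \<bar>p \<omega>\<bar> \<le> 1"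
    and bayes: "\<And>A. A \<in> sets F \<Longrightarrow> (\<integral>\<omega>\<in>A. p \<omega> * D \<omega> \<partial>M) = (\<integral>\<omega>\<in>A. indicator a \<omega> * D \<omega> \<partial>M)"
  shows "AE \<omega> in M. \<bar>p \<omega> * real_cond_exp M F D \<omega> - real_cond_exp M F D \<omega> * real_cond_exp M F (indicator a) \<omega>\<bar>
    \<le> real_cond_exp M F (\<lambda>\<omega>. \<bar>real_cond_exp M G D \<omega> - real_cond_exp M F D \<omega>\<bar>) \<omega>"
proof -
  interpret F: sigma_finite_subalgebra M F by (rule sigma_finite_subalgebra_of_prob[OF F])
  interpret G: sigma_finite_subalgebra M G by (rule sigma_finite_subalgebra_of_prob[OF G])
  let ?E = "real_cond_exp M F" and ?d = "real_cond_exp M F D" and ?g = "real_cond_exp M G D"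
  have GF: "subalgebra G F" using F G FG by (auto simp: subalgebra_def)
  have [measurable]: "a \<in> sets M" using a G by (auto simp: subalgebra_def)
  have [measurable]: "p \<in> borel_measurable M" by (rule measurable_from_subalg[OF F p])
  have ind_G: "(indicator a :: 'a \<Rightarrow> real) \<in> borel_measurable G" using a by simp
  have bnd: "AE \<omega> in M. \<bar>q \<omega> * f \<omega>\<bar> \<le> C'" if "AE \<omega> in M. \<bar>f \<omega>\<bar> \<le> C'" "\<And>\<omega>. \<bar>q \<omega>\<bar> \<le> 1" for f q :: "'a \<Rightarrow> real" and C'
    using that(1)
  proof eventually_elim
    case (elim \<omega>)
    then show ?case using mult_mono[OF that(2)[of \<omega>] elim] by (simp add: abs_mult)
  qed
  have i1: "\<bar>indicator a \<omega> :: real\<bar> \<le> 1" for \<omega> by (simp add: indicator_def)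
  have d: "AE \<omega> in M. \<bar>?d \<omega>\<bar> \<le> C" and g: "AE \<omega> in M. \<bar>?g \<omega>\<bar> \<le> C"
    by (rule AE_bounded_cond_exp[OF _ D C]; fact)+
  have int_pD: "integrable M (\<lambda>\<omega>. p \<omega> * D \<omega>)" by (rule integrable_AE_bounded[OF _ bnd[OF C p1]]) simp
  have int_aD: "integrable M (\<lambda>\<omega>. indicator a \<omega> * D \<omega>)" by (rule integrable_AE_bounded[OF _ bnd[OF C i1]]) simp
  have int_ag: "integrable M (\<lambda>\<omega>. indicator a \<omega> * ?g \<omega>)" by (rule integrable_AE_bounded[OF _ bnd[OF g i1]]) simp
  have int_ad: "integrable M (\<lambda>\<omega>. ?d \<omega> * indicator a \<omega>)"
    by (subst mult.commute, rule integrable_AE_bounded[OF _ bnd[OF d i1]]) simp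
  have int_g: "integrable M ?g" and int_d: "integrable M ?d"
    by (rule integrable_AE_bounded[OF _ g] integrable_AE_bounded[OF _ d]; simp)+
  have 1: "AE \<omega> in M. ?E (\<lambda>\<omega>. indicator a \<omega> * D \<omega>) \<omega> = ?E (\<lambda>\<omega>. p \<omega> * D \<omega>) \<omega>"
  proof (rule F.real_cond_exp_charact)
    show "(\<integral>\<omega>\<in>A. indicator a \<omega> * D \<omega> \<partial>M) = (\<integral>\<omega>\<in>A. ?E (\<lambda>\<omega>. p \<omega> * D \<omega>) \<omega> \<partial>M)" if "A \<in> sets F" for A
      using bayes[OF that] F.real_cond_exp_intA[OF int_pD that] by simp
  qed (use int_aD F.real_cond_exp_int(1)[OF int_pD] in auto)
  have 2: "AE \<omega> in M. ?E (\<lambda>\<omega>. p \<omega> * D \<omega>) \<omega> = p \<omega> * ?d \<omega>"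
    by (rule F.real_cond_exp_mult[OF p D int_pD])
  have 3: "AE \<omega> in M. ?E (real_cond_exp M G (\<lambda>\<omega>. indicator a \<omega> * D \<omega>)) \<omega> = ?E (\<lambda>\<omega>. indicator a \<omega> * D \<omega>) \<omega>"
    by (rule F.real_cond_exp_nested_subalg[OF G GF int_aD])
  have 4: "AE \<omega> in M. ?E (real_cond_exp M G (\<lambda>\<omega>. indicator a \<omega> * D \<omega>)) \<omega> = ?E (\<lambda>\<omega>. indicator a \<omega> * ?g \<omega>) \<omega>"
    by (rule F.real_cond_exp_cong[OF G.real_cond_exp_mult[OF ind_G D int_aD]]) auto
  have 5: "AE \<omega> in M. ?E (\<lambda>\<omega>. ?d \<omega> * indicator a \<omega>) \<omega> = ?d \<omega> * ?E (indicator a) \<omega>"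
    by (rule F.real_cond_exp_mult[OF _ _ int_ad]) auto
  have 6: "AE \<omega> in M. ?E (\<lambda>\<omega>. indicator a \<omega> * ?g \<omega> - ?d \<omega> * indicator a \<omega>) \<omega>
      = ?E (\<lambda>\<omega>. indicator a \<omega> * ?g \<omega>) \<omega> - ?E (\<lambda>\<omega>. ?d \<omega> * indicator a \<omega>) \<omega>"
    by (rule F.real_cond_exp_diff[OF int_ag int_ad])
  have int_abs: "integrable M (\<lambda>\<omega>. \<bar>?g \<omega> - ?d \<omega>\<bar>)" using int_g int_d by simp
  have int_mabs: "integrable M (\<lambda>\<omega>. - 1 * \<bar>?g \<omega> - ?d \<omega>\<bar>)" using int_abs by simp
  have int_diff: "integrable M (\<lambda>\<omega>. indicator a \<omega> * ?g \<omega> - ?d \<omega> * indicator a \<omega>)" using int_ag int_ad by simp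
  have le: "indicator a \<omega> * ?g \<omega> - ?d \<omega> * indicator a \<omega> \<le> \<bar>?g \<omega> - ?d \<omega>\<bar>"
    and ge: "- 1 * \<bar>?g \<omega> - ?d \<omega>\<bar> \<le> indicator a \<omega> * ?g \<omega> - ?d \<omega> * indicator a \<omega>" for \<omega>
    by (auto simp: indicator_def)
  show ?thesis
    using 1 2 3 4 5 6 F.real_cond_exp_mono[OF AE_I2[OF le] int_diff int_abs]
      F.real_cond_exp_mono[OF AE_I2[OF ge] int_mabs int_diff] F.real_cond_exp_cmult[OF int_abs, of "- 1"]
  proof eventually_elim
    case (elim \<omega>)
    then show ?case by linarith
  qed
qed

lemma regular_cond_law_density:
  assumes M: "prob_space M" and P: "prob_space P" and D[measurable]: "D \<in> borel_measurable M" and D0: "\<And>\<omega>. 0 \<le> D \<omega>"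
    and PD: "P = density M (\<lambda>\<omega>. ennreal (D \<omega>))"
    and F: "subalgebra M F" and reg: "regular_cond_law P F N Z \<kappa>" and B: "B \<in> sets N" and ZB: "Z -` B \<inter> space M \<in> sets M"
    and A: "A \<in> sets F"
  shows "(\<integral>\<omega>\<in>A. measure (\<kappa> \<omega>) B * D \<omega> \<partial>M) = (\<integral>\<omega>\<in>A. indicator (Z -` B \<inter> space M) \<omega> * D \<omega> \<partial>M)"
proof -
  interpret P: prob_space P by fact
  have sP: "sets P = sets M" "space P = space M" using PD by simp_all
  have FP: "subalgebra P F" using F sP by (simp add: subalgebra_def)
  interpret F: sigma_finite_subalgebra P F by (rule P.sigma_finite_subalgebra_of_prob[OF FP])
  have \<kappa>: "\<kappa> \<in> F \<rightarrow>\<^sub>M prob_algebra N" using reg by (simp add: regular_cond_law_def)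
  have pF: "(\<lambda>\<omega>. measure (\<kappa> \<omega>) B) \<in> borel_measurable F"
    by (rule measurable_compose[OF measurable_prob_algebraD[OF \<kappa>] measurable_measure_subprob_algebra[OF B]])
  have [measurable]: "(\<lambda>\<omega>. measure (\<kappa> \<omega>) B) \<in> borel_measurable M" by (rule measurable_from_subalg[OF F pF])
  have [measurable]: "A \<in> sets M" using A F by (auto simp: subalgebra_def)
  note ZB[measurable]
  let ?a = "Z -` B \<inter> space M"
  have conv: "(\<integral>\<omega>\<in>A. f \<omega> \<partial>P) = (\<integral>\<omega>\<in>A. f \<omega> * D \<omega> \<partial>M)" if [measurable]: "f \<in> borel_measurable M" for f :: "'a \<Rightarrow> real"
    unfolding PD set_lebesgue_integral_def
    by (subst integral_density) (auto simp: D0 intro!: Bochner_Integration.integral_cong)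
  have "AE \<omega> in P. measure (\<kappa> \<omega>) B = real_cond_exp P F (indicator ?a) \<omega>"
    using reg B by (simp add: regular_cond_law_def sP)
  then have "(\<integral>\<omega>\<in>A. measure (\<kappa> \<omega>) B \<partial>P) = (\<integral>\<omega>\<in>A. real_cond_exp P F (indicator ?a) \<omega> \<partial>P)"
    unfolding set_lebesgue_integral_def
  proof (intro integral_cong_AE)
    have "real_cond_exp P F (indicator ?a) \<in> borel_measurable M"
      by (rule measurable_from_subalg[OF F]) simp
    then show "(\<lambda>\<omega>. indicator A \<omega> *\<^sub>R real_cond_exp P F (indicator ?a) \<omega>) \<in> borel_measurable P"
      by (simp add: measurable_cong_sets[OF sP(1) refl])
    show "(\<lambda>\<omega>. indicator A \<omega> *\<^sub>R measure (\<kappa> \<omega>) B) \<in> borel_measurable P"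
      by (simp add: measurable_cong_sets[OF sP(1) refl])
  qed auto
  also have "\<dots> = (\<integral>\<omega>\<in>A. indicator ?a \<omega> \<partial>P)"
    by (rule F.real_cond_exp_intA[OF _ A, symmetric]) (auto simp: sP P.emeasure_eq_measure)
  finally show ?thesis by (simp add: conv)
qed

text \<open>
  Two arbitrary laws become comparable through their average: both densities are bounded by \<open>2\<close>
  and their sum is \<open>2\<close>.
\<close>

lemma half_mixture:
  assumes P1: "prob_space P1" and P2: "prob_space P2" and s: "sets P1 = sets P2"
  obtains M D where "prob_space M" "sets M = sets P1" "D \<in> borel_measurable M" "\<And>\<omega>. 0 \<le> D \<omega>" "\<And>\<omega>. D \<omega> \<le> (2::real)"
    "P1 = density M (\<lambda>\<omega>. ennreal (D \<omega>))" "P2 = density M (\<lambda>\<omega>. ennreal (2 - D \<omega>))"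
proof -
  interpret P1: prob_space P1 by fact
  interpret P2: prob_space P2 by fact
  let ?b = "measure_pmf (bernoulli_pmf (1 / 2))"
  \<comment> \<open>A fair coin chooses between the two laws.\<close>
  define M where "M = ?b \<bind> (\<lambda>b. if b then P1 else P2)"
  have bp: "?b \<in> space (prob_algebra (count_space UNIV))"
    by (simp add: space_prob_algebra measure_pmf.prob_space_axioms)
  have kp: "(\<lambda>b. if b then P1 else P2) \<in> count_space UNIV \<rightarrow>\<^sub>M prob_algebra P1"
    using P1 P2 s by (auto simp: space_prob_algebra)
  have sM: "sets M = sets P1" unfolding M_def by (rule sets_bind'[OF bp kp])
  have pM: "prob_space M" unfolding M_def by (rule prob_space_bind'[OF bp kp])
  interpret M: prob_space M by fact
  have eM: "2 * emeasure M A = emeasure P1 A + emeasure P2 A" if "A \<in> sets P1" for A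
  proof -
    have "emeasure M A = (\<integral>\<^sup>+b. emeasure (if b then P1 else P2) A \<partial>?b)"
      unfolding M_def by (rule emeasure_bind_prob_algebra[OF bp kp that])
    also have "\<dots> = emeasure P1 A * ennreal (1 / 2) + emeasure P2 A * ennreal (1 / 2)"
      by (subst nn_integral_bernoulli_pmf) auto
    finally have "emeasure M A = ennreal (1 / 2) * (emeasure P1 A + emeasure P2 A)"
      by (simp add: distrib_left mult.commute)
    moreover have "2 * ennreal (1 / 2) = 1"
      by (metis ennreal_1 ennreal_mult' ennreal_numeral field_sum_of_halves mult_2 zero_le_numeral)
    ultimately show ?thesis by (simp add: mult.assoc[symmetric])
  qed
  have ac: "absolutely_continuous M P1" "absolutely_continuous M P2"
  proof -
    have "emeasure P1 A = 0 \<and> emeasure P2 A = 0" if "A \<in> null_sets M" for A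
    proof -
      have "A \<in> sets P1" "emeasure M A = 0" using that sM by (auto simp: null_sets_def)
      then have "emeasure P1 A + emeasure P2 A = 0" using eM[of A] by simp
      then show ?thesis by simp
    qed
    then show "absolutely_continuous M P1" "absolutely_continuous M P2"
      unfolding absolutely_continuous_def using sM s by (auto simp: null_sets_def)
  qed
  have sM2: "sets P2 = sets M" using sM s by simp
  obtain D1 where D1: "D1 \<in> borel_measurable M" "AE x in M. RN_deriv M P1 x = ennreal (D1 x)" "\<And>x. 0 \<le> D1 x"
    by (rule M.real_RN_deriv[OF P1.finite_measure_axioms ac(1) sM[symmetric]]) blast
  obtain D2 where D2: "D2 \<in> borel_measurable M" "AE x in M. RN_deriv M P2 x = ennreal (D2 x)" "\<And>x. 0 \<le> D2 x"
    by (rule M.real_RN_deriv[OF P2.finite_measure_axioms ac(2) sM2]) blast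
  note [measurable] = D1(1) D2(1)
  have "density M (RN_deriv M P1) = density M (\<lambda>x. ennreal (D1 x))"
    by (rule density_cong) (use D1(2) in auto)
  then have P1D: "P1 = density M (\<lambda>x. ennreal (D1 x))"
    using M.density_RN_deriv[OF ac(1) sM[symmetric]] by simp
  have "density M (RN_deriv M P2) = density M (\<lambda>x. ennreal (D2 x))"
    by (rule density_cong) (use D2(2) in auto)
  then have P2D: "P2 = density M (\<lambda>x. ennreal (D2 x))"
    using M.density_RN_deriv[OF ac(2) sM2] by simp
  have "density M (\<lambda>x. ennreal (D1 x) + ennreal (D2 x)) = density M (\<lambda>_. 2)"
  proof (rule measure_eqI)
    fix A assume "A \<in> sets (density M (\<lambda>x. ennreal (D1 x) + ennreal (D2 x)))"
    then have A[measurable]: "A \<in> sets M" by simp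
    have "emeasure (density M (\<lambda>x. ennreal (D1 x) + ennreal (D2 x))) A = emeasure P1 A + emeasure P2 A"
      unfolding P1D P2D by (simp add: emeasure_density distrib_right nn_integral_add)
    also have "\<dots> = emeasure (density M (\<lambda>_. 2)) A"
      using eM[of A] A sM by (simp add: emeasure_density nn_integral_cmult)
    finally show "emeasure (density M (\<lambda>x. ennreal (D1 x) + ennreal (D2 x))) A = emeasure (density M (\<lambda>_. 2)) A" .
  qed simp
  then have "AE x in M. ennreal (D1 x) + ennreal (D2 x) = 2"
    by (intro M.density_unique) auto
  then have sum: "AE x in M. D1 x + D2 x = 2"
  proof eventually_elim
    case (elim x)
    then have "ennreal (D1 x + D2 x) = ennreal 2" using D1(3) D2(3) by (simp add: ennreal_plus)
    then show ?case using D1(3)[of x] D2(3)[of x] by (subst (asm) ennreal_inj) auto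
  qed
  let ?D = "\<lambda>x. min (D1 x) 2"
  show thesis
  proof (rule that[of M ?D])
    have "AE x in M. D1 x = ?D x \<and> D2 x = 2 - ?D x"
      using sum
    proof eventually_elim
      case (elim x)
      then show ?case using D2(3)[of x] by (simp add: min_def)
    qed
    then have ae: "AE x in M. ennreal (D1 x) = ennreal (?D x)" "AE x in M. ennreal (D2 x) = ennreal (2 - ?D x)"
      by (auto elim: eventually_mono)
    show "P1 = density M (\<lambda>x. ennreal (?D x))"
      unfolding P1D by (rule density_cong[OF _ _ ae(1)]) auto
    show "P2 = density M (\<lambda>x. ennreal (2 - ?D x))"
      unfolding P2D by (rule density_cong[OF _ _ ae(2)]) auto
  qed (use pM sM D1(3) in auto)
qed

text \<open>
  The hypothesis \<open>tail\<close> says that the intersection of the fields \<open>G n\<close> is trivial given \<open>Finf\<close>,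
  simultaneously for both laws. With the density \<open>D\<close> of \<open>P1\<close> with respect to the average \<open>M\<close>
  of the two laws, \<open>conditional_bayes_bound\<close> compares each of the two conditional laws with
  that of \<open>M\<close>, and the error tends to zero because the martingales \<open>E (D | G n)\<close> and
  \<open>E (D | F n)\<close> have a common limit. The comparison degenerates only where that limit is \<open>0\<close>
  or \<open>2\<close>, that is, on events of \<open>Finf\<close> that are null for \<open>P1\<close> or for \<open>P2\<close>,
  and in both cases for \<open>P1\<close> by \<open>ac\<close>.
\<close>

theorem conditional_laws_merge:
  fixes P1 P2 :: "'a measure" and N :: "nat \<Rightarrow> 'b measure"
  assumes P1: "prob_space P1" and P2: "prob_space P2" and sets_eq: "sets P1 = sets P2"
    and F: "\<And>n. subalgebra P1 (F n)" and F_inc: "\<And>i j. i \<le> j \<Longrightarrow> sets (F i) \<subseteq> sets (F j)"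
    and Finf: "subalgebra P1 Finf" "sets Finf = sigma_sets (space P1) (\<Union>n. sets (F n))"
    and G: "\<And>n. subalgebra P1 (G n)" and G_dec: "\<And>i j. i \<le> j \<Longrightarrow> sets (G j) \<subseteq> sets (G i)"
    and FG: "\<And>n. sets Finf \<subseteq> sets (G n)"
    and tail: "\<And>A. (\<And>n. A \<in> sets (G n)) \<Longrightarrow>
      \<exists>B\<in>sets Finf. measure P1 ((A - B) \<union> (B - A)) = 0 \<and> measure P2 ((A - B) \<union> (B - A)) = 0"
    and ac: "\<And>A. A \<in> sets Finf \<Longrightarrow> measure P2 A = 0 \<Longrightarrow> measure P1 A = 0"
    and loc: "\<And>n. space (\<A> n) = space (N n)" "\<And>n. sets (\<A> n) \<subseteq> sets (N n)" "\<And>n. countably_generated (\<A> n)"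
    and Z: "\<And>n A. A \<in> sets (\<A> n) \<Longrightarrow> Z n -` A \<inter> space P1 \<in> sets (G (n - r))"
    and reg1: "\<And>n. regular_cond_law P1 (F n) (N n) (Z n) (\<kappa>1 n)"
    and reg2: "\<And>n. regular_cond_law P2 (F n) (N n) (Z n) (\<kappa>2 n)"
  shows "AE \<omega> in P1. (\<lambda>n. tv_dist (sets (\<A> n)) (\<kappa>1 n \<omega>) (\<kappa>2 n \<omega>)) \<longlonglongrightarrow> 0"
proof -
  obtain M D where M: "prob_space M" and sM: "sets M = sets P1" and D[measurable]: "D \<in> borel_measurable M"
    and D0: "\<And>\<omega>. 0 \<le> D \<omega>" and D2: "\<And>\<omega>. D \<omega> \<le> (2::real)"
    and P1D: "P1 = density M (\<lambda>\<omega>. ennreal (D \<omega>))" and P2D: "P2 = density M (\<lambda>\<omega>. ennreal (2 - D \<omega>))"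
    by (rule half_mixture[OF P1 P2 sets_eq]) blast
  interpret M: prob_space M by fact
  interpret P1: prob_space P1 by fact
  interpret P2: prob_space P2 by fact
  have spM: "space M = space P1" using sets_eq_imp_space_eq[OF sM] .
  have spP2: "space P2 = space P1" using sets_eq_imp_space_eq[OF sets_eq] by simp
  have FM: "subalgebra M (F n)" and GM: "subalgebra M (G n)" and FIM: "subalgebra M Finf" for n
    using F[of n] G[of n] Finf(1) sM spM by (simp_all add: subalgebra_def)
  have F_FI: "sets (F n) \<subseteq> sets Finf" for n unfolding Finf(2) by auto
  have spF: "space (F n) = space P1" and spG: "space (G n) = space P1" and spFI: "space Finf = space P1" for n
    using F[of n] G[of n] Finf(1) by (auto simp: subalgebra_def)
  have C: "AE \<omega> in M. \<bar>D \<omega>\<bar> \<le> 2" "AE \<omega> in M. \<bar>2 - D \<omega>\<bar> \<le> 2" using D0 D2 by auto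
  have D'[measurable]: "(\<lambda>\<omega>. 2 - D \<omega>) \<in> borel_measurable M" by measurable
  have intD: "integrable M D" by (rule M.integrable_AE_bounded[OF D C(1)])
  define K where "K = sigma (space P1) (\<Inter>n. sets (G n))"
  have K_pow: "(\<Inter>n. sets (G n)) \<subseteq> Pow (space P1)"
    using sets.space_closed[of "G 0"] unfolding spG by blast
  have "sigma_sets (space P1) (\<Inter>n. sets (G n)) \<subseteq> sets (G m)" for m
    using sets.sigma_sets_subset[of "\<Inter>n. sets (G n)" "G m"] unfolding spG by blast
  then have sK: "sets K = (\<Inter>n. sets (G n))" and spK: "space K = space P1"
    unfolding K_def using K_pow by (auto intro: sigma_sets.Basic)
  have KM: "subalgebra M K" using GM[of 0] spK spM unfolding subalgebra_def sK by auto
  interpret K: sigma_finite_subalgebra M K by (rule M.sigma_finite_subalgebra_of_prob[OF KM])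
  interpret FI: sigma_finite_subalgebra M Finf by (rule M.sigma_finite_subalgebra_of_prob[OF FIM])
  let ?d = "\<lambda>n. real_cond_exp M (F n) D" and ?g = "\<lambda>n. real_cond_exp M (G n) D" and ?dinf = "real_cond_exp M Finf D"
  have dFI: "?dinf \<in> borel_measurable K"
  proof -
    have "subalgebra K Finf" using FG unfolding subalgebra_def sK spK spFI by auto
    then show ?thesis by (rule measurable_from_subalg) simp
  qed
  \<comment> \<open>An event of the tail differs from one in \<open>Finf\<close> by a set that is null for \<open>P1\<close> and \<open>P2\<close>, hence for \<open>M\<close>.\<close>
  have tail_eq: "AE \<omega> in M. real_cond_exp M K D \<omega> = ?dinf \<omega>"
  proof (rule K.real_cond_exp_charact[OF _ intD FI.real_cond_exp_int(1)[OF intD] dFI])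
    fix A assume A: "A \<in> sets K"
    then obtain B where B: "B \<in> sets Finf" "measure P1 ((A - B) \<union> (B - A)) = 0" "measure P2 ((A - B) \<union> (B - A)) = 0"
      using tail[of A] sK by auto
    have AM[measurable]: "A \<in> sets M" using A KM by (auto simp: subalgebra_def)
    have BM[measurable]: "B \<in> sets M" using B FIM by (auto simp: subalgebra_def)
    let ?S = "(A - B) \<union> (B - A)"
    have "emeasure P1 ?S = 0" "emeasure P2 ?S = 0"
      using B(2,3) by (simp_all add: P1.emeasure_eq_measure P2.emeasure_eq_measure)
    then have "?S \<in> null_sets P1" "?S \<in> null_sets P2" using AM BM sM sets_eq by (auto simp: null_sets_def)
    then have "AE \<omega> in M. \<omega> \<in> ?S \<longrightarrow> ennreal (D \<omega>) \<le> 0" "AE \<omega> in M. \<omega> \<in> ?S \<longrightarrow> ennreal (2 - D \<omega>) \<le> 0"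
      unfolding P1D P2D by (simp_all add: null_sets_density_iff)
    then have notS: "AE \<omega> in M. \<omega> \<notin> ?S"
      by eventually_elim (use D0 D2 in \<open>auto simp: ennreal_le_iff2 order_antisym_conv\<close>)
    have AB: "(\<integral>\<omega>\<in>A. f \<omega> \<partial>M) = (\<integral>\<omega>\<in>B. f \<omega> \<partial>M)" if [measurable]: "f \<in> borel_measurable M" for f :: "'a \<Rightarrow> real"
    proof -
      have "AE \<omega> in M. indicator A \<omega> *\<^sub>R f \<omega> = indicator B \<omega> *\<^sub>R f \<omega>"
        using notS by eventually_elim (auto simp: indicator_def)
      then show ?thesis
        unfolding set_lebesgue_integral_def by (intro integral_cong_AE) auto
    qed
    show "(\<integral>\<omega>\<in>A. D \<omega> \<partial>M) = (\<integral>\<omega>\<in>A. ?dinf \<omega> \<partial>M)"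
      using FI.real_cond_exp_intA[OF intD B(1)] AB[of D] AB[of ?dinf] by simp
  qed
  have g_lim: "AE \<omega> in M. (\<lambda>n. ?g n \<omega>) \<longlonglongrightarrow> ?dinf \<omega>"
  proof -
    have "AE \<omega> in M. (\<lambda>n. ?g n \<omega>) \<longlonglongrightarrow> real_cond_exp M K D \<omega>"
      by (rule M.levy_downward[OF GM _ D C(1) KM sK]) (rule G_dec)
    with tail_eq show ?thesis by eventually_elim simp
  qed
  have d_lim: "AE \<omega> in M. (\<lambda>n. ?d n \<omega>) \<longlonglongrightarrow> ?dinf \<omega>"
    by (rule M.levy_upward[OF FM _ D C(1) FIM]) (simp_all add: F_inc Finf(2) spM)
  \<comment> \<open>The common error term of the two comparisons with \<open>M\<close>.\<close>
  define W where "W n = real_cond_exp M (F n) (\<lambda>\<omega>. \<bar>?g (n - r) \<omega> - ?d n \<omega>\<bar>)" for n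
  have W_lim: "AE \<omega> in M. (\<lambda>n. W n \<omega>) \<longlonglongrightarrow> 0"
    unfolding W_def
  proof (rule M.cond_exp_tendsto_zero[where C=4, OF FM])
    show "AE \<omega> in M. \<bar>\<bar>?g (n - r) \<omega> - ?d n \<omega>\<bar>\<bar> \<le> 4" for n
      using M.AE_bounded_cond_exp[OF GM[of "n - r"] D C(1)] M.AE_bounded_cond_exp[OF FM[of n] D C(1)]
      by eventually_elim linarith
    show "AE \<omega> in M. (\<lambda>n. \<bar>?g (n - r) \<omega> - ?d n \<omega>\<bar>) \<longlonglongrightarrow> 0"
      using g_lim d_lim
    proof eventually_elim
      case (elim \<omega>)
      have "(\<lambda>n. ?g (n - r) \<omega>) \<longlonglongrightarrow> ?dinf \<omega>"
        by (rule LIMSEQ_offset[where k=r]) (simp add: elim(1))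
      from tendsto_rabs[OF tendsto_diff[OF this elim(2)]] show ?case by simp
    qed
  qed (auto dest: F_inc)
  have bound1: "AE \<omega> in M. \<bar>measure (\<kappa>1 n \<omega>) A - measure (\<kappa>2 n \<omega>) A\<bar> * (?d n \<omega> * (2 - ?d n \<omega>)) \<le> 2 * W n \<omega>"
    if A: "A \<in> sets (\<A> n)" for n A
  proof -
    let ?a = "Z n -` A \<inter> space M"
    interpret Fn: sigma_finite_subalgebra M "F n" by (rule M.sigma_finite_subalgebra_of_prob[OF FM])
    interpret Gn: sigma_finite_subalgebra M "G (n - r)" by (rule M.sigma_finite_subalgebra_of_prob[OF GM])
    have a: "?a \<in> sets (G (n - r))" using Z[OF A] spM by simp
    then have aM: "?a \<in> sets M" using GM by (auto simp: subalgebra_def)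
    have AN: "A \<in> sets (N n)" using A loc(2) by auto
    have FnG: "sets (F n) \<subseteq> sets (G (n - r))" using F_FI FG by blast
    have meas: "(\<lambda>\<omega>. measure (\<kappa> \<omega>) A) \<in> borel_measurable (F n)" if "\<kappa> \<in> F n \<rightarrow>\<^sub>M prob_algebra (N n)" for \<kappa>
      by (rule measurable_compose[OF measurable_prob_algebraD[OF that] measurable_measure_subprob_algebra[OF AN]])
    have \<kappa>: "\<kappa>1 n \<in> F n \<rightarrow>\<^sub>M prob_algebra (N n)" "\<kappa>2 n \<in> F n \<rightarrow>\<^sub>M prob_algebra (N n)"
      using reg1 reg2 by (simp_all add: regular_cond_law_def)
    define p1 where "p1 \<omega> = (if \<omega> \<in> space M then measure (\<kappa>1 n \<omega>) A else 0)" for \<omega>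
    define p2 where "p2 \<omega> = (if \<omega> \<in> space M then measure (\<kappa>2 n \<omega>) A else 0)" for \<omega>
    have p_meas: "p1 \<in> borel_measurable (F n)" "p2 \<in> borel_measurable (F n)"
      by (rule measurable_cong[THEN iffD2, OF _ meas[OF \<kappa>(1)]] measurable_cong[THEN iffD2, OF _ meas[OF \<kappa>(2)]];
        simp add: p1_def p2_def spF spM)+
    have p_le: "\<bar>p1 \<omega>\<bar> \<le> 1" "\<bar>p2 \<omega>\<bar> \<le> 1" for \<omega>
      using measurable_space[OF \<kappa>(1), of \<omega>] measurable_space[OF \<kappa>(2), of \<omega>] spF spM
      by (auto simp: p1_def p2_def space_prob_algebra prob_space.prob_le_1)
    have cong: "(\<integral>\<omega>\<in>B. (if \<omega> \<in> space M then f \<omega> else 0) * h \<omega> \<partial>M) = (\<integral>\<omega>\<in>B. f \<omega> * h \<omega> \<partial>M)" for B and f h :: "'a \<Rightarrow> real"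
      unfolding set_lebesgue_integral_def by (rule Bochner_Integration.integral_cong) auto
    let ?e = "real_cond_exp M (F n) (indicator ?a)" and ?d' = "real_cond_exp M (F n) (\<lambda>\<omega>. 2 - D \<omega>)"
      and ?g' = "real_cond_exp M (G (n - r)) (\<lambda>\<omega>. 2 - D \<omega>)"
    have b1: "AE \<omega> in M. \<bar>p1 \<omega> * ?d n \<omega> - ?d n \<omega> * ?e \<omega>\<bar> \<le> W n \<omega>"
      unfolding W_def
    proof (rule M.conditional_bayes_bound[OF FM GM FnG D C(1) a p_meas(1) p_le(1)])
      show "(\<integral>\<omega>\<in>B. p1 \<omega> * D \<omega> \<partial>M) = (\<integral>\<omega>\<in>B. indicator ?a \<omega> * D \<omega> \<partial>M)" if "B \<in> sets (F n)" for B
        unfolding p1_def cong by (rule regular_cond_law_density[OF M P1 D D0 P1D FM reg1 AN aM that])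
    qed
    have b2: "AE \<omega> in M. \<bar>p2 \<omega> * ?d' \<omega> - ?d' \<omega> * ?e \<omega>\<bar>
        \<le> real_cond_exp M (F n) (\<lambda>\<omega>. \<bar>?g' \<omega> - ?d' \<omega>\<bar>) \<omega>"
    proof (rule M.conditional_bayes_bound[OF FM GM FnG D' C(2) a p_meas(2) p_le(2)])
      show "(\<integral>\<omega>\<in>B. p2 \<omega> * (2 - D \<omega>) \<partial>M) = (\<integral>\<omega>\<in>B. indicator ?a \<omega> * (2 - D \<omega>) \<partial>M)" if "B \<in> sets (F n)" for B
        unfolding p2_def cong
        by (rule regular_cond_law_density[OF M P2 D' _ P2D FM reg2 AN aM that]) (simp add: D2)
    qed
    \<comment> \<open>The density of \<open>P2\<close> is \<open>2 - D\<close>, so both comparisons have the same error.\<close>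
    have d': "AE \<omega> in M. ?d' \<omega> = 2 - ?d n \<omega>"
    proof -
      have "AE \<omega> in M. real_cond_exp M (F n) (\<lambda>_. 2) \<omega> = 2" by (rule Fn.real_cond_exp_F_meas) auto
      moreover have "AE \<omega> in M. ?d' \<omega> = real_cond_exp M (F n) (\<lambda>_. 2) \<omega> - ?d n \<omega>"
        by (rule Fn.real_cond_exp_diff) (use intD in auto)
      ultimately show ?thesis by eventually_elim simp
    qed
    have g': "AE \<omega> in M. ?g' \<omega> = 2 - ?g (n - r) \<omega>"
    proof -
      have "AE \<omega> in M. real_cond_exp M (G (n - r)) (\<lambda>_. 2) \<omega> = 2" by (rule Gn.real_cond_exp_F_meas) auto
      moreover have "AE \<omega> in M. ?g' \<omega> = real_cond_exp M (G (n - r)) (\<lambda>_. 2) \<omega> - ?g (n - r) \<omega>"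
        by (rule Gn.real_cond_exp_diff) (use intD in auto)
      ultimately show ?thesis by eventually_elim simp
    qed
    have W': "AE \<omega> in M. real_cond_exp M (F n) (\<lambda>\<omega>. \<bar>?g' \<omega> - ?d' \<omega>\<bar>) \<omega> = W n \<omega>"
      unfolding W_def
    proof (rule Fn.real_cond_exp_cong)
      show "AE \<omega> in M. \<bar>?g' \<omega> - ?d' \<omega>\<bar> = \<bar>?g (n - r) \<omega> - ?d n \<omega>\<bar>"
        using d' g' by eventually_elim simp
    qed auto
    have d01: "AE \<omega> in M. 0 \<le> ?d n \<omega>" "AE \<omega> in M. ?d n \<omega> \<le> 2"
      by (rule Fn.real_cond_exp_ge_c[OF intD] Fn.real_cond_exp_le_c[OF intD]; simp add: D0 D2)+
    show ?thesis
      using b1 b2 d' W' d01 AE_space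
    proof eventually_elim
      case (elim \<omega>)
      let ?p = "measure (\<kappa>1 n \<omega>) A" and ?q = "measure (\<kappa>2 n \<omega>) A"
      have pq: "p1 \<omega> = ?p" "p2 \<omega> = ?q" using elim(7) by (simp_all add: p1_def p2_def)
      have 1: "\<bar>?p - ?e \<omega>\<bar> * ?d n \<omega> \<le> W n \<omega>"
      proof -
        have "\<bar>?p - ?e \<omega>\<bar> * ?d n \<omega> = \<bar>(?p - ?e \<omega>) * ?d n \<omega>\<bar>" using elim(5) by (simp add: abs_mult)
        also have "(?p - ?e \<omega>) * ?d n \<omega> = p1 \<omega> * ?d n \<omega> - ?d n \<omega> * ?e \<omega>" unfolding pq by (simp add: algebra_simps)
        finally show ?thesis using elim(1) by simp
      qed
      have 2: "\<bar>?q - ?e \<omega>\<bar> * (2 - ?d n \<omega>) \<le> W n \<omega>"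
      proof -
        have "\<bar>?q - ?e \<omega>\<bar> * (2 - ?d n \<omega>) = \<bar>(?q - ?e \<omega>) * (2 - ?d n \<omega>)\<bar>" using elim(6) by (simp add: abs_mult)
        also have "(?q - ?e \<omega>) * (2 - ?d n \<omega>) = p2 \<omega> * ?d' \<omega> - ?d' \<omega> * ?e \<omega>" unfolding pq elim(3) by (simp add: algebra_simps)
        finally show ?thesis using elim(2,4) by simp
      qed
      have "\<bar>?p - ?q\<bar> * (?d n \<omega> * (2 - ?d n \<omega>)) \<le> (\<bar>?p - ?e \<omega>\<bar> + \<bar>?q - ?e \<omega>\<bar>) * (?d n \<omega> * (2 - ?d n \<omega>))"
        using elim(5,6) by (intro mult_right_mono) auto
      also have "\<dots> = (\<bar>?p - ?e \<omega>\<bar> * ?d n \<omega>) * (2 - ?d n \<omega>) + (\<bar>?q - ?e \<omega>\<bar> * (2 - ?d n \<omega>)) * ?d n \<omega>"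
        by (simp add: algebra_simps)
      also have "\<dots> \<le> W n \<omega> * (2 - ?d n \<omega>) + W n \<omega> * ?d n \<omega>"
        using 1 2 elim(5,6) by (intro add_mono mult_right_mono) auto
      finally show ?case by (simp add: algebra_simps)
    qed
  qed
  \<comment> \<open>A single exceptional set for all events: first on a countable algebra, then by approximation.\<close>
  have bound: "AE \<omega> in M. \<forall>n. 0 < ?d n \<omega> * (2 - ?d n \<omega>) \<longrightarrow> (\<forall>A\<in>sets (\<A> n).
      \<bar>measure (\<kappa>1 n \<omega>) A - measure (\<kappa>2 n \<omega>) A\<bar> \<le> 2 * W n \<omega> / (?d n \<omega> * (2 - ?d n \<omega>)))"
  proof -
    have "\<exists>\<C>. countable \<C> \<and> algebra (space (\<A> n)) \<C> \<and> sets (\<A> n) = sigma_sets (space (\<A> n)) \<C>" for n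
      by (rule countably_generated_algebra[OF loc(3)]) blast
    then obtain \<C> where \<C>: "\<And>n. countable (\<C> n)" "\<And>n. algebra (space (\<A> n)) (\<C> n)"
        "\<And>n. sets (\<A> n) = sigma_sets (space (\<A> n)) (\<C> n)"
      by metis
    have \<C>_sub: "\<C> n \<subseteq> sets (\<A> n)" for n unfolding \<C>(3) by auto
    have "AE \<omega> in M. \<forall>n. \<forall>A\<in>\<C> n.
        \<bar>measure (\<kappa>1 n \<omega>) A - measure (\<kappa>2 n \<omega>) A\<bar> * (?d n \<omega> * (2 - ?d n \<omega>)) \<le> 2 * W n \<omega>"
      unfolding AE_all_countable
    proof
      fix n
      show "AE \<omega> in M. \<forall>A\<in>\<C> n.
        \<bar>measure (\<kappa>1 n \<omega>) A - measure (\<kappa>2 n \<omega>) A\<bar> * (?d n \<omega> * (2 - ?d n \<omega>)) \<le> 2 * W n \<omega>"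
        using \<C>_sub by (subst AE_ball_countable[OF \<C>(1)]) (auto intro!: bound1)
    qed
    with AE_space show ?thesis
    proof eventually_elim
      case (elim \<omega>)
      show ?case
      proof (intro allI impI ballI)
        fix n A assume c: "0 < ?d n \<omega> * (2 - ?d n \<omega>)" and A: "A \<in> sets (\<A> n)"
        let ?b = "2 * W n \<omega> / (?d n \<omega> * (2 - ?d n \<omega>))"
        have "\<kappa>1 n \<in> F n \<rightarrow>\<^sub>M prob_algebra (N n)" "\<kappa>2 n \<in> F n \<rightarrow>\<^sub>M prob_algebra (N n)"
          using reg1 reg2 by (simp_all add: regular_cond_law_def)
        from measurable_space[OF this(1), of \<omega>] measurable_space[OF this(2), of \<omega>] elim(1)
        have k: "prob_space (\<kappa>1 n \<omega>)" "prob_space (\<kappa>2 n \<omega>)" "sets (\<kappa>1 n \<omega>) = sets (N n)" "sets (\<kappa>2 n \<omega>) = sets (N n)"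
          by (simp_all add: spF spM space_prob_algebra)
        have fin: "finite_measure (\<kappa>1 n \<omega>)" "finite_measure (\<kappa>2 n \<omega>)" using k by (simp_all add: prob_space_def)
        have sp: "space (\<kappa>1 n \<omega>) = space (\<A> n)" "space (\<kappa>2 n \<omega>) = space (\<A> n)"
          using k(3,4)[THEN sets_eq_imp_space_eq] loc(1)[of n] by simp_all
        have sub: "\<C> n \<subseteq> sets (\<kappa>1 n \<omega>)" "\<C> n \<subseteq> sets (\<kappa>2 n \<omega>)"
          using \<C>_sub[of n] loc(2)[of n] k by auto
        have gen: "A \<in> sigma_sets (space (\<A> n)) (\<C> n)" using A \<C>(3) by simp
        have b: "\<bar>measure (\<kappa>1 n \<omega>) B - measure (\<kappa>2 n \<omega>) B\<bar> \<le> ?b" if "B \<in> \<C> n" for B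
        proof -
          have "\<bar>measure (\<kappa>1 n \<omega>) B - measure (\<kappa>2 n \<omega>) B\<bar> * (?d n \<omega> * (2 - ?d n \<omega>)) \<le> 2 * W n \<omega>"
            using elim(2) that by blast
          then show ?thesis using c by (simp add: pos_le_divide_eq)
        qed
        have "measure (\<kappa>1 n \<omega>) A \<le> 1 * measure (\<kappa>2 n \<omega>) A + ?b"
        proof (rule measure_bound_from_algebra[OF \<C>(2) gen fin(1) sp(1) sub(1) fin(2) sp(2) sub(2)])
          show "measure (\<kappa>1 n \<omega>) B \<le> 1 * measure (\<kappa>2 n \<omega>) B + ?b" if "B \<in> \<C> n" for B
            using b[OF that] by linarith
        qed simp
        moreover have "measure (\<kappa>2 n \<omega>) A \<le> 1 * measure (\<kappa>1 n \<omega>) A + ?b"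
        proof (rule measure_bound_from_algebra[OF \<C>(2) gen fin(2) sp(2) sub(2) fin(1) sp(1) sub(1)])
          show "measure (\<kappa>2 n \<omega>) B \<le> 1 * measure (\<kappa>1 n \<omega>) B + ?b" if "B \<in> \<C> n" for B
            using b[OF that] by linarith
        qed simp
        ultimately show "\<bar>measure (\<kappa>1 n \<omega>) A - measure (\<kappa>2 n \<omega>) A\<bar> \<le> ?b"
          by linarith
      qed
    qed
  qed
  have P1_int: "measure P1 B = (\<integral>\<omega>\<in>B. D \<omega> \<partial>M)" and P2_int: "measure P2 B = (\<integral>\<omega>\<in>B. 2 - D \<omega> \<partial>M)"
    if [measurable]: "B \<in> sets M" for B
  proof -
    have "measure P1 B = (\<integral>\<omega>. indicator B \<omega> \<partial>P1)" "measure P2 B = (\<integral>\<omega>. indicator B \<omega> \<partial>P2)"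
      using that sM sets_eq by simp_all
    moreover have "(\<integral>\<omega>. indicator B \<omega> \<partial>P1) = (\<integral>\<omega>. D \<omega> * indicator B \<omega> \<partial>M)"
      unfolding P1D by (rule integral_real_density) (auto simp: D0)
    moreover have "(\<integral>\<omega>. indicator B \<omega> \<partial>P2) = (\<integral>\<omega>. (2 - D \<omega>) * indicator B \<omega> \<partial>M)"
      unfolding P2D by (rule integral_real_density) (auto simp: D2)
    ultimately show "measure P1 B = (\<integral>\<omega>\<in>B. D \<omega> \<partial>M)" "measure P2 B = (\<integral>\<omega>\<in>B. 2 - D \<omega> \<partial>M)"
      unfolding set_lebesgue_integral_def by (simp_all only: real_scaleR_def mult.commute)
  qed
  have AE_not: "AE \<omega> in P1. \<omega> \<notin> B" if "B \<in> sets Finf" "measure P1 B = 0" for B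
  proof -
    have "B \<in> sets P1" using that(1) Finf(1) by (auto simp: subalgebra_def)
    then have "B \<in> null_sets P1" using that(2) by (simp add: null_sets_def P1.emeasure_eq_measure)
    then show ?thesis by (rule AE_not_in)
  qed
  have "{\<omega> \<in> space Finf. ?dinf \<omega> \<le> 0} \<in> sets Finf" "{\<omega> \<in> space Finf. 2 \<le> ?dinf \<omega>} \<in> sets Finf"
    by measurable
  then have B_Finf: "{\<omega> \<in> space M. ?dinf \<omega> \<le> 0} \<in> sets Finf" "{\<omega> \<in> space M. 2 \<le> ?dinf \<omega>} \<in> sets Finf"
    by (simp_all add: spFI spM)
  then have B_M: "{\<omega> \<in> space M. ?dinf \<omega> \<le> 0} \<in> sets M" "{\<omega> \<in> space M. 2 \<le> ?dinf \<omega>} \<in> sets M"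
    using FIM by (auto simp: subalgebra_def)
  have int_dinf: "integrable M ?dinf" by (rule FI.real_cond_exp_int(1)[OF intD])
  have pos1: "AE \<omega> in P1. 0 < ?dinf \<omega>"
  proof -
    let ?B = "{\<omega> \<in> space M. ?dinf \<omega> \<le> 0}"
    have "measure P1 ?B = (\<integral>\<omega>\<in>?B. ?dinf \<omega> \<partial>M)"
      using P1_int[OF B_M(1)] FI.real_cond_exp_intA[OF intD B_Finf(1)] by simp
    also have "\<dots> \<le> (\<integral>\<omega>. 0 \<partial>M)"
      unfolding set_lebesgue_integral_def
    proof (rule integral_mono)
      show "integrable M (\<lambda>\<omega>. indicator ?B \<omega> *\<^sub>R ?dinf \<omega>)"
        by (rule integrable_mult_indicator[OF B_M(1) int_dinf])
    qed (auto simp: indicator_def)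
    finally have "measure P1 ?B = 0" by (simp add: measure_le_0_iff)
    from AE_not[OF B_Finf(1) this] AE_space show ?thesis by eventually_elim (auto simp: spM)
  qed
  have pos2: "AE \<omega> in P1. ?dinf \<omega> < 2"
  proof -
    let ?B = "{\<omega> \<in> space M. 2 \<le> ?dinf \<omega>}"
    have int2: "integrable M (\<lambda>\<omega>. indicator ?B \<omega> *\<^sub>R D \<omega>)" "integrable M (\<lambda>\<omega>. indicator ?B \<omega> *\<^sub>R ?dinf \<omega>)"
      "integrable M (\<lambda>\<omega>. indicator ?B \<omega> *\<^sub>R (2::real))"
      by (rule integrable_mult_indicator[OF B_M(2)]; simp add: intD int_dinf)+
    have "measure P2 ?B = (\<integral>\<omega>. indicator ?B \<omega> *\<^sub>R 2 - indicator ?B \<omega> *\<^sub>R D \<omega> \<partial>M)"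
      unfolding P2_int[OF B_M(2)] set_lebesgue_integral_def by (simp add: right_diff_distrib)
    also have "\<dots> = (\<integral>\<omega>. indicator ?B \<omega> *\<^sub>R 2 \<partial>M) - (\<integral>\<omega>. indicator ?B \<omega> *\<^sub>R D \<omega> \<partial>M)"
      by (rule Bochner_Integration.integral_diff[OF int2(3,1)])
    also have "(\<integral>\<omega>. indicator ?B \<omega> *\<^sub>R D \<omega> \<partial>M) = (\<integral>\<omega>. indicator ?B \<omega> *\<^sub>R ?dinf \<omega> \<partial>M)"
      using FI.real_cond_exp_intA[OF intD B_Finf(2)] by (simp add: set_lebesgue_integral_def)
    also have "(\<integral>\<omega>. indicator ?B \<omega> *\<^sub>R 2 \<partial>M) - \<dots> \<le> 0"
      using integral_mono[OF int2(3,2)] by (auto simp: indicator_def)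
    finally have "measure P2 ?B = 0" by (simp add: measure_le_0_iff)
    from AE_not[OF B_Finf(2) ac[OF B_Finf(2) this]] AE_space show ?thesis by eventually_elim (auto simp: spM)
  qed
  have transfer: "AE \<omega> in P1. Q \<omega>" if "AE \<omega> in M. Q \<omega>" for Q
    using that unfolding P1D by (subst AE_density) auto
  show ?thesis
    using transfer[OF bound] transfer[OF W_lim] transfer[OF d_lim] pos1 pos2 AE_space
  proof eventually_elim
    case (elim \<omega>)
    note bnd = elim(1)
    let ?c = "\<lambda>n. ?d n \<omega> * (2 - ?d n \<omega>)"
    have c_lim: "?c \<longlonglongrightarrow> ?dinf \<omega> * (2 - ?dinf \<omega>)"
      by (intro tendsto_intros elim(3))
    have c0: "0 < ?dinf \<omega> * (2 - ?dinf \<omega>)" using elim(4,5) by simp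
    have "(\<lambda>n. 2 * (2 * W n \<omega> / ?c n)) \<longlonglongrightarrow> 2 * (2 * 0 / (?dinf \<omega> * (2 - ?dinf \<omega>)))"
      using c0 by (intro tendsto_intros elim(2,3)) auto
    then have lim0: "(\<lambda>n. 2 * (2 * W n \<omega> / ?c n)) \<longlonglongrightarrow> 0" by simp
    show ?case
    proof (rule tendsto_sandwich[OF _ _ tendsto_const lim0])
      have \<kappa>: "prob_space (\<kappa>1 n \<omega>)" "prob_space (\<kappa>2 n \<omega>)" for n
      proof -
        have "\<kappa>1 n \<in> F n \<rightarrow>\<^sub>M prob_algebra (N n)" "\<kappa>2 n \<in> F n \<rightarrow>\<^sub>M prob_algebra (N n)"
          using reg1 reg2 by (simp_all add: regular_cond_law_def)
        from measurable_space[OF this(1), of \<omega>] measurable_space[OF this(2), of \<omega>] elim(6)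
        show "prob_space (\<kappa>1 n \<omega>)" "prob_space (\<kappa>2 n \<omega>)" by (simp_all add: spF space_prob_algebra)
      qed
      show "\<forall>\<^sub>F n in sequentially. 0 \<le> tv_dist (sets (\<A> n)) (\<kappa>1 n \<omega>) (\<kappa>2 n \<omega>)"
        using abs_measure_diff_le_tv_dist[OF \<kappa> sets.empty_sets] by (intro always_eventually allI) fastforce
      have "\<forall>\<^sub>F n in sequentially. 0 < ?c n" using order_tendstoD(1)[OF c_lim c0] .
      then show "\<forall>\<^sub>F n in sequentially. tv_dist (sets (\<A> n)) (\<kappa>1 n \<omega>) (\<kappa>2 n \<omega>) \<le> 2 * (2 * W n \<omega> / ?c n)"
      proof eventually_elim
        case (elim n)
        note c = this
        show ?case
        proof (rule tv_dist_le)
          fix A assume "A \<in> sets (\<A> n)"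
          then show "\<bar>measure (\<kappa>1 n \<omega>) A - measure (\<kappa>2 n \<omega>) A\<bar> \<le> 2 * W n \<omega> / ?c n"
            using bnd c by blast
        qed auto
      qed
    qed
  qed
qed

section \<open>The Markov property of the canonical chain\<close>

text \<open>
  The path \<open>\<omega>\<close> before time \<open>n\<close>, continued by \<open>\<omega>'\<close>. The continuation runs from time \<open>n\<close> on, so its
  first state replaces \<open>\<omega> n\<close>.
\<close>

definition splice_path :: "nat \<Rightarrow> (nat \<Rightarrow> 'a) \<Rightarrow> (nat \<Rightarrow> 'a) \<Rightarrow> nat \<Rightarrow> 'a" where
  "splice_path n \<omega> \<omega>' k = (if k < n then \<omega> k else \<omega>' (k - n))"

lemma space_path_space [simp]: "space path_space = UNIV"
  by (simp add: space_PiM PiE_UNIV_domain)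

lemma cylinder_in_path_space:
  assumes "\<And>i. A i \<in> sets borel"
  shows "{\<omega>. \<forall>i<n. \<omega> i \<in> A i} \<in> sets path_space"
proof -
  note assms[measurable]
  have "{\<omega> \<in> space path_space. \<forall>i<n. \<omega> i \<in> A i} \<in> sets path_space"
    by measurable
  then show ?thesis by simp
qed

lemma prod_emb_cylinder:
  assumes J: "finite J" and E: "\<And>j. j \<in> J \<Longrightarrow> E j \<in> sets (borel :: 'a::topological_space measure)"
  obtains n A where "k \<le> n" "\<And>i. A i \<in> sets borel"
    "prod_emb UNIV (\<lambda>_::nat. borel) J (Pi\<^sub>E J E) = {\<omega>. \<forall>i<n. \<omega> i \<in> A i}"
proof -
  obtain m where m: "\<And>j. j \<in> J \<Longrightarrow> j < m"
    using finite_nat_set_iff_bounded[THEN iffD1, OF J] by auto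
  show thesis
  proof (rule that[of "max m k" "\<lambda>i. if i \<in> J then E i else UNIV"])
    show "prod_emb UNIV (\<lambda>_::nat. borel) J (Pi\<^sub>E J E)
        = {\<omega>. \<forall>i<max m k. \<omega> i \<in> (if i \<in> J then E i else UNIV)}"
      unfolding prod_emb_def using m
      by (fastforce simp: PiE_UNIV_domain less_max_iff_disj)
  qed (use E in auto)
qed

text \<open>
  It suffices to compare cylinders of length at least \<open>k\<close>, because every cylinder can be prolonged;
  then there is no need to distinguish whether a cylinder ends before a given time.
\<close>

lemma path_measure_eqI:
  fixes M N :: "(nat \<Rightarrow> 'a::topological_space) measure"
  assumes "sets M = sets path_space" "sets N = sets path_space" "finite_measure M"
    and eq: "\<And>n A. k \<le> n \<Longrightarrow> (\<And>i. A i \<in> sets borel) \<Longrightarrow>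
      emeasure M {\<omega>. \<forall>i<n. \<omega> i \<in> A i} = emeasure N {\<omega>. \<forall>i<n. \<omega> i \<in> A i}"
  shows "M = N"
proof (rule measure_eqI_PiM_infinite[OF assms(1,2) _ assms(3)])
  fix A :: "nat \<Rightarrow> 'a set" and J :: "nat set"
  assume J: "finite J" "\<And>i. i \<in> J \<Longrightarrow> A i \<in> sets borel"
  let ?X = "prod_emb UNIV (\<lambda>_. borel) J (Pi\<^sub>E J A)"
  show "emeasure M ?X = emeasure N ?X"
    by (rule prod_emb_cylinder[where k=k and E=A, OF J], assumption) (simp add: eq)
qed

lemma splice_measurable [measurable]:
  "(\<lambda>(\<omega>, \<omega>'). splice_path n \<omega> \<omega>') \<in> path_space \<Otimes>\<^sub>M path_space \<rightarrow>\<^sub>M path_space"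
  unfolding splice_path_def by (rule measurable_PiM_single') (auto simp: split_beta PiE_UNIV_domain)

lemma splice_measurable2 [measurable]: "splice_path n \<omega> \<in> path_space \<rightarrow>\<^sub>M path_space"
  unfolding splice_path_def by (rule measurable_PiM_single') (auto simp: PiE_UNIV_domain)

lemma case_nat_measurable_path [measurable]: "case_nat z \<in> path_space \<rightarrow>\<^sub>M path_space"
  by (rule measurable_PiM_single') (auto simp: PiE_UNIV_domain split: nat.split)

locale markov_kernel =
  fixes P :: "'a::topological_space \<Rightarrow> 'a measure"
  assumes kernel: "P \<in> borel \<rightarrow>\<^sub>M prob_algebra borel"

begin

lemma kernel_subprob [measurable]: "P \<in> borel \<rightarrow>\<^sub>M subprob_algebra borel"
  by (rule measurable_prob_algebraD[OF kernel])

lemma prob_space_kernel: "prob_space (P z)"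
  using measurable_space[OF kernel, of z] by (simp add: space_prob_algebra)

lemma sets_kernel [measurable_cong, simp]: "sets (P z) = sets borel"
  using measurable_space[OF kernel, of z] by (simp add: space_prob_algebra)

lemma space_kernel [simp]: "space (P z) = UNIV"
  using sets_eq_imp_space_eq[OF sets_kernel] by simp

text \<open>
  The defining step of the chain, in the form of an integral over the path space.
\<close>

lemma chain_law_integral_step:
  assumes nu: "\<nu> \<in> space (prob_algebra borel)"
    and [measurable]: "\<And>i. A i \<in> sets borel" "h \<in> borel_measurable borel"
  shows "(\<integral>\<^sup>+\<omega>. (\<Prod>i<n. indicator (A i) (\<omega> i)) * h (\<omega> n) \<partial>chain_law P \<nu>)
    = (\<integral>\<^sup>+\<omega>. (\<Prod>i<n. indicator (A i) (\<omega> i)) * (\<integral>\<^sup>+z. h z \<partial>transition P \<nu> n \<omega>) \<partial>chain_law P \<nu>)"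
proof -
  interpret IT: Ionescu_Tulcea "transition P \<nu>" "\<lambda>_. borel"
    by (rule Ionescu_Tulcea_transition[OF kernel nu])
  have [measurable_cong]: "sets (chain_law P \<nu>) = sets path_space"
    using chain_law_in_prob_algebra[OF kernel nu] by (simp add: space_prob_algebra)
  have trans_meas [measurable]: "(\<lambda>\<omega>. \<integral>\<^sup>+z. h z \<partial>transition P \<nu> n \<omega>) \<in> borel_measurable (PiM {0..<n} (\<lambda>_. borel))"
    using IT.P(1)[of n] by measurable
  let ?\<phi> = "\<lambda>\<omega>. (\<Prod>i<n. indicator (A i) (\<omega> i)) * h (\<omega> n) :: ennreal"
  let ?L = "\<lambda>n. distr (chain_law P \<nu>) (PiM {0..<n} (\<lambda>_. borel)) (\<lambda>x. restrict x {0..<n})"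
  have phi [measurable]: "?\<phi> \<in> borel_measurable (PiM {0..<Suc n} (\<lambda>_. borel))"
    by measurable
  have tr: "transition P \<nu> n (restrict \<omega> {0..<n}) = transition P \<nu> n \<omega>" for \<omega>
    by (auto simp: transition_def split: nat.split)
  have "(\<integral>\<^sup>+\<omega>. ?\<phi> \<omega> \<partial>chain_law P \<nu>) = (\<integral>\<^sup>+\<omega>. ?\<phi> \<omega> \<partial>?L (Suc n))"
    by (subst nn_integral_distr) (auto intro!: nn_integral_cong prod.cong)
  also have "?L (Suc n) = ?L n \<bind> IT.eP n"
    using chain_law_step[OF kernel nu, of n] by (simp add: IT.eP_def[abs_def] transition_def)
  also have "(\<integral>\<^sup>+\<omega>. ?\<phi> \<omega> \<partial>(?L n \<bind> IT.eP n)) = (\<integral>\<^sup>+\<omega>. \<integral>\<^sup>+x. ?\<phi> x \<partial>IT.eP n \<omega> \<partial>?L n)"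
    by (rule nn_integral_bind[OF phi]) simp
  also have "\<dots> = (\<integral>\<^sup>+\<omega>. (\<integral>\<^sup>+z. (\<Prod>i<n. indicator (A i) (\<omega> i)) * h z \<partial>transition P \<nu> n \<omega>) \<partial>?L n)"
  proof (rule nn_integral_cong)
    fix \<omega> assume "\<omega> \<in> space (?L n)"
    then have w: "\<omega> \<in> space (PiM {0..<n} (\<lambda>_. borel))" by simp
    show "(\<integral>\<^sup>+x. ?\<phi> x \<partial>IT.eP n \<omega>) = (\<integral>\<^sup>+z. (\<Prod>i<n. indicator (A i) (\<omega> i)) * h z \<partial>transition P \<nu> n \<omega>)"
      by (subst IT.nn_integral_eP[OF w phi]) (auto intro!: nn_integral_cong prod.cong)
  qed
  also have "\<dots> = (\<integral>\<^sup>+\<omega>. (\<Prod>i<n. indicator (A i) (\<omega> i)) * (\<integral>\<^sup>+z. h z \<partial>transition P \<nu> n \<omega>) \<partial>?L n)"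
  proof (rule nn_integral_cong)
    fix \<omega> assume "\<omega> \<in> space (?L n)"
    then have w: "\<omega> \<in> space (PiM {0..<n} (\<lambda>_. borel))" by simp
    have s: "sets (transition P \<nu> n \<omega>) = sets borel"
      using IT.sets_P[OF w] .
    show "(\<integral>\<^sup>+z. (\<Prod>i<n. indicator (A i) (\<omega> i)) * h z \<partial>transition P \<nu> n \<omega>)
        = (\<Prod>i<n. indicator (A i) (\<omega> i)) * (\<integral>\<^sup>+z. h z \<partial>transition P \<nu> n \<omega>)"
      by (rule nn_integral_cmult) (simp add: measurable_cong_sets[OF s refl])
  qed
  also have "\<dots> = (\<integral>\<^sup>+\<omega>. (\<Prod>i<n. indicator (A i) (\<omega> i)) * (\<integral>\<^sup>+z. h z \<partial>transition P \<nu> n \<omega>) \<partial>chain_law P \<nu>)"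
    by (subst nn_integral_distr) (auto intro!: nn_integral_cong prod.cong simp: tr)
  finally show ?thesis .
qed

text \<open>
  The mean of \<open>1 (\<omega> 0 \<in> A 0) * \<dots> * 1 (\<omega> (n - 1) \<in> A (n - 1)) * h (\<omega> n)\<close> for the chain started at
  \<open>z\<close>, computed forwards from the first step, whereas \<open>chain_law_step\<close> peels off the last one.
\<close>

primrec cyl_integral :: "nat \<Rightarrow> (nat \<Rightarrow> 'a set) \<Rightarrow> ('a \<Rightarrow> ennreal) \<Rightarrow> 'a \<Rightarrow> ennreal" where
  "cyl_integral 0 A h z = h z"
| "cyl_integral (Suc n) A h z = indicator (A 0) z * (\<integral>\<^sup>+z'. cyl_integral n (\<lambda>i. A (Suc i)) h z' \<partial>P z)"

lemma cyl_integral_measurable: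
  assumes "\<And>i. A i \<in> sets borel" and [measurable]: "h \<in> borel_measurable borel"
  shows "cyl_integral n A h \<in> borel_measurable borel"
  using assms(1)
proof (induction n arbitrary: A)
  case 0
  have "cyl_integral 0 A h = h" by (simp add: fun_eq_iff)
  then show ?case by simp
next
  case (Suc n)
  have [measurable]: "A 0 \<in> sets borel" "cyl_integral n (\<lambda>i. A (Suc i)) h \<in> borel_measurable borel"
    using Suc by auto
  have "cyl_integral (Suc n) A h = (\<lambda>z. indicator (A 0) z * (\<integral>\<^sup>+z'. cyl_integral n (\<lambda>i. A (Suc i)) h z' \<partial>P z))"
    by (simp add: fun_eq_iff)
  then show ?case by simp
qed

lemma cyl_integral_add:
  "cyl_integral (n + k) A h z = cyl_integral n A (cyl_integral k (\<lambda>i. A (n + i)) h) z"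
  by (induction n arbitrary: A z) simp_all

lemma chain_law_cyl_integral:
  assumes nu: "\<nu> \<in> space (prob_algebra borel)"
    and A[measurable]: "\<And>i. A i \<in> sets borel" and "h \<in> borel_measurable borel"
  shows "(\<integral>\<^sup>+\<omega>. (\<Prod>i<n. indicator (A i) (\<omega> i)) * h (\<omega> n) \<partial>chain_law P \<nu>)
    = (\<integral>\<^sup>+z. cyl_integral n A h z \<partial>\<nu>)"
  using assms(3)
proof (induction n arbitrary: h)
  case 0
  have "prob_space (chain_law P \<nu>)"
    using chain_law_in_prob_algebra[OF kernel nu] by (simp add: space_prob_algebra)
  then show ?case
    using chain_law_integral_step[OF nu A 0, where n=0]
    by (simp add: transition_def prob_space.emeasure_space_1)
next
  case (Suc n)
  note [measurable] = Suc.prems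
  have h': "(\<lambda>z. indicator (A n) z * (\<integral>\<^sup>+z'. h z' \<partial>P z)) \<in> borel_measurable borel"
    by measurable
  have eq: "cyl_integral (Suc n) A h z = cyl_integral n A (\<lambda>z. indicator (A n) z * (\<integral>\<^sup>+z'. h z' \<partial>P z)) z" for z
  proof -
    have "cyl_integral (Suc 0) (\<lambda>i. A (n + i)) h = (\<lambda>z. indicator (A n) z * (\<integral>\<^sup>+z'. h z' \<partial>P z))"
      by (simp add: fun_eq_iff)
    then show ?thesis using cyl_integral_add[of n 1 A h z] by simp
  qed
  show ?case
    using Suc.IH[OF h'] chain_law_integral_step[where A=A and n="Suc n", OF nu A Suc.prems]
    unfolding eq by (simp add: transition_def mult.assoc)
qed

definition path_from :: "'a \<Rightarrow> (nat \<Rightarrow> 'a) measure" where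
  "path_from z = chain_law P (return borel z)"

lemma return_in_prob_algebra: "return borel z \<in> space (prob_algebra borel)"
  by (simp add: space_prob_algebra prob_space_return)

lemma prob_space_chain_law: "\<nu> \<in> space (prob_algebra borel) \<Longrightarrow> prob_space (chain_law P \<nu>)"
  using chain_law_in_prob_algebra[OF kernel] by (simp add: space_prob_algebra)

lemma sets_chain_law: "\<nu> \<in> space (prob_algebra borel) \<Longrightarrow> sets (chain_law P \<nu>) = sets path_space"
  using chain_law_in_prob_algebra[OF kernel] by (simp add: space_prob_algebra)

lemma prob_space_path_from: "prob_space (path_from z)"
  unfolding path_from_def by (intro prob_space_chain_law return_in_prob_algebra)

lemma sets_path_from [measurable_cong, simp]: "sets (path_from z) = sets path_space"
  unfolding path_from_def by (intro sets_chain_law return_in_prob_algebra)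

lemma space_path_from [simp]: "space (path_from z) = UNIV"
  using sets_eq_imp_space_eq[OF sets_path_from] by simp

lemma prod_indicator_cylinder:
  fixes n :: nat
  shows "(\<Prod>i<n. indicator (A i) (\<omega> i)) = (indicator {\<omega>. \<forall>i<n. \<omega> i \<in> A i} \<omega> :: ennreal)"
  by (induction n) (auto simp: indicator_def less_Suc_eq)

lemma chain_law_cylinder:
  assumes nu: "\<nu> \<in> space (prob_algebra borel)" and A: "\<And>i. A i \<in> sets borel"
  shows "emeasure (chain_law P \<nu>) {\<omega>. \<forall>i<n. \<omega> i \<in> A i} = (\<integral>\<^sup>+z. cyl_integral n A (\<lambda>_. 1) z \<partial>\<nu>)"
proof -
  have "{\<omega>. \<forall>i<n. \<omega> i \<in> A i} \<in> sets (chain_law P \<nu>)"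
    using cylinder_in_path_space[of A n] A sets_chain_law[OF nu] by simp
  then show ?thesis
    using chain_law_cyl_integral[where h="\<lambda>_. 1" and n=n and A=A, OF nu A] by (simp add: prod_indicator_cylinder)
qed

lemma path_from_cyl_integral:
  assumes A: "\<And>i. A i \<in> sets borel" and h: "h \<in> borel_measurable borel"
  shows "(\<integral>\<^sup>+\<omega>. (\<Prod>i<n. indicator (A i) (\<omega> i)) * h (\<omega> n) \<partial>path_from z) = cyl_integral n A h z"
  unfolding path_from_def
  by (subst chain_law_cyl_integral[OF return_in_prob_algebra A h])
    (auto intro!: nn_integral_return cyl_integral_measurable A h)

lemma path_from_cylinder:
  assumes A: "\<And>i. A i \<in> sets borel"
  shows "emeasure (path_from z) {\<omega>. \<forall>i<n. \<omega> i \<in> A i} = cyl_integral n A (\<lambda>_. 1) z"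
  unfolding path_from_def
  by (subst chain_law_cylinder[OF return_in_prob_algebra A])
    (auto intro!: nn_integral_return cyl_integral_measurable A)

lemma path_from_kernel [measurable]: "path_from \<in> borel \<rightarrow>\<^sub>M prob_algebra path_space"
proof (rule measurable_prob_algebra_generated[OF sets_PiM Int_stable_prod_algebra])
  fix X assume X: "X \<in> prod_algebra UNIV (\<lambda>_::nat. borel :: 'a measure)"
  then obtain n A where A: "\<And>i. A i \<in> sets borel" and X: "X = {\<omega>. \<forall>i<n. \<omega> i \<in> A i}"
  proof -
    obtain J E where X: "X = prod_emb UNIV (\<lambda>_. borel) J (Pi\<^sub>E J E)" "finite J" "\<And>j. j \<in> J \<Longrightarrow> E j \<in> sets borel"
      by (rule prod_algebraE[OF X]) simp
    show thesis by (rule prod_emb_cylinder[where k=0, OF X(2,3)], assumption) (rule that, auto simp: X(1))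
  qed
  show "(\<lambda>z. emeasure (path_from z) X) \<in> borel_measurable borel"
    unfolding X path_from_cylinder[of A, OF A] by (rule cyl_integral_measurable[OF A]) simp
qed (auto simp: prob_space_path_from prod_algebra_sets_into_space)

lemma path_from_subprob [measurable]: "path_from \<in> borel \<rightarrow>\<^sub>M subprob_algebra path_space"
  by (rule measurable_prob_algebraD[OF path_from_kernel])

lemma chain_law_mixture:
  assumes nu: "\<nu> \<in> space (prob_algebra borel)"
  shows "chain_law P \<nu> = \<nu> \<bind> path_from"
proof (rule path_measure_eqI[where k=0])
  show "finite_measure (chain_law P \<nu>)"
    using prob_space_chain_law[OF nu] by (simp add: prob_space_def)
next
  fix n :: nat and A :: "nat \<Rightarrow> 'a set" assume A: "\<And>i. A i \<in> sets borel"
  have "emeasure (\<nu> \<bind> path_from) {\<omega>. \<forall>i<n. \<omega> i \<in> A i} = (\<integral>\<^sup>+z. emeasure (path_from z) {\<omega>. \<forall>i<n. \<omega> i \<in> A i} \<partial>\<nu>)"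
    by (rule emeasure_bind_prob_algebra[OF nu path_from_kernel cylinder_in_path_space[of A, OF A]])
  then show "emeasure (chain_law P \<nu>) {\<omega>. \<forall>i<n. \<omega> i \<in> A i} = emeasure (\<nu> \<bind> path_from) {\<omega>. \<forall>i<n. \<omega> i \<in> A i}"
    by (simp add: chain_law_cylinder[OF nu A] path_from_cylinder[of A, OF A])
qed (simp_all add: sets_chain_law[OF nu] sets_bind'[OF nu path_from_kernel])

lemma emeasure_chain_law_mixture:
  assumes nu: "\<nu> \<in> space (prob_algebra borel)" and A: "A \<in> sets path_space"
  shows "emeasure (chain_law P \<nu>) A = (\<integral>\<^sup>+z. emeasure (path_from z) A \<partial>\<nu>)"
  unfolding chain_law_mixture[OF nu] by (rule emeasure_bind_prob_algebra[OF nu path_from_kernel A])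

lemma continuation_kernel:
  "(\<lambda>\<omega>. distr (path_from (\<omega> n)) path_space (splice_path n \<omega>)) \<in> path_space \<rightarrow>\<^sub>M prob_algebra path_space"
proof (rule measurable_prob_algebraI)
  show "(\<lambda>\<omega>. distr (path_from (\<omega> n)) path_space (splice_path n \<omega>)) \<in> path_space \<rightarrow>\<^sub>M subprob_algebra path_space"
    by (rule measurable_distr2[where M=path_space]) measurable
  show "prob_space (distr (path_from (\<omega> n)) path_space (splice_path n \<omega>))" for \<omega>
    by (rule prob_space.prob_space_distr[OF prob_space_path_from]) simp
qed

lemma splice_cylinder:
  fixes n N :: nat
  shows "n \<le> N \<Longrightarrow> splice_path n \<omega> -` {\<omega>. \<forall>i<N. \<omega> i \<in> A i} =
     (if \<forall>i<n. \<omega> i \<in> A i then {\<omega>'. \<forall>i<N - n. \<omega>' i \<in> A (n + i)} else {})"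
proof (intro set_eqI)
  fix \<omega>'
  assume "n \<le> N"
  have "(\<forall>i<N. splice_path n \<omega> \<omega>' i \<in> A i) \<longleftrightarrow> (\<forall>i<n. \<omega> i \<in> A i) \<and> (\<forall>i<N - n. \<omega>' i \<in> A (n + i))"
  proof (intro iffI conjI allI impI)
    fix i assume *: "\<forall>i<N. splice_path n \<omega> \<omega>' i \<in> A i"
    show "\<omega> i \<in> A i" if "i < n"
      using *[rule_format, of i] that \<open>n \<le> N\<close> by (simp add: splice_path_def)
    show "\<omega>' i \<in> A (n + i)" if "i < N - n"
      using *[rule_format, of "n + i"] that by (simp add: splice_path_def)
  next
    fix i assume "(\<forall>i<n. \<omega> i \<in> A i) \<and> (\<forall>i<N - n. \<omega>' i \<in> A (n + i))" "i < N"
    moreover have "i - n < N - n" "n + (i - n) = i" if "\<not> i < n" using that \<open>i < N\<close> by auto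
    ultimately show "splice_path n \<omega> \<omega>' i \<in> A i" by (auto simp: splice_path_def)
  qed
  then show "\<omega>' \<in> splice_path n \<omega> -` {\<omega>. \<forall>i<N. \<omega> i \<in> A i} \<longleftrightarrow>
      \<omega>' \<in> (if \<forall>i<n. \<omega> i \<in> A i then {\<omega>'. \<forall>i<N - n. \<omega>' i \<in> A (n + i)} else {})"
    by simp
qed

text \<open>
  Resampling the path from time \<open>n\<close> on, given its state at time \<open>n\<close>, does not change its law. Both
  sides give a cylinder of length at least \<open>n\<close> the probability computed by \<open>cyl_integral\<close>.
\<close>

lemma markov_property:
  assumes nu: "\<nu> \<in> space (prob_algebra borel)"
  shows "chain_law P \<nu> = chain_law P \<nu> \<bind> (\<lambda>\<omega>. distr (path_from (\<omega> n)) path_space (splice_path n \<omega>))" (is "_ = ?R")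
proof (rule path_measure_eqI[where k=n])
  note chain = chain_law_in_prob_algebra[OF kernel nu]
  show "finite_measure (chain_law P \<nu>)"
    using prob_space_chain_law[OF nu] by (simp add: prob_space_def)
  show "sets ?R = sets path_space"
    by (rule sets_bind'[OF chain continuation_kernel])
  fix N :: nat and A :: "nat \<Rightarrow> 'a set" assume "n \<le> N" and A: "\<And>i. A i \<in> sets borel"
  let ?X = "{\<omega>. \<forall>i<N. \<omega> i \<in> A i}"
  let ?h = "\<lambda>z. cyl_integral (N - n) (\<lambda>i. A (n + i)) (\<lambda>_. 1) z"
  have "emeasure ?R ?X = (\<integral>\<^sup>+\<omega>. emeasure (distr (path_from (\<omega> n)) path_space (splice_path n \<omega>)) ?X \<partial>chain_law P \<nu>)"
    by (rule emeasure_bind_prob_algebra[OF chain continuation_kernel cylinder_in_path_space[of A, OF A]])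
  also have "\<dots> = (\<integral>\<^sup>+\<omega>. (\<Prod>i<n. indicator (A i) (\<omega> i)) * ?h (\<omega> n) \<partial>chain_law P \<nu>)"
  proof (rule nn_integral_cong)
    fix \<omega>
    have "emeasure (distr (path_from (\<omega> n)) path_space (splice_path n \<omega>)) ?X = emeasure (path_from (\<omega> n)) (splice_path n \<omega> -` ?X)"
      by (subst emeasure_distr) (auto simp: cylinder_in_path_space A)
    then show "emeasure (distr (path_from (\<omega> n)) path_space (splice_path n \<omega>)) ?X = (\<Prod>i<n. indicator (A i) (\<omega> i)) * ?h (\<omega> n)"
      unfolding splice_cylinder[OF \<open>n \<le> N\<close>] prod_indicator_cylinder by (simp add: path_from_cylinder A)
  qed
  also have "\<dots> = (\<integral>\<^sup>+z. cyl_integral N A (\<lambda>_. 1) z \<partial>\<nu>)"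
    using chain_law_cyl_integral[OF nu A cyl_integral_measurable, where n=n]
      cyl_integral_add[of n "N - n" A "\<lambda>_. 1"] A \<open>n \<le> N\<close> by simp
  finally show "emeasure (chain_law P \<nu>) ?X = emeasure ?R ?X"
    by (simp add: chain_law_cylinder[OF nu A])
qed (rule sets_chain_law[OF nu])

lemma splice_vimage_measurable [measurable]: "A \<in> sets path_space \<Longrightarrow> splice_path n \<omega> -` A \<in> sets path_space"
  using measurable_sets[OF splice_measurable2] by fastforce

text \<open>
  The function under the integral is a version of the conditional probability of \<open>A\<close> given the path
  up to time \<open>n\<close>.
\<close>

lemma emeasure_chain_law_splice:
  assumes nu: "\<nu> \<in> space (prob_algebra borel)" and A: "A \<in> sets path_space"
  shows "emeasure (chain_law P \<nu>) A = (\<integral>\<^sup>+\<omega>. emeasure (path_from (\<omega> n)) (splice_path n \<omega> -` A) \<partial>chain_law P \<nu>)"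
proof -
  have "emeasure (chain_law P \<nu>) A = (\<integral>\<^sup>+\<omega>. emeasure (distr (path_from (\<omega> n)) path_space (splice_path n \<omega>)) A \<partial>chain_law P \<nu>)"
    by (subst markov_property[OF nu, of n])
      (rule emeasure_bind_prob_algebra[OF chain_law_in_prob_algebra[OF kernel nu] continuation_kernel A])
  then show ?thesis using A by (simp add: emeasure_distr)
qed

lemma path_from_step:
  "path_from z = P z \<bind> (\<lambda>z1. distr (path_from z1) path_space (case_nat z))" (is "_ = ?R")
proof (rule path_measure_eqI[where k=1])
  have Pz: "P z \<in> space (prob_algebra borel)" by (simp add: space_prob_algebra prob_space_kernel)
  have k: "(\<lambda>z1. distr (path_from z1) path_space (case_nat z)) \<in> borel \<rightarrow>\<^sub>M prob_algebra path_space"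
    by (rule measurable_compose[OF path_from_kernel measurable_distr_prob_space]) simp
  show "finite_measure (path_from z)"
    using prob_space_path_from by (simp add: prob_space_def)
  show "sets ?R = sets path_space"
    by (rule sets_bind'[OF Pz k])
  fix N :: nat and A :: "nat \<Rightarrow> 'a set" assume "1 \<le> N" and A: "\<And>i. A i \<in> sets borel"
  then obtain n where N: "N = Suc n" by (cases N) auto
  let ?X = "{\<omega>. \<forall>i<N. \<omega> i \<in> A i}"
  have v: "case_nat z -` ?X = (if z \<in> A 0 then {\<omega>. \<forall>i<n. \<omega> i \<in> A (Suc i)} else {})"
    unfolding N by (auto simp: less_Suc_eq_0_disj)
  have "emeasure ?R ?X = (\<integral>\<^sup>+z1. emeasure (distr (path_from z1) path_space (case_nat z)) ?X \<partial>P z)"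
    by (rule emeasure_bind_prob_algebra[OF Pz k cylinder_in_path_space[of A, OF A]])
  also have "\<dots> = (\<integral>\<^sup>+z1. indicator (A 0) z * cyl_integral n (\<lambda>i. A (Suc i)) (\<lambda>_. 1) z1 \<partial>P z)"
  proof (rule nn_integral_cong)
    fix z1
    have "emeasure (distr (path_from z1) path_space (case_nat z)) ?X = emeasure (path_from z1) (case_nat z -` ?X)"
      by (subst emeasure_distr) (auto simp: cylinder_in_path_space A)
    then show "emeasure (distr (path_from z1) path_space (case_nat z)) ?X = indicator (A 0) z * cyl_integral n (\<lambda>i. A (Suc i)) (\<lambda>_. 1) z1"
      unfolding v by (simp add: path_from_cylinder A)
  qed
  also have "\<dots> = cyl_integral N A (\<lambda>_. 1) z"
  proof -
    have "cyl_integral n (\<lambda>i. A (Suc i)) (\<lambda>_. 1) \<in> borel_measurable borel"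
      by (rule cyl_integral_measurable) (auto simp: A)
    then show ?thesis unfolding N by (simp add: nn_integral_cmult)
  qed
  finally show "emeasure (path_from z) ?X = emeasure ?R ?X"
    by (simp add: path_from_cylinder A)
qed simp

lemma case_nat_vimage_measurable [measurable]: "A \<in> sets path_space \<Longrightarrow> case_nat z -` A \<in> sets path_space"
  using measurable_sets[OF case_nat_measurable_path] by fastforce

lemma emeasure_path_from_step:
  assumes A: "A \<in> sets path_space"
  shows "emeasure (path_from z) A = (\<integral>\<^sup>+z1. emeasure (path_from z1) (case_nat z -` A) \<partial>P z)"
proof -
  have Pz: "P z \<in> space (prob_algebra borel)" by (simp add: space_prob_algebra prob_space_kernel)
  have k: "(\<lambda>z1. distr (path_from z1) path_space (case_nat z)) \<in> borel \<rightarrow>\<^sub>M prob_algebra path_space"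
    by (rule measurable_compose[OF path_from_kernel measurable_distr_prob_space]) simp
  show ?thesis using A
    by (subst path_from_step)
      (simp add: emeasure_bind_prob_algebra[OF Pz k] emeasure_distr)
qed

lemma distr_chain_law_invariant:
  assumes nu: "\<nu> \<in> space (prob_algebra borel)" and inv: "markov_invariant P \<nu>"
    and h: "h \<in> borel_measurable borel"
  shows "(\<integral>\<^sup>+\<omega>. h (\<omega> n) \<partial>chain_law P \<nu>) = (\<integral>\<^sup>+z. h z \<partial>\<nu>)"
  using h
proof (induction n arbitrary: h)
  case 0
  then show ?case using chain_law_cyl_integral[OF nu _ 0, where A="\<lambda>_. UNIV" and n=0] by simp
next
  case (Suc n)
  note [measurable] = Suc.prems
  have s: "sets \<nu> = sets borel" using nu by (simp add: space_prob_algebra)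
  have "(\<integral>\<^sup>+\<omega>. h (\<omega> (Suc n)) \<partial>chain_law P \<nu>) = (\<integral>\<^sup>+\<omega>. (\<integral>\<^sup>+z. h z \<partial>P (\<omega> n)) \<partial>chain_law P \<nu>)"
    using chain_law_integral_step[OF nu _ Suc.prems, where A="\<lambda>_. UNIV" and n="Suc n"] by (simp add: transition_def)
  also have "\<dots> = (\<integral>\<^sup>+z. (\<integral>\<^sup>+z'. h z' \<partial>P z) \<partial>\<nu>)"
    by (rule Suc.IH) measurable
  also have "\<dots> = (\<integral>\<^sup>+z. h z \<partial>(\<nu> \<bind> P))"
    by (rule nn_integral_bind[symmetric, OF Suc.prems])
      (simp add: measurable_cong_sets[OF s refl])
  finally show ?case using inv by (simp add: markov_invariant_def)
qed

lemma nn_integral_path_from_step: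
  assumes h[measurable]: "h \<in> borel_measurable path_space"
  shows "(\<integral>\<^sup>+\<omega>. h \<omega> \<partial>path_from z) = (\<integral>\<^sup>+z1. \<integral>\<^sup>+\<omega>. h (case_nat z \<omega>) \<partial>path_from z1 \<partial>P z)"
proof -
  have k: "(\<lambda>z1. distr (path_from z1) path_space (case_nat z)) \<in> borel \<rightarrow>\<^sub>M prob_algebra path_space"
    by (rule measurable_compose[OF path_from_kernel measurable_distr_prob_space]) simp
  have "(\<lambda>z1. distr (path_from z1) path_space (case_nat z)) \<in> P z \<rightarrow>\<^sub>M subprob_algebra path_space"
    using measurable_prob_algebraD[OF k] by (simp add: measurable_cong_sets[OF sets_kernel refl])
  then show ?thesis
    by (subst path_from_step) (simp add: nn_integral_bind[OF h] nn_integral_distr)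
qed

lemma nn_integral_path_from_initial:
  assumes "h \<in> borel_measurable borel"
  shows "(\<integral>\<^sup>+\<omega>. h (\<omega> 0) \<partial>path_from z) = h z"
  using path_from_cyl_integral[where A="\<lambda>_. UNIV" and n=0 and z=z, OF _ assms] by simp

lemma AE_path_from_initial:
  assumes z: "{z} \<in> sets borel"
  shows "AE \<omega> in path_from z. \<omega> 0 = z"
proof -
  have Z [measurable]: "- {z} \<in> sets borel"
    using sets.compl_sets[OF z] by (simp add: Compl_eq_Diff_UNIV)
  have "(\<integral>\<^sup>+\<omega>. indicator (- {z}) (\<omega> 0) \<partial>path_from z) = 0"
    using nn_integral_path_from_initial[of "indicator (- {z})" z] by simp
  moreover have "(\<lambda>\<omega>. indicator (- {z}) (\<omega> 0) :: ennreal) \<in> borel_measurable (path_from z)"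
    by measurable
  ultimately have "AE \<omega> in path_from z. indicator (- {z}) (\<omega> 0) = (0::ennreal)"
    by (simp add: nn_integral_0_iff_AE)
  then show ?thesis by eventually_elim (simp add: indicator_def split: if_splits)
qed

lemma splice_measure_measurable:
  assumes C: "C \<in> sets path_space" and k: "\<kappa> \<in> path_space \<rightarrow>\<^sub>M borel"
  shows "(\<lambda>\<omega>. measure (path_from (\<kappa> \<omega>)) (splice_path n \<omega> -` C)) \<in> borel_measurable path_space"
proof -
  have "(\<lambda>\<omega>. distr (path_from (\<kappa> \<omega>)) path_space (splice_path n \<omega>)) \<in> path_space \<rightarrow>\<^sub>M subprob_algebra path_space"
    by (rule measurable_distr2[where M=path_space, OF splice_measurable measurable_compose[OF k path_from_subprob]])
  from measurable_compose[OF this measurable_measure_subprob_algebra[OF C]]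
  show ?thesis using C by (simp add: measure_distr)
qed

lemma integral_splice_measure:
  assumes nu: "\<nu> \<in> space (prob_algebra borel)" and C: "C \<in> sets path_space"
  shows "(\<integral>\<omega>. measure (path_from (\<omega> n)) (splice_path n \<omega> -` C) \<partial>chain_law P \<nu>) = measure (chain_law P \<nu>) C"
proof -
  have m: "(\<lambda>\<omega>. measure (path_from (\<omega> n)) (splice_path n \<omega> -` C)) \<in> borel_measurable (chain_law P \<nu>)"
    using splice_measure_measurable[OF C, of "\<lambda>\<omega>. \<omega> n" n] by (simp add: measurable_cong_sets[OF sets_chain_law[OF nu] refl])
  have "(\<integral>\<omega>. measure (path_from (\<omega> n)) (splice_path n \<omega> -` C) \<partial>chain_law P \<nu>)
      = enn2real (\<integral>\<^sup>+\<omega>. ennreal (measure (path_from (\<omega> n)) (splice_path n \<omega> -` C)) \<partial>chain_law P \<nu>)"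
    by (rule integral_eq_nn_integral[OF m]) simp
  also have "(\<integral>\<^sup>+\<omega>. ennreal (measure (path_from (\<omega> n)) (splice_path n \<omega> -` C)) \<partial>chain_law P \<nu>) = emeasure (chain_law P \<nu>) C"
    unfolding emeasure_chain_law_splice[OF nu C, of n]
    using prob_space_path_from by (simp add: finite_measure.emeasure_eq_measure prob_space_def)
  finally show ?thesis by (simp add: measure_def)
qed

text \<open>
  A zero-one law, in mean. For an event that is determined by finitely many coordinates the
  conditional probability given the path up to time \<open>n\<close> is eventually equal to the indicator, and
  such events approximate all events.
\<close>

lemma splice_measure_tendsto_indicator:
  assumes nu: "\<nu> \<in> space (prob_algebra borel)" and A: "A \<in> sets path_space"
  shows "(\<lambda>n. \<integral>\<omega>. \<bar>measure (path_from (\<omega> n)) (splice_path n \<omega> -` A) - indicator A \<omega>\<bar> \<partial>chain_law P \<nu>) \<longlonglongrightarrow> 0"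
proof -
  let ?M = "chain_law P \<nu>"
  let ?u = "\<lambda>n C \<omega>. measure (path_from (\<omega> n)) (splice_path n \<omega> -` C)"
  interpret M: prob_space ?M by (rule prob_space_chain_law[OF nu])
  note sM = sets_chain_law[OF nu]
  have spM: "space ?M = UNIV" using sets_eq_imp_space_eq[OF sM] by simp
  \<comment> \<open>The events that are determined by finitely many coordinates.\<close>
  define \<A> :: "(nat \<Rightarrow> 'a) set set" where "\<A> = {B \<in> sets path_space. \<exists>k. \<forall>\<omega> \<omega>'. (\<forall>i<k. \<omega> i = \<omega>' i) \<longrightarrow> (\<omega> \<in> B \<longleftrightarrow> \<omega>' \<in> B)}"
  have alg: "algebra UNIV \<A>"
    unfolding algebra_iff_Un
  proof (intro conjI ballI)
    fix a b assume "a \<in> \<A>" "b \<in> \<A>"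
    then obtain i j where a: "a \<in> sets path_space" "\<And>\<omega> \<omega>'. (\<forall>l<i. \<omega> l = \<omega>' l) \<Longrightarrow> \<omega> \<in> a \<longleftrightarrow> \<omega>' \<in> a"
      and b: "b \<in> sets path_space" "\<And>\<omega> \<omega>'. (\<forall>l<j. \<omega> l = \<omega>' l) \<Longrightarrow> \<omega> \<in> b \<longleftrightarrow> \<omega>' \<in> b"
      unfolding \<A>_def by blast
    have "\<omega> \<in> a \<union> b \<longleftrightarrow> \<omega>' \<in> a \<union> b" if "\<forall>l<max i j. \<omega> l = \<omega>' l" for \<omega> \<omega>'
      using a(2)[of \<omega> \<omega>'] b(2)[of \<omega> \<omega>'] that by simp
    then show "a \<union> b \<in> \<A>" using a(1) b(1) unfolding \<A>_def by blast
  next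
    fix a assume "a \<in> \<A>"
    moreover have "UNIV - a \<in> sets path_space" if "a \<in> sets path_space"
      using sets.compl_sets[OF that] by simp
    ultimately show "UNIV - a \<in> \<A>" unfolding \<A>_def by blast
  qed (auto simp: \<A>_def)
  have gen: "A \<in> sigma_sets UNIV \<A>"
  proof -
    have "prod_algebra UNIV (\<lambda>_::nat. borel :: 'a measure) \<subseteq> \<A>"
    proof
      fix X assume X: "X \<in> prod_algebra UNIV (\<lambda>_::nat. borel :: 'a measure)"
      obtain J E where XJ: "X = prod_emb UNIV (\<lambda>_. borel) J (Pi\<^sub>E J E)" "finite J" "\<And>j. j \<in> J \<Longrightarrow> E j \<in> sets borel"
        by (rule prod_algebraE[OF X]) simp
      obtain n B where B: "\<And>i. B i \<in> sets borel" "X = {\<omega>. \<forall>i<n. \<omega> i \<in> B i}"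
        by (rule prod_emb_cylinder[where k=0, OF XJ(2,3)], assumption) (auto simp: XJ(1))
      have "X \<in> sets path_space" unfolding B(2) by (rule cylinder_in_path_space[OF B(1)])
      moreover have "\<omega> \<in> X \<longleftrightarrow> \<omega>' \<in> X" if "\<forall>i<n. \<omega> i = \<omega>' i" for \<omega> \<omega>'
        using that unfolding B(2) by simp
      ultimately show "X \<in> \<A>" unfolding \<A>_def by blast
    qed
    then have "sigma_sets UNIV (prod_algebra UNIV (\<lambda>_::nat. borel :: 'a measure)) \<subseteq> sigma_sets UNIV \<A>"
      by (rule sigma_sets_mono')
    moreover have "sets path_space = sigma_sets UNIV (prod_algebra UNIV (\<lambda>_::nat. borel :: 'a measure))"
      by (simp add: sets_PiM PiE_UNIV_domain)
    ultimately show ?thesis using A by blast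
  qed
  have um: "?u n C \<in> borel_measurable ?M" if "C \<in> sets path_space" for n C
    using splice_measure_measurable[OF that, of "\<lambda>\<omega>. \<omega> n" n] by (simp add: measurable_cong_sets[OF sM refl])
  have int_u: "integrable ?M (?u n C)" if "C \<in> sets path_space" for n C
    by (rule M.integrable_AE_bounded[where C=1, OF um[OF that]]) (simp add: prob_space.prob_le_1[OF prob_space_path_from])
  have int_i: "integrable ?M (indicator C :: _ \<Rightarrow> real)" if "C \<in> sets path_space" for C
    using that sM by (simp add: M.emeasure_eq_measure)
  show ?thesis
  proof (rule LIMSEQ_I)
    fix r :: real assume r: "0 < r"
    have "\<exists>B\<in>\<A>. measure ?M ((A - B) \<union> (B - A)) < r / 2 \<and> measure ?M ((A - B) \<union> (B - A)) < r / 2"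
      by (rule algebra_approximation[OF alg gen M.finite_measure_axioms spM _ M.finite_measure_axioms spM])
        (use r sM in \<open>auto simp: \<A>_def\<close>)
    then obtain B k where B: "B \<in> sets path_space" "\<And>\<omega> \<omega>'. (\<forall>i<k. \<omega> i = \<omega>' i) \<Longrightarrow> \<omega> \<in> B \<longleftrightarrow> \<omega>' \<in> B"
      and AB: "measure ?M ((A - B) \<union> (B - A)) < r / 2"
      unfolding \<A>_def by blast
    let ?S = "(A - B) \<union> (B - A)"
    have S: "?S \<in> sets path_space" using A B(1) by auto
    have "norm ((\<integral>\<omega>. \<bar>?u n A \<omega> - indicator A \<omega>\<bar> \<partial>?M) - 0) < r" if n: "k \<le> n" for n
    proof -
      have "\<bar>?u n A \<omega> - indicator A \<omega>\<bar> \<le> ?u n ?S \<omega> + indicator ?S \<omega>" for \<omega>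
      proof -
        interpret K: prob_space "path_from (\<omega> n)" by (rule prob_space_path_from)
        have "splice_path n \<omega> \<omega>' \<in> B \<longleftrightarrow> \<omega> \<in> B" for \<omega>'
          by (rule B(2)) (use n in \<open>simp add: splice_path_def\<close>)
        then have "splice_path n \<omega> -` B = (if \<omega> \<in> B then UNIV else {})" by auto
        then have uB: "measure (path_from (\<omega> n)) (splice_path n \<omega> -` B) = indicator B \<omega>"
          using K.prob_space by simp
        have "\<bar>?u n A \<omega> - ?u n B \<omega>\<bar> \<le> measure (path_from (\<omega> n))
            ((splice_path n \<omega> -` A - splice_path n \<omega> -` B) \<union> (splice_path n \<omega> -` B - splice_path n \<omega> -` A))"
          by (rule K.abs_measure_diff_le) (use A B(1) in auto)
        also have "\<dots> = ?u n ?S \<omega>" by (simp add: vimage_Diff)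
        finally have "\<bar>?u n A \<omega> - indicator B \<omega>\<bar> \<le> ?u n ?S \<omega>" unfolding uB .
        moreover have "\<bar>indicator B \<omega> - indicator A \<omega>\<bar> = (indicator ?S \<omega> :: real)"
          by (auto simp: indicator_def)
        ultimately show ?thesis by linarith
      qed
      then have "(\<integral>\<omega>. \<bar>?u n A \<omega> - indicator A \<omega>\<bar> \<partial>?M) \<le> (\<integral>\<omega>. ?u n ?S \<omega> + indicator ?S \<omega> \<partial>?M)"
        using int_u[OF A] int_i[OF A] int_u[OF S] int_i[OF S]
        by (intro integral_mono Bochner_Integration.integrable_abs Bochner_Integration.integrable_diff Bochner_Integration.integrable_add) auto
      also have "\<dots> = measure ?M ?S + measure ?M ?S"
        using int_u[OF S] int_i[OF S] integral_splice_measure[OF nu S] S sM spM by simp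
      finally have "(\<integral>\<omega>. \<bar>?u n A \<omega> - indicator A \<omega>\<bar> \<partial>?M) < r" using AB by linarith
      moreover have "0 \<le> (\<integral>\<omega>. \<bar>?u n A \<omega> - indicator A \<omega>\<bar> \<partial>?M)" by simp
      ultimately show ?thesis by simp
    qed
    then show "\<exists>k. \<forall>n\<ge>k. norm ((\<integral>\<omega>. \<bar>?u n A \<omega> - indicator A \<omega>\<bar> \<partial>?M) - 0) < r" by blast
  qed
qed

end

section \<open>Fields generated by a path\<close>

text \<open>
  The field generated by \<open>\<psi> (\<omega> k)\<close> for \<open>k \<in> K\<close>. Both \<open>field_Y\<close> and \<open>field_XY\<close> are of this form.
\<close>

definition field_of :: "('s \<Rightarrow> 'c) \<Rightarrow> 'c measure \<Rightarrow> nat set \<Rightarrow> (nat \<Rightarrow> 's) measure" where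
  "field_of \<psi> N K = sigma UNIV (\<Union>k\<in>K. sets (vimage_algebra UNIV (\<lambda>\<omega>. \<psi> (\<omega> k)) N))"

lemma field_Y_eq: "field_Y K = field_of snd borel K"
  by (simp add: field_Y_def field_of_def)

lemma field_XY_eq:
  "field_XY T emb J K = field_of (\<lambda>z. (restrict (emb (fst z)) J, snd z)) ((\<Pi>\<^sub>M i\<in>J. borel_of (T i)) \<Otimes>\<^sub>M borel) K"
  by (simp add: field_XY_def field_of_def)

lemma space_field_of [simp]: "space (field_of \<psi> N K) = UNIV"
  by (simp add: field_of_def)

lemma sets_field_of: "sets (field_of \<psi> N K) = sigma_sets UNIV (\<Union>k\<in>K. sets (vimage_algebra UNIV (\<lambda>\<omega>. \<psi> (\<omega> k)) N))"
  by (simp add: field_of_def)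

lemma measurable_field_of:
  assumes \<psi>: "range \<psi> \<subseteq> space N"
    and f: "\<And>k. k \<in> K \<Longrightarrow> (\<lambda>\<omega>. \<psi> (f \<omega> k)) \<in> M \<rightarrow>\<^sub>M N"
  shows "f \<in> M \<rightarrow>\<^sub>M field_of \<psi> N K"
  unfolding field_of_def
proof (rule measurable_measure_of)
  fix A assume "A \<in> (\<Union>k\<in>K. sets (vimage_algebra UNIV (\<lambda>\<omega>. \<psi> (\<omega> k)) N))"
  then obtain k B where k: "k \<in> K" and B: "B \<in> sets N" and A: "A = (\<lambda>\<omega>. \<psi> (\<omega> k)) -` B \<inter> UNIV"
    using \<psi> by (auto simp: sets_vimage_algebra2 image_subset_iff)
  have "f -` A \<inter> space M = (\<lambda>\<omega>. \<psi> (f \<omega> k)) -` B \<inter> space M" unfolding A by auto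
  then show "f -` A \<inter> space M \<in> sets M" using measurable_sets[OF f[OF k] B] by simp
qed auto

lemma field_of_component:
  assumes \<psi>: "range \<psi> \<subseteq> space N" and k: "k \<in> K"
  shows "(\<lambda>\<omega>. \<psi> (\<omega> k)) \<in> field_of \<psi> N K \<rightarrow>\<^sub>M N"
proof (rule measurableI)
  show "\<psi> (\<omega> k) \<in> space N" for \<omega> using \<psi> by auto
  fix B assume "B \<in> sets N"
  then have "(\<lambda>\<omega>. \<psi> (\<omega> k)) -` B \<inter> UNIV \<in> sets (vimage_algebra UNIV (\<lambda>\<omega>. \<psi> (\<omega> k)) N)"
    by (rule in_vimage_algebra)
  then show "(\<lambda>\<omega>. \<psi> (\<omega> k)) -` B \<inter> space (field_of \<psi> N K) \<in> sets (field_of \<psi> N K)"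
    using k unfolding sets_field_of space_field_of by (intro sigma_sets.Basic) blast
qed

lemma field_of_mono: "K \<subseteq> K' \<Longrightarrow> sets (field_of \<psi> N K) \<subseteq> sets (field_of \<psi> N K')"
  unfolding sets_field_of by (intro sigma_sets_mono') auto

lemma field_of_sub_path_space:
  assumes \<psi>: "\<psi> \<in> borel \<rightarrow>\<^sub>M N"
  shows "sets (field_of \<psi> N K) \<subseteq> sets path_space"
proof -
  have "range \<psi> \<subseteq> space N" using measurable_space[OF \<psi>] by auto
  then have "(\<lambda>\<omega>. \<omega>) \<in> path_space \<rightarrow>\<^sub>M field_of \<psi> N K"
    by (rule measurable_field_of) (rule measurable_compose[OF _ \<psi>], simp)
  from measurable_sets[OF this] show ?thesis by auto
qed

lemma field_of_cong_mem:
  assumes \<psi>: "range \<psi> \<subseteq> space N" and A: "A \<in> sets (field_of \<psi> N K)" and eq: "\<And>k. k \<in> K \<Longrightarrow> \<psi> (\<omega> k) = \<psi> (\<omega>' k)"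
  shows "\<omega> \<in> A \<longleftrightarrow> \<omega>' \<in> A"
  using A unfolding sets_field_of
proof (induction rule: sigma_sets.induct)
  case (Basic a)
  then obtain k B where "k \<in> K" "a = (\<lambda>\<omega>. \<psi> (\<omega> k)) -` B \<inter> UNIV"
    using \<psi> by (auto simp: sets_vimage_algebra2 image_subset_iff)
  then show ?case using eq by simp
qed auto

lemma countably_generated_field_of:
  assumes "countably_generated N" "range \<psi> \<subseteq> space N"
  shows "countably_generated (field_of \<psi> N K)"
  unfolding field_of_def
  by (rule countably_generated_sigma_Un) (use assms in \<open>auto intro!: countably_generated_vimage_algebra\<close>)

definition join_field :: "'w measure \<Rightarrow> 'w measure \<Rightarrow> 'w measure" where
  "join_field A B = sigma UNIV (sets A \<union> sets B)"

lemma space_join_field [simp]: "space (join_field A B) = UNIV"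
  by (simp add: join_field_def)

lemma sets_join_field: "sets (join_field A B) = sigma_sets UNIV (sets A \<union> sets B)"
  by (simp add: join_field_def)

lemma join_field_upper: "sets A \<subseteq> sets (join_field A B)" "sets B \<subseteq> sets (join_field A B)"
  by (auto simp: sets_join_field)

lemma join_field_least:
  "space M = UNIV \<Longrightarrow> sets A \<subseteq> sets M \<Longrightarrow> sets B \<subseteq> sets M \<Longrightarrow> sets (join_field A B) \<subseteq> sets M"
  using sets.sigma_sets_subset[of "sets A \<union> sets B" M] by (simp add: sets_join_field)

lemma measurable_join_field:
  assumes "f \<in> M \<rightarrow>\<^sub>M A" "f \<in> M \<rightarrow>\<^sub>M B"
  shows "f \<in> M \<rightarrow>\<^sub>M join_field A B"
  unfolding join_field_def
  by (rule measurable_measure_of) (use measurable_sets[OF assms(1)] measurable_sets[OF assms(2)] in auto)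

lemma countably_generated_join_field:
  assumes "countably_generated A" "countably_generated B" "space A = UNIV" "space B = UNIV"
  shows "countably_generated (join_field A B)"
proof -
  have "countably_generated (sigma UNIV (\<Union>b\<in>UNIV. sets (if b then A else B)))"
    by (rule countably_generated_sigma_Un) (use assms in auto)
  then show ?thesis by (simp add: join_field_def UNIV_bool Un_commute)
qed

lemma join_field_cong_mem:
  assumes A: "A \<in> sets (join_field F G)"
    and "\<And>B. B \<in> sets F \<Longrightarrow> \<omega> \<in> B \<longleftrightarrow> \<omega>' \<in> B" "\<And>B. B \<in> sets G \<Longrightarrow> \<omega> \<in> B \<longleftrightarrow> \<omega>' \<in> B"
  shows "\<omega> \<in> A \<longleftrightarrow> \<omega>' \<in> A"
  using A unfolding sets_join_field
  by (induction rule: sigma_sets.induct) (use assms(2,3) in auto)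

lemma field_of_cong_fun:
  fixes f :: "(nat \<Rightarrow> 's) \<Rightarrow> ennreal"
  assumes \<psi>: "range \<psi> \<subseteq> space N" and f: "f \<in> borel_measurable (field_of \<psi> N K)"
    and eq: "\<And>k. k \<in> K \<Longrightarrow> \<psi> (\<omega> k) = \<psi> (\<omega>' k)"
  shows "f \<omega> = f \<omega>'"
proof -
  have "f -` {f \<omega>} \<inter> space (field_of \<psi> N K) \<in> sets (field_of \<psi> N K)"
    by (rule measurable_sets[OF f]) simp
  from field_of_cong_mem[OF \<psi> this, of \<omega> \<omega>'] eq show ?thesis by auto
qed

section \<open>Decoupling the signal from the observations\<close>

text \<open>
  The hypothesis \<open>q\<close> says that the events of \<open>\<S>\<close> have a common conditional probability given
  \<open>H\<close> under \<open>N1\<close> and \<open>N2\<close>. Then \<open>N1\<close> and \<open>N2\<close> differ on the joint field \<open>G\<close> only through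
  their restrictions to \<open>H\<close>: a density of one restriction with respect to the other is also a density
  on \<open>G\<close>. So the part of \<open>N2\<close> on \<open>G\<close> that is singular with respect to \<open>N1\<close> is carried by an
  event \<open>B\<close> of \<open>H\<close>.
\<close>

lemma common_conditional_null_transfer:
  assumes N1: "prob_space N1" and N2: "prob_space N2" and s: "sets N1 = sets N2"
    and H: "subalgebra N1 H" and G: "subalgebra N1 G"
    and \<S>: "sets G = sigma_sets (space N1) {S \<inter> C |S C. S \<in> \<S> \<and> C \<in> sets H}"
      "space N1 \<in> \<S>" "\<And>S S'. S \<in> \<S> \<Longrightarrow> S' \<in> \<S> \<Longrightarrow> S \<inter> S' \<in> \<S>" "\<S> \<subseteq> sets N1"
    and q: "\<And>S. S \<in> \<S> \<Longrightarrow> \<exists>q\<in>borel_measurable H. \<forall>f\<in>borel_measurable H.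
        (\<integral>\<^sup>+\<omega>. indicator S \<omega> * f \<omega> \<partial>N1) = (\<integral>\<^sup>+\<omega>. q \<omega> * f \<omega> \<partial>N1) \<and>
        (\<integral>\<^sup>+\<omega>. indicator S \<omega> * f \<omega> \<partial>N2) = (\<integral>\<^sup>+\<omega>. q \<omega> * (f \<omega> :: ennreal) \<partial>N2)"
  shows "\<exists>B\<in>sets H. emeasure N1 B = 0 \<and> (\<forall>A\<in>sets G. emeasure N1 A = 0 \<longrightarrow> emeasure N2 (A - B) = 0)"
proof -
  interpret N1: prob_space N1 by fact
  interpret N2: prob_space N2 by fact
  have sp: "space N2 = space N1" using sets_eq_imp_space_eq[OF s] by simp
  have H2: "subalgebra N2 H" using H s sp by (simp add: subalgebra_def)
  have spH: "space H = space N1" and spG: "space G = space N1" using H G by (simp_all add: subalgebra_def)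
  have HN: "sets H \<subseteq> sets N1" "sets G \<subseteq> sets N1" using H G by (auto simp: subalgebra_def)
  let ?R1 = "restr_to_subalg N1 H" and ?R2 = "restr_to_subalg N2 H"
  have sR: "sets ?R1 = sets H" "sets ?R2 = sets H" using sets_restr_to_subalg[OF H] sets_restr_to_subalg[OF H2] by auto
  have sR12: "sets ?R1 = sets ?R2" using sR by simp
  obtain M D where M: "prob_space M" and sM: "sets M = sets ?R1" and D: "D \<in> borel_measurable M"
    and D0: "\<And>\<omega>. 0 \<le> D \<omega>" and D2: "\<And>\<omega>. D \<omega> \<le> (2::real)"
    and R1: "?R1 = density M (\<lambda>\<omega>. ennreal (D \<omega>))" and R2: "?R2 = density M (\<lambda>\<omega>. ennreal (2 - D \<omega>))"
    by (rule half_mixture[OF prob_space_restr_to_subalg[OF H N1] prob_space_restr_to_subalg[OF H2 N2] sR12]) blast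
  have sMH: "sets M = sets H" using sM sR by simp
  have DM [measurable]: "D \<in> borel_measurable M" by fact
  have DH [measurable]: "D \<in> borel_measurable H" using D by (simp add: measurable_cong_sets[OF sMH refl])
  have HtoM: "f \<in> borel_measurable M" if "f \<in> borel_measurable H" for f :: "'a \<Rightarrow> ennreal"
    using that by (simp add: measurable_cong_sets[OF sMH refl])
  have int1: "(\<integral>\<^sup>+\<omega>. f \<omega> \<partial>N1) = (\<integral>\<^sup>+\<omega>. ennreal (D \<omega>) * f \<omega> \<partial>M)"
    and int2: "(\<integral>\<^sup>+\<omega>. f \<omega> \<partial>N2) = (\<integral>\<^sup>+\<omega>. ennreal (2 - D \<omega>) * f \<omega> \<partial>M)"
    if f: "f \<in> borel_measurable H" for f :: "'a \<Rightarrow> ennreal"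
  proof -
    note [measurable] = HtoM[OF f]
    have "(\<integral>\<^sup>+\<omega>. f \<omega> \<partial>N1) = (\<integral>\<^sup>+\<omega>. f \<omega> \<partial>?R1)" "(\<integral>\<^sup>+\<omega>. f \<omega> \<partial>N2) = (\<integral>\<^sup>+\<omega>. f \<omega> \<partial>?R2)"
      by (rule nn_integral_subalgebra2[symmetric]; fact H H2 f)+
    then show "(\<integral>\<^sup>+\<omega>. f \<omega> \<partial>N1) = (\<integral>\<^sup>+\<omega>. ennreal (D \<omega>) * f \<omega> \<partial>M)"
      "(\<integral>\<^sup>+\<omega>. f \<omega> \<partial>N2) = (\<integral>\<^sup>+\<omega>. ennreal (2 - D \<omega>) * f \<omega> \<partial>M)"
      unfolding R1 R2 by (simp_all add: nn_integral_density)
  qed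
  \<comment> \<open>On \<open>B\<close> the law \<open>N1\<close> has no mass; elsewhere \<open>h\<close> is the density of \<open>N2\<close> with respect to \<open>N1\<close> on \<open>H\<close>.\<close>
  define B where "B = {\<omega> \<in> space H. D \<omega> = 0}"
  have B: "B \<in> sets H" unfolding B_def by measurable
  define h where "h \<omega> = (if D \<omega> = 0 then 0 else ennreal ((2 - D \<omega>) / D \<omega>))" for \<omega>
  have h: "h \<in> borel_measurable H" unfolding h_def by measurable
  have hN: "h \<in> borel_measurable N1" by (rule measurable_from_subalg[OF H h])
  have change: "(\<integral>\<^sup>+\<omega>. indicator (space N1 - B) \<omega> * f \<omega> \<partial>N2) = (\<integral>\<^sup>+\<omega>. h \<omega> * f \<omega> \<partial>N1)"
    if f: "f \<in> borel_measurable H" for f :: "'a \<Rightarrow> ennreal"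
  proof -
    have m1: "(\<lambda>\<omega>. indicator (space N1 - B) \<omega> * f \<omega>) \<in> borel_measurable H"
      using B f spH by (intro borel_measurable_times_ennreal borel_measurable_indicator) (auto simp: spH[symmetric])
    have m2: "(\<lambda>\<omega>. h \<omega> * f \<omega>) \<in> borel_measurable H" using h f by measurable
    have spM: "space M = space N1" using sets_eq_imp_space_eq[OF sMH] spH by simp
    show ?thesis unfolding int2[OF m1] int1[OF m2]
    proof (rule nn_integral_cong)
      fix \<omega> assume "\<omega> \<in> space M"
      then have w: "\<omega> \<in> space N1" using spM by simp
      show "ennreal (2 - D \<omega>) * (indicator (space N1 - B) \<omega> * f \<omega>) = ennreal (D \<omega>) * (h \<omega> * f \<omega>)"
      proof (cases "D \<omega> = 0")
        case True
        then show ?thesis using w by (simp add: h_def B_def spH)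
      next
        case False
        then have "ennreal (D \<omega>) * ennreal ((2 - D \<omega>) / D \<omega>) = ennreal (2 - D \<omega>)"
          using D0[of \<omega>] D2[of \<omega>] by (simp add: ennreal_mult[symmetric])
        then show ?thesis using False w by (simp add: h_def B_def spH mult.assoc[symmetric])
      qed
    qed
  qed
  let ?I = "\<lambda>\<omega>. indicator (space N1 - B) \<omega> :: ennreal"
  have I_meas: "?I \<in> borel_measurable N2" using B HN s sp by (intro borel_measurable_indicator) auto
  let ?L1 = "restr_to_subalg (density N2 ?I) G" and ?L2 = "restr_to_subalg (density N1 h) G"
  have G1: "subalgebra (density N2 ?I) G" and G2: "subalgebra (density N1 h) G"
    using G s sp by (simp_all add: subalgebra_def)
  have L1: "emeasure ?L1 A = (\<integral>\<^sup>+\<omega>. ?I \<omega> * indicator A \<omega> \<partial>N2)" if "A \<in> sets G" for A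
    using that HN s I_meas by (auto simp: emeasure_restr_to_subalg[OF G1] emeasure_density)
  have L2: "emeasure ?L2 A = (\<integral>\<^sup>+\<omega>. h \<omega> * indicator A \<omega> \<partial>N1)" if "A \<in> sets G" for A
    using that HN hN by (auto simp: emeasure_restr_to_subalg[OF G2] emeasure_density)
  let ?E = "{S \<inter> C |S C. S \<in> \<S> \<and> C \<in> sets H}"
  have E_G: "?E \<subseteq> sets G" unfolding \<S>(1) by (auto intro: sigma_sets.Basic)
  have "?L1 = ?L2"
  proof (rule measure_eqI_generator_eq[where \<Omega>="space N1" and E="?E" and A="\<lambda>_. space N1"])
    show "Int_stable ?E"
    proof (rule Int_stableI)
      fix a b assume "a \<in> ?E" "b \<in> ?E"
      then obtain S C S' C' where "a = S \<inter> C" "b = S' \<inter> C'" "S \<in> \<S>" "S' \<in> \<S>" "C \<in> sets H" "C' \<in> sets H" by blast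
      then have "a \<inter> b = (S \<inter> S') \<inter> (C \<inter> C')" "S \<inter> S' \<in> \<S>" "C \<inter> C' \<in> sets H" using \<S>(3) by auto
      then show "a \<inter> b \<in> ?E" by blast
    qed
    show "?E \<subseteq> Pow (space N1)" using E_G HN sets.sets_into_space by blast
    show "sets ?L1 = sigma_sets (space N1) ?E" "sets ?L2 = sigma_sets (space N1) ?E"
      using sets_restr_to_subalg[OF G1] sets_restr_to_subalg[OF G2] \<S>(1) by auto
    have top: "space N1 = space N1 \<inter> space N1" "space N1 \<in> sets H" using spH sets.top[of H] by auto
    then show "range (\<lambda>_. space N1) \<subseteq> ?E" using \<S>(2) by blast
    have "emeasure ?L1 (space N1) = (\<integral>\<^sup>+\<omega>. ?I \<omega> * indicator (space N1) \<omega> \<partial>N2)"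
      by (rule L1) (metis sets.top spG)
    also have "\<dots> \<le> (\<integral>\<^sup>+\<omega>. 1 \<partial>N2)"
      by (rule nn_integral_mono) (simp add: indicator_def)
    finally show "emeasure ?L1 (space N1) \<noteq> \<infinity>" by (auto simp: N2.emeasure_space_1 top_unique)
    fix X assume "X \<in> ?E"
    then obtain S C where X: "X = S \<inter> C" and S: "S \<in> \<S>" and C: "C \<in> sets H" by blast
    obtain q where qH: "q \<in> borel_measurable H" and
      q1: "\<And>f. f \<in> borel_measurable H \<Longrightarrow> (\<integral>\<^sup>+\<omega>. indicator S \<omega> * f \<omega> \<partial>N1) = (\<integral>\<^sup>+\<omega>. q \<omega> * f \<omega> \<partial>N1)" and
      q2: "\<And>f. f \<in> borel_measurable H \<Longrightarrow> (\<integral>\<^sup>+\<omega>. indicator S \<omega> * f \<omega> \<partial>N2) = (\<integral>\<^sup>+\<omega>. q \<omega> * f \<omega> \<partial>N2)"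
      using q[OF S] by blast
    have XG: "X \<in> sets G" using E_G X S C by blast
    have m1: "(\<lambda>\<omega>. ?I \<omega> * indicator C \<omega>) \<in> borel_measurable H"
      using B C spH by (intro borel_measurable_times_ennreal borel_measurable_indicator) (auto simp: spH[symmetric])
    have m2: "(\<lambda>\<omega>. h \<omega> * indicator C \<omega>) \<in> borel_measurable H"
      using h C by (intro borel_measurable_times_ennreal borel_measurable_indicator)
    have m3: "(\<lambda>\<omega>. q \<omega> * indicator C \<omega>) \<in> borel_measurable H"
      using qH C by (intro borel_measurable_times_ennreal borel_measurable_indicator)
    have "emeasure ?L1 X = (\<integral>\<^sup>+\<omega>. indicator S \<omega> * (?I \<omega> * indicator C \<omega>) \<partial>N2)"
      unfolding L1[OF XG] by (rule nn_integral_cong) (simp add: X indicator_def)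
    also have "\<dots> = (\<integral>\<^sup>+\<omega>. ?I \<omega> * (q \<omega> * indicator C \<omega>) \<partial>N2)"
      unfolding q2[OF m1] by (rule nn_integral_cong) (simp add: mult_ac)
    also have "\<dots> = (\<integral>\<^sup>+\<omega>. q \<omega> * (h \<omega> * indicator C \<omega>) \<partial>N1)"
      unfolding change[OF m3] by (rule nn_integral_cong) (simp add: mult_ac)
    also have "\<dots> = (\<integral>\<^sup>+\<omega>. indicator S \<omega> * (h \<omega> * indicator C \<omega>) \<partial>N1)"
      by (rule q1[OF m2, symmetric])
    also have "\<dots> = emeasure ?L2 X"
      unfolding L2[OF XG] by (rule nn_integral_cong) (simp add: X indicator_def)
    finally show "emeasure ?L1 X = emeasure ?L2 X" .
  qed simp
  then have key: "(\<integral>\<^sup>+\<omega>. ?I \<omega> * indicator A \<omega> \<partial>N2) = (\<integral>\<^sup>+\<omega>. h \<omega> * indicator A \<omega> \<partial>N1)" if "A \<in> sets G" for A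
    using L1[OF that] L2[OF that] by simp
  show ?thesis
  proof (intro bexI[OF _ B] conjI ballI impI)
    have "emeasure N1 B = (\<integral>\<^sup>+\<omega>. indicator B \<omega> \<partial>N1)" using B HN by auto
    also have "\<dots> = (\<integral>\<^sup>+\<omega>. ennreal (D \<omega>) * indicator B \<omega> \<partial>M)"
      by (rule int1) (use B in simp)
    also have "\<dots> = (\<integral>\<^sup>+\<omega>. 0 \<partial>M)" by (rule nn_integral_cong) (auto simp: B_def indicator_def)
    finally show "emeasure N1 B = 0" by simp
  next
    fix A assume A: "A \<in> sets G" "emeasure N1 A = 0"
    have AN: "A \<in> sets N1" using A HN by auto
    have "emeasure N2 (A - B) = (\<integral>\<^sup>+\<omega>. indicator (A - B) \<omega> \<partial>N2)"
      using AN B HN s by (intro nn_integral_indicator[symmetric]) auto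
    also have "\<dots> = (\<integral>\<^sup>+\<omega>. ?I \<omega> * indicator A \<omega> \<partial>N2)"
      by (rule nn_integral_cong) (auto simp: indicator_def sp)
    also have "\<dots> = (\<integral>\<^sup>+\<omega>. h \<omega> * indicator A \<omega> \<partial>N1)" by (rule key[OF A(1)])
    also have "\<dots> = 0"
    proof -
      have "A \<in> null_sets N1" using AN A(2) by (simp add: null_sets_def)
      then have "AE \<omega> in N1. \<omega> \<notin> A" by (rule AE_not_in)
      then have "AE \<omega> in N1. h \<omega> * indicator A \<omega> = 0" by eventually_elim simp
      then have "(\<integral>\<^sup>+\<omega>. h \<omega> * indicator A \<omega> \<partial>N1) = (\<integral>\<^sup>+\<omega>. 0 \<partial>N1)" by (rule nn_integral_cong_AE)
      then show ?thesis by simp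
    qed
    finally show "emeasure N2 (A - B) = 0" .
  qed
qed

locale nondegenerate_kernel =
  fixes P :: "'e::polish_space \<times> 'f::polish_space \<Rightarrow> ('e \<times> 'f) measure"
    and P0 :: "'e \<Rightarrow> 'e measure" and Q :: "'f \<Rightarrow> 'f measure"
    and g :: "('e \<times> 'f) \<times> ('e \<times> 'f) \<Rightarrow> real"
  assumes P_kernel: "P \<in> borel \<rightarrow>\<^sub>M prob_algebra borel"
    and P0_kernel: "P0 \<in> borel \<rightarrow>\<^sub>M prob_algebra borel"
    and Q_kernel: "Q \<in> borel \<rightarrow>\<^sub>M prob_algebra borel"
    and g_measurable [measurable]: "g \<in> borel_measurable borel"
    and g_pos: "\<And>z z'. 0 < g (z, z')"
    and P_density: "\<And>x y. P (x, y) = density (P0 x \<Otimes>\<^sub>M Q y) (\<lambda>z'. ennreal (g ((x, y), z')))"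

begin

sublocale P: markov_kernel P by unfold_locales (rule P_kernel)

sublocale X: markov_kernel P0 by unfold_locales (rule P0_kernel)

sublocale Y: markov_kernel Q by unfold_locales (rule Q_kernel)

abbreviation zip_path :: "(nat \<Rightarrow> 'e) \<Rightarrow> (nat \<Rightarrow> 'f) \<Rightarrow> nat \<Rightarrow> 'e \<times> 'f" where
  "zip_path \<xi> \<eta> k \<equiv> (\<xi> k, \<eta> k)"

definition decoupled_kernel :: "nat \<Rightarrow> (nat \<Rightarrow> 'e) \<times> (nat \<Rightarrow> 'f) \<Rightarrow> (nat \<Rightarrow> 'e \<times> 'f) measure" where
  "decoupled_kernel m = (\<lambda>(\<xi>, \<eta>). distr (P.path_from (\<xi> m, \<eta> m)) path_space (splice_path m (zip_path \<xi> \<eta>)))"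

text \<open>
  The law of a chain whose two components are independent up to time \<open>m\<close>, with kernels \<open>P0\<close> and
  \<open>Q\<close>, and which follows the kernel \<open>P\<close> afterwards.
\<close>

definition decoupled :: "nat \<Rightarrow> 'e \<Rightarrow> 'f \<Rightarrow> (nat \<Rightarrow> 'e \<times> 'f) measure" where
  "decoupled m x y = (X.path_from x \<Otimes>\<^sub>M Y.path_from y) \<bind> decoupled_kernel m"

lemma zip_path_measurable [measurable]:
  "(\<lambda>(\<xi>, \<eta>). zip_path \<xi> \<eta>) \<in> path_space \<Otimes>\<^sub>M path_space \<rightarrow>\<^sub>M path_space"
  by (rule measurable_PiM_single') (auto simp: split_beta PiE_UNIV_domain intro!: borel_measurable_Pair)

lemma decoupled_kernel_measurable:
  "decoupled_kernel m \<in> path_space \<Otimes>\<^sub>M path_space \<rightarrow>\<^sub>M prob_algebra path_space"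
proof -
  have 1: "(\<lambda>p. P.path_from (fst p m, snd p m)) \<in> path_space \<Otimes>\<^sub>M path_space \<rightarrow>\<^sub>M prob_algebra path_space"
    by (rule measurable_compose[OF _ P.path_from_kernel]) (intro borel_measurable_Pair; measurable)
  have z: "(\<lambda>q. zip_path (fst (fst q)) (snd (fst q))) \<in> (path_space \<Otimes>\<^sub>M path_space) \<Otimes>\<^sub>M path_space \<rightarrow>\<^sub>M path_space"
    using measurable_compose[OF measurable_fst zip_path_measurable] by (simp add: case_prod_unfold)
  have "(\<lambda>q. splice_path m (zip_path (fst (fst q)) (snd (fst q))) (snd q))
      \<in> (path_space \<Otimes>\<^sub>M path_space) \<Otimes>\<^sub>M path_space \<rightarrow>\<^sub>M path_space"
    using measurable_compose[OF measurable_Pair[OF z measurable_snd] splice_measurable] by simp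
  then have 2: "(\<lambda>(p, \<omega>). splice_path m (zip_path (fst p) (snd p)) \<omega>)
      \<in> (path_space \<Otimes>\<^sub>M path_space) \<Otimes>\<^sub>M path_space \<rightarrow>\<^sub>M path_space"
    by (simp add: case_prod_unfold)
  show ?thesis
    using measurable_distr_prob_space2[OF 1 2] by (simp add: decoupled_kernel_def case_prod_unfold)
qed

lemma pair_in_prob_algebra: "X.path_from x \<Otimes>\<^sub>M Y.path_from y \<in> space (prob_algebra (path_space \<Otimes>\<^sub>M path_space))"
proof -
  interpret pair_prob_space "X.path_from x" "Y.path_from y"
    unfolding pair_prob_space_def pair_sigma_finite_def
    using X.prob_space_path_from Y.prob_space_path_from by (simp add: prob_space_imp_sigma_finite)
  show ?thesis by (simp add: space_prob_algebra prob_space_axioms cong: sets_pair_measure_cong)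
qed

lemma sets_decoupled: "sets (decoupled m x y) = sets path_space"
  unfolding decoupled_def by (rule sets_bind'[OF pair_in_prob_algebra decoupled_kernel_measurable])

lemma prob_space_decoupled: "prob_space (decoupled m x y)"
  unfolding decoupled_def by (rule prob_space_bind'[OF pair_in_prob_algebra decoupled_kernel_measurable])

lemma nn_integral_decoupled:
  assumes f: "f \<in> borel_measurable path_space"
  shows "(\<integral>\<^sup>+\<omega>. f \<omega> \<partial>decoupled m x y) =
    (\<integral>\<^sup>+\<xi>. \<integral>\<^sup>+\<eta>. \<integral>\<^sup>+\<omega>. f (splice_path m (zip_path \<xi> \<eta>) \<omega>) \<partial>P.path_from (\<xi> m, \<eta> m) \<partial>Y.path_from y \<partial>X.path_from x)"
proof -
  interpret Y: prob_space "Y.path_from y" by (rule Y.prob_space_path_from)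
  have s: "sets (X.path_from x \<Otimes>\<^sub>M Y.path_from y) = sets (path_space \<Otimes>\<^sub>M path_space)"
    by (rule sets_pair_measure_cong) simp_all
  have k: "decoupled_kernel m \<in> X.path_from x \<Otimes>\<^sub>M Y.path_from y \<rightarrow>\<^sub>M subprob_algebra path_space"
    using measurable_prob_algebraD[OF decoupled_kernel_measurable] by (simp add: measurable_cong_sets[OF s refl])
  have "(\<integral>\<^sup>+\<omega>. f \<omega> \<partial>decoupled m x y) = (\<integral>\<^sup>+p. \<integral>\<^sup>+\<omega>. f \<omega> \<partial>decoupled_kernel m p \<partial>(X.path_from x \<Otimes>\<^sub>M Y.path_from y))"
    unfolding decoupled_def by (rule nn_integral_bind[OF f k])
  also have "\<dots> = (\<integral>\<^sup>+\<xi>. \<integral>\<^sup>+\<eta>. \<integral>\<^sup>+\<omega>. f \<omega> \<partial>decoupled_kernel m (\<xi>, \<eta>) \<partial>Y.path_from y \<partial>X.path_from x)"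
    by (rule Y.nn_integral_fst[symmetric])
      (rule measurable_compose[OF k nn_integral_measurable_subprob_algebra[OF f]])
  finally show ?thesis using f by (simp add: decoupled_kernel_def nn_integral_distr)
qed

lemma emeasure_decoupled:
  assumes A: "A \<in> sets path_space"
  shows "emeasure (decoupled m x y) A =
    (\<integral>\<^sup>+\<xi>. \<integral>\<^sup>+\<eta>. emeasure (P.path_from (\<xi> m, \<eta> m)) (splice_path m (zip_path \<xi> \<eta>) -` A) \<partial>Y.path_from y \<partial>X.path_from x)"
proof -
  have "emeasure (decoupled m x y) A = (\<integral>\<^sup>+\<omega>. indicator A \<omega> \<partial>decoupled m x y)"
    using A by (simp add: sets_decoupled)
  also have "\<dots> = (\<integral>\<^sup>+\<xi>. \<integral>\<^sup>+\<eta>. \<integral>\<^sup>+\<omega>. indicator (splice_path m (zip_path \<xi> \<eta>) -` A) \<omega> \<partial>P.path_from (\<xi> m, \<eta> m) \<partial>Y.path_from y \<partial>X.path_from x)"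
    unfolding nn_integral_decoupled[OF borel_measurable_indicator[OF A]]
    by (intro nn_integral_cong) (simp split: split_indicator)
  finally show ?thesis using A by simp
qed

lemma emeasure_decoupled_measurable:
  assumes A: "A \<in> sets path_space"
  shows "(\<lambda>(\<xi>, \<eta>). emeasure (P.path_from (\<xi> m, \<eta> m)) (splice_path m (zip_path \<xi> \<eta>) -` A))
    \<in> borel_measurable (path_space \<Otimes>\<^sub>M path_space)"
proof -
  have "(\<lambda>p. emeasure (decoupled_kernel m p) A) \<in> borel_measurable (path_space \<Otimes>\<^sub>M path_space)"
    using measurable_compose[OF measurable_prob_algebraD[OF decoupled_kernel_measurable] measurable_emeasure_subprob_algebra[OF A]] .
  moreover have "(\<lambda>p. emeasure (decoupled_kernel m p) A)
      = (\<lambda>(\<xi>, \<eta>). emeasure (P.path_from (\<xi> m, \<eta> m)) (splice_path m (zip_path \<xi> \<eta>) -` A))"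
    using A by (auto simp: decoupled_kernel_def fun_eq_iff emeasure_distr)
  ultimately show ?thesis by simp
qed

lemma splice_path_0: "splice_path 0 \<omega> = (\<lambda>\<omega>'. \<omega>')"
  by (simp add: fun_eq_iff splice_path_def)

lemma splice_Suc_case_nat:
  "splice_path (Suc m) (zip_path (case_nat x \<xi>) (case_nat y \<eta>)) \<omega> = case_nat (x, y) (splice_path m (zip_path \<xi> \<eta>) \<omega>)"
  by (auto simp: fun_eq_iff splice_path_def split: nat.split)

text \<open>
  The first step can be split off because the two components start independently; exchanging the first
  step of the observations with the later signal is Fubini's theorem.
\<close>

lemma decoupled_Suc:
  assumes A: "A \<in> sets path_space"
  shows "emeasure (decoupled (Suc m) x y) A
    = (\<integral>\<^sup>+x1. \<integral>\<^sup>+y1. emeasure (decoupled m x1 y1) (case_nat (x, y) -` A) \<partial>Q y \<partial>P0 x)"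
    and "(\<lambda>(x1, y1). emeasure (decoupled m x1 y1) (case_nat (x, y) -` A)) \<in> borel_measurable (borel \<Otimes>\<^sub>M borel)"
proof -
  let ?F = "\<lambda>m A \<xi> \<eta>. emeasure (P.path_from (\<xi> m, \<eta> m)) (splice_path m (zip_path \<xi> \<eta>) -` A)"
  let ?A = "case_nat (x, y) -` A"
  have A': "?A \<in> sets path_space" using A by simp
  note F_meas = emeasure_decoupled_measurable
  have shift: "?F (Suc m) A (case_nat x \<xi>) (case_nat y \<eta>) = ?F m ?A \<xi> \<eta>" for \<xi> \<eta>
    by (simp add: vimage_def splice_Suc_case_nat)
  have F1: "(\<lambda>\<eta>. ?F m A \<xi> \<eta>) \<in> borel_measurable path_space" if "A \<in> sets path_space" for m A \<xi>
    using measurable_compose[OF measurable_Pair1' F_meas[OF that]] by simp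
  have \<psi>: "(\<lambda>(\<xi>, y1). \<integral>\<^sup>+\<eta>. ?F m A \<xi> \<eta> \<partial>Y.path_from y1) \<in> borel_measurable (path_space \<Otimes>\<^sub>M borel)"
    if A: "A \<in> sets path_space" for m A
  proof -
    have "(\<lambda>q. (fst (fst q), snd q)) \<in> (path_space \<Otimes>\<^sub>M borel) \<Otimes>\<^sub>M path_space \<rightarrow>\<^sub>M path_space \<Otimes>\<^sub>M path_space"
      by measurable
    from measurable_compose[OF this F_meas[OF A, of m]]
    have "(\<lambda>(p, \<eta>). ?F m A (fst p) \<eta>) \<in> borel_measurable ((path_space \<Otimes>\<^sub>M borel) \<Otimes>\<^sub>M path_space)"
      by (simp add: case_prod_unfold)
    from nn_integral_measurable_subprob_algebra2[OF this, of "\<lambda>p. Y.path_from (snd p)"]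
    show ?thesis by (simp add: case_prod_unfold)
  qed
  have \<psi>1: "(\<lambda>\<xi>. \<integral>\<^sup>+\<eta>. ?F m A \<xi> \<eta> \<partial>Y.path_from y) \<in> borel_measurable path_space"
    if A: "A \<in> sets path_space" for m A y
    using measurable_compose[OF measurable_Pair2' \<psi>[OF A]] by simp
  have "emeasure (decoupled (Suc m) x y) A
      = (\<integral>\<^sup>+x1. \<integral>\<^sup>+\<xi>. \<integral>\<^sup>+\<eta>. ?F (Suc m) A (case_nat x \<xi>) \<eta> \<partial>Y.path_from y \<partial>X.path_from x1 \<partial>P0 x)"
    unfolding emeasure_decoupled[OF A] by (rule X.nn_integral_path_from_step[OF \<psi>1[OF A]])
  also have "\<dots> = (\<integral>\<^sup>+x1. \<integral>\<^sup>+\<xi>. \<integral>\<^sup>+y1. \<integral>\<^sup>+\<eta>. ?F m ?A \<xi> \<eta> \<partial>Y.path_from y1 \<partial>Q y \<partial>X.path_from x1 \<partial>P0 x)"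
    by (subst Y.nn_integral_path_from_step[OF F1[OF A]]) (simp only: shift)
  also have "\<dots> = (\<integral>\<^sup>+x1. \<integral>\<^sup>+y1. \<integral>\<^sup>+\<xi>. \<integral>\<^sup>+\<eta>. ?F m ?A \<xi> \<eta> \<partial>Y.path_from y1 \<partial>X.path_from x1 \<partial>Q y \<partial>P0 x)"
  proof (rule nn_integral_cong)
    fix x1
    interpret pair_sigma_finite "X.path_from x1" "Q y"
      using X.prob_space_path_from Y.prob_space_kernel
      by (simp add: pair_sigma_finite_def prob_space_imp_sigma_finite)
    have s: "sets (X.path_from x1 \<Otimes>\<^sub>M Q y) = sets (path_space \<Otimes>\<^sub>M borel)"
      by (rule sets_pair_measure_cong) simp_all
    show "(\<integral>\<^sup>+\<xi>. \<integral>\<^sup>+y1. \<integral>\<^sup>+\<eta>. ?F m ?A \<xi> \<eta> \<partial>Y.path_from y1 \<partial>Q y \<partial>X.path_from x1)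
        = (\<integral>\<^sup>+y1. \<integral>\<^sup>+\<xi>. \<integral>\<^sup>+\<eta>. ?F m ?A \<xi> \<eta> \<partial>Y.path_from y1 \<partial>X.path_from x1 \<partial>Q y)"
      by (rule Fubini'[symmetric]) (use \<psi>[OF A', of m] in \<open>simp add: measurable_cong_sets[OF s refl]\<close>)
  qed
  finally show "emeasure (decoupled (Suc m) x y) A
    = (\<integral>\<^sup>+x1. \<integral>\<^sup>+y1. emeasure (decoupled m x1 y1) (case_nat (x, y) -` A) \<partial>Q y \<partial>P0 x)"
    unfolding emeasure_decoupled[OF A'] .
  have "(\<lambda>q. (snd q, snd (fst q))) \<in> (borel \<Otimes>\<^sub>M borel) \<Otimes>\<^sub>M path_space \<rightarrow>\<^sub>M path_space \<Otimes>\<^sub>M borel"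
    by measurable
  from measurable_compose[OF this \<psi>[OF A', of m]]
  have "(\<lambda>(p, \<xi>). \<integral>\<^sup>+\<eta>. ?F m ?A \<xi> \<eta> \<partial>Y.path_from (snd p)) \<in> borel_measurable ((borel \<Otimes>\<^sub>M borel) \<Otimes>\<^sub>M path_space)"
    by (simp add: case_prod_unfold)
  from nn_integral_measurable_subprob_algebra2[OF this, of "\<lambda>p. X.path_from (fst p)"]
  show "(\<lambda>(x1, y1). emeasure (decoupled m x1 y1) (case_nat (x, y) -` A)) \<in> borel_measurable (borel \<Otimes>\<^sub>M borel)"
    unfolding emeasure_decoupled[OF A'] by (simp add: case_prod_unfold)
qed

text \<open>
  By induction on the number of decoupled steps. In each step the strictly positive density \<open>g\<close> can be
  removed without changing the null events, and no product of densities has to be formed.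
\<close>

lemma null_iff_decoupled_null:
  "A \<in> sets path_space \<Longrightarrow> emeasure (P.path_from (x, y)) A = 0 \<longleftrightarrow> emeasure (decoupled m x y) A = 0"
proof (induction m arbitrary: x y A)
  case 0
  have m1: "(\<lambda>x'. emeasure (P.path_from (x', y')) A) \<in> borel_measurable borel"
    and m2: "(\<lambda>y'. emeasure (P.path_from (x', y')) A) \<in> borel_measurable borel" for x' y'
    by (rule measurable_compose[OF measurable_compose[OF _ P.path_from_subprob] measurable_emeasure_subprob_algebra[OF 0]];
      intro borel_measurable_Pair; simp)+
  have "(\<integral>\<^sup>+\<eta>. emeasure (P.path_from (\<xi> 0, \<eta> 0)) A \<partial>Y.path_from y) = emeasure (P.path_from (\<xi> 0, y)) A" for \<xi> :: "nat \<Rightarrow> 'e"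
    by (rule Y.nn_integral_path_from_initial[OF m2])
  moreover have "(\<integral>\<^sup>+\<xi>. emeasure (P.path_from (\<xi> 0, y)) A \<partial>X.path_from x) = emeasure (P.path_from (x, y)) A"
    by (rule X.nn_integral_path_from_initial[OF m1])
  ultimately show ?case
    unfolding emeasure_decoupled[OF 0] by (simp add: splice_path_0)
next
  case (Suc m)
  interpret Qy: prob_space "Q y" by (rule Y.prob_space_kernel)
  let ?A = "case_nat (x, y) -` A"
  have A': "?A \<in> sets path_space" using Suc.prems by simp
  have s: "sets (P0 x \<Otimes>\<^sub>M Q y) = sets (borel :: ('e \<times> 'f) measure)"
    unfolding borel_prod[symmetric] by (rule sets_pair_measure_cong) simp_all
  have f: "(\<lambda>z1. emeasure (P.path_from z1) ?A) \<in> borel_measurable borel"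
    by (rule measurable_compose[OF P.path_from_subprob measurable_emeasure_subprob_algebra[OF A']])
  have fs: "(\<lambda>y1. emeasure (P.path_from (x1, y1)) ?A) \<in> borel_measurable borel" for x1
    by (rule measurable_compose[OF _ f]) (intro borel_measurable_Pair; simp)
  have gm: "(\<lambda>z'. ennreal (g ((x, y), z'))) \<in> borel_measurable (P0 x \<Otimes>\<^sub>M Q y)"
    unfolding measurable_cong_sets[OF s refl]
    by (rule measurable_compose[OF measurable_compose[OF _ g_measurable] measurable_ennreal]) (intro borel_measurable_Pair; simp)
  have fp: "(\<lambda>z1. emeasure (P.path_from z1) ?A) \<in> borel_measurable (P0 x \<Otimes>\<^sub>M Q y)"
    using f by (simp add: measurable_cong_sets[OF s refl])
  have "emeasure (P.path_from (x, y)) A = 0 \<longleftrightarrow> (\<integral>\<^sup>+z1. emeasure (P.path_from z1) ?A \<partial>P (x, y)) = 0"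
    by (simp add: P.emeasure_path_from_step[OF Suc.prems])
  also have "\<dots> \<longleftrightarrow> (AE z1 in P (x, y). emeasure (P.path_from z1) ?A = 0)"
    by (rule nn_integral_0_iff_AE) (use f in \<open>simp add: measurable_cong_sets[OF P.sets_kernel refl]\<close>)
  also have "\<dots> \<longleftrightarrow> (AE z1 in P0 x \<Otimes>\<^sub>M Q y. emeasure (P.path_from z1) ?A = 0)"
    unfolding P_density by (subst AE_density[OF gm]) (simp add: g_pos)
  also have "\<dots> \<longleftrightarrow> (\<integral>\<^sup>+z1. emeasure (P.path_from z1) ?A \<partial>(P0 x \<Otimes>\<^sub>M Q y)) = 0"
    by (rule nn_integral_0_iff_AE[symmetric, OF fp])
  also have "(\<integral>\<^sup>+z1. emeasure (P.path_from z1) ?A \<partial>(P0 x \<Otimes>\<^sub>M Q y))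
      = (\<integral>\<^sup>+x1. \<integral>\<^sup>+y1. emeasure (P.path_from (x1, y1)) ?A \<partial>Q y \<partial>P0 x)"
    by (rule Qy.nn_integral_fst[symmetric, OF fp])
  also have "\<dots> = 0 \<longleftrightarrow> (AE x1 in P0 x. (\<integral>\<^sup>+y1. emeasure (P.path_from (x1, y1)) ?A \<partial>Q y) = 0)"
    by (rule nn_integral_0_iff_AE[OF Qy.borel_measurable_nn_integral_fst[OF fp]])
  also have "\<dots> \<longleftrightarrow> (AE x1 in P0 x. (\<integral>\<^sup>+y1. emeasure (decoupled m x1 y1) ?A \<partial>Q y) = 0)"
  proof -
    have d: "(\<lambda>y1. emeasure (decoupled m x1 y1) ?A) \<in> borel_measurable borel" for x1
      using measurable_compose[OF measurable_Pair1' decoupled_Suc(2)[OF Suc.prems, of m x y]] by simp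
    have "(\<integral>\<^sup>+y1. emeasure (P.path_from (x1, y1)) ?A \<partial>Q y) = 0
        \<longleftrightarrow> (\<integral>\<^sup>+y1. emeasure (decoupled m x1 y1) ?A \<partial>Q y) = 0" for x1
      using fs[of x1] d[of x1]
      by (simp add: nn_integral_0_iff_AE measurable_cong_sets[OF Y.sets_kernel refl] Suc.IH[OF A'])
    then show ?thesis by simp
  qed
  also have "\<dots> \<longleftrightarrow> (\<integral>\<^sup>+x1. \<integral>\<^sup>+y1. emeasure (decoupled m x1 y1) ?A \<partial>Q y \<partial>P0 x) = 0"
  proof (rule nn_integral_0_iff_AE[symmetric])
    have "(\<lambda>(x1, y1). emeasure (decoupled m x1 y1) ?A) \<in> borel_measurable (P0 x \<Otimes>\<^sub>M Q y)"
      using decoupled_Suc(2)[OF Suc.prems, of m x y]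
      by (simp add: measurable_cong_sets[OF sets_pair_measure_cong[OF X.sets_kernel Y.sets_kernel] refl])
    from Qy.borel_measurable_nn_integral_fst[OF this]
    show "(\<lambda>x1. \<integral>\<^sup>+y1. emeasure (decoupled m x1 y1) ?A \<partial>Q y) \<in> borel_measurable (P0 x)" by simp
  qed
  finally show ?case by (simp add: decoupled_Suc(1)[OF Suc.prems])
qed

end

section \<open>Null events of the tail field\<close>

text \<open>
  The map \<open>\<phi>\<close> is the local part of the state, in the application the restriction of \<open>x\<close> to
  finitely many coordinates.
\<close>

locale local_observation = nondegenerate_kernel P P0 Q g
  for P :: "'e::polish_space \<times> 'f::polish_space \<Rightarrow> ('e \<times> 'f) measure"
    and P0 :: "'e \<Rightarrow> 'e measure" and Q :: "'f \<Rightarrow> 'f measure"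
    and g :: "('e \<times> 'f) \<times> ('e \<times> 'f) \<Rightarrow> real" +
  fixes \<phi> :: "'e \<Rightarrow> 'c" and L :: "'c measure"
  assumes \<phi>_measurable: "\<phi> \<in> borel \<rightarrow>\<^sub>M L"

begin

definition local_state :: "'e \<times> 'f \<Rightarrow> 'c \<times> 'f" where
  "local_state z = (\<phi> (fst z), snd z)"

abbreviation obs_field :: "nat set \<Rightarrow> (nat \<Rightarrow> 'e \<times> 'f) measure" where
  "obs_field \<equiv> field_of snd borel"

abbreviation future_field :: "nat \<Rightarrow> (nat \<Rightarrow> 'e \<times> 'f) measure" where
  "future_field m \<equiv> field_of local_state (L \<Otimes>\<^sub>M borel) {m..}"

text \<open>
  All the observations together with the local states from time \<open>m\<close> on. The intersection over all
  \<open>m\<close> is the tail field.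
\<close>

definition env_field :: "nat \<Rightarrow> (nat \<Rightarrow> 'e \<times> 'f) measure" where
  "env_field m = join_field (obs_field UNIV) (future_field m)"

lemma snd_measurable_borel: "snd \<in> (borel :: ('e \<times> 'f) measure) \<rightarrow>\<^sub>M borel"
  unfolding borel_prod[symmetric] by (rule measurable_snd)

lemma local_state_measurable: "local_state \<in> borel \<rightarrow>\<^sub>M L \<Otimes>\<^sub>M borel"
proof -
  have "(\<lambda>z. \<phi> (fst z)) \<in> (borel :: ('e \<times> 'f) measure) \<rightarrow>\<^sub>M L"
    unfolding borel_prod[symmetric] by (rule measurable_compose[OF measurable_fst \<phi>_measurable])
  from measurable_Pair[OF this snd_measurable_borel] show ?thesis
    by (simp add: local_state_def[abs_def])
qed

lemma range_local_state: "range local_state \<subseteq> space (L \<Otimes>\<^sub>M borel)"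
  using measurable_space[OF local_state_measurable] by auto

lemma range_snd: "range (snd :: 'e \<times> 'f \<Rightarrow> 'f) \<subseteq> space borel" by simp

lemma obs_field_sub: "sets (obs_field K) \<subseteq> sets path_space"
  by (rule field_of_sub_path_space[OF snd_measurable_borel])

lemma future_field_sub: "sets (future_field m) \<subseteq> sets path_space"
  by (rule field_of_sub_path_space[OF local_state_measurable])

lemma env_field_sub: "sets (env_field m) \<subseteq> sets path_space"
  unfolding env_field_def by (rule join_field_least[OF _ obs_field_sub future_field_sub]) simp

lemma snd_component_future:
  assumes "m \<le> k"
  shows "(\<lambda>\<omega>. snd (\<omega> k)) \<in> future_field m \<rightarrow>\<^sub>M borel"
  using measurable_compose[OF field_of_component[OF range_local_state, of k "{m..}"] measurable_snd] assms
  by (simp add: local_state_def)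

lemma env_field_rectangles:
  "sets (env_field m) = sigma_sets UNIV {S \<inter> C |S C. S \<in> sets (obs_field {..<m}) \<and> C \<in> sets (future_field m)}"
proof
  let ?E = "{S \<inter> C |S C. S \<in> sets (obs_field {..<m}) \<and> C \<in> sets (future_field m)}"
  let ?R = "sigma UNIV ?E"
  have sR: "sets ?R = sigma_sets UNIV ?E" by simp
  have oR: "sets (obs_field {..<m}) \<subseteq> sets ?R"
  proof
    fix S assume "S \<in> sets (obs_field {..<m})"
    moreover have "UNIV \<in> sets (future_field m)" using sets.top[of "future_field m"] by simp
    ultimately have "S \<inter> UNIV \<in> ?E" by blast
    then show "S \<in> sets ?R" unfolding sR by (auto intro: sigma_sets.Basic)
  qed
  have fR: "sets (future_field m) \<subseteq> sets ?R"
  proof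
    fix C assume "C \<in> sets (future_field m)"
    moreover have "UNIV \<in> sets (obs_field {..<m})" using sets.top[of "obs_field {..<m}"] by simp
    ultimately have "UNIV \<inter> C \<in> ?E" by blast
    then show "C \<in> sets ?R" unfolding sR by (auto intro: sigma_sets.Basic)
  qed
  have "(\<lambda>\<omega>. \<omega>) \<in> ?R \<rightarrow>\<^sub>M obs_field UNIV"
  proof (rule measurable_field_of[OF range_snd])
    fix k
    show "(\<lambda>\<omega>. snd (\<omega> k)) \<in> ?R \<rightarrow>\<^sub>M borel"
    proof (cases "k < m")
      case True
      then show ?thesis
        using field_of_component[OF range_snd, of k "{..<m}"] oR
        by (intro measurable_from_subalg[of ?R "obs_field {..<m}"]) (auto simp: subalgebra_def)
    next
      case False
      then show ?thesis
        using snd_component_future[of m k] fR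
        by (intro measurable_from_subalg[of ?R "future_field m"]) (auto simp: subalgebra_def)
    qed
  qed
  from measurable_sets[OF this] have "sets (obs_field UNIV) \<subseteq> sets ?R" by auto
  then show "sets (env_field m) \<subseteq> sigma_sets UNIV ?E"
    unfolding env_field_def sR[symmetric] by (rule join_field_least[rotated]) (use fR in auto)
  have "?E \<subseteq> sets (env_field m)"
  proof clarify
    fix S C assume "S \<in> sets (obs_field {..<m})" "C \<in> sets (future_field m)"
    then have "S \<in> sets (env_field m)" "C \<in> sets (env_field m)"
      using field_of_mono[of "{..<m}" UNIV snd borel] join_field_upper(1)[of "obs_field UNIV" "future_field m"]
        join_field_upper(2)[of "future_field m" "obs_field UNIV"]
      by (auto simp: env_field_def)
    then show "S \<inter> C \<in> sets (env_field m)" by (rule sets.Int)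
  qed
  then show "sigma_sets UNIV ?E \<subseteq> sets (env_field m)"
    using sets.sigma_sets_subset[of ?E "env_field m"] by (simp add: env_field_def)
qed

text \<open>
  In the decoupled chain the observations before time \<open>m\<close> are linked to the future only through the
  observation at time \<open>m\<close>. Their conditional probability given the future is therefore a
  function of that observation, computed from the law of the decoupled observations alone, in which
  the initial state \<open>x\<close> does not occur.
\<close>

lemma decoupled_common_conditional:
  assumes S: "S \<in> sets (obs_field {..<m})"
  shows "\<exists>q\<in>borel_measurable (future_field m). \<forall>x. \<forall>f\<in>borel_measurable (future_field m).
    (\<integral>\<^sup>+\<omega>. indicator S \<omega> * f \<omega> \<partial>decoupled m x y) = (\<integral>\<^sup>+\<omega>. q \<omega> * (f \<omega> :: ennreal) \<partial>decoupled m x y)"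
proof -
  let ?Y = "Y.path_from y"
  interpret Yp: prob_space ?Y by (rule Y.prob_space_path_from)
  \<comment> \<open>Events of the observations do not see the signal, so any signal path can be inserted.\<close>
  define c :: "nat \<Rightarrow> 'e" where "c = (\<lambda>_. undefined)"
  define S' where "S' = {\<eta>. zip_path c \<eta> \<in> S}"
  have S_path: "S \<in> sets path_space" using S obs_field_sub by auto
  have "(\<lambda>\<eta>. zip_path c \<eta>) \<in> path_space \<rightarrow>\<^sub>M path_space"
    using measurable_compose[OF measurable_Pair1'[of c path_space path_space] zip_path_measurable] by simp
  from measurable_sets[OF this S_path] have S'[measurable]: "S' \<in> sets path_space"
    by (simp add: S'_def vimage_def)
  have mem_S: "splice_path m (zip_path \<xi> \<eta>) \<omega> \<in> S \<longleftrightarrow> \<eta> \<in> S'" for \<xi> \<eta> \<omega>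
    unfolding S'_def mem_Collect_eq by (rule field_of_cong_mem[OF range_snd S]) (simp add: splice_path_def)
  have proj: "(\<lambda>\<eta>. \<eta> m) \<in> ?Y \<rightarrow>\<^sub>M borel" "(\<lambda>\<eta>. \<eta> m) \<in> density ?Y (indicator S') \<rightarrow>\<^sub>M borel"
    by (simp_all add: measurable_cong_sets[OF Y.sets_path_from refl])
  define \<nu> where "\<nu> = distr ?Y borel (\<lambda>\<eta>. \<eta> m)"
  define \<nu>1 where "\<nu>1 = distr (density ?Y (indicator S')) borel (\<lambda>\<eta>. \<eta> m)"
  interpret \<nu>: prob_space \<nu> unfolding \<nu>_def by (rule Yp.prob_space_distr[OF proj(1)])
  have sets_\<nu>: "sets \<nu> = sets borel" "sets \<nu>1 = sets borel" by (simp_all add: \<nu>_def \<nu>1_def)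
  have ind: "indicator S' \<in> borel_measurable ?Y" using S' by simp
  have int_\<nu>1: "(\<integral>\<^sup>+t. h t \<partial>\<nu>1) = (\<integral>\<^sup>+\<eta>. indicator S' \<eta> * h (\<eta> m) \<partial>?Y)" if [measurable]: "h \<in> borel_measurable borel" for h
    unfolding \<nu>1_def by (subst nn_integral_distr[OF proj(2)], simp, subst nn_integral_density[OF ind]) (use proj(1) in simp_all)
  have int_\<nu>: "(\<integral>\<^sup>+t. h t \<partial>\<nu>) = (\<integral>\<^sup>+\<eta>. h (\<eta> m) \<partial>?Y)" if "h \<in> borel_measurable borel" for h
    unfolding \<nu>_def by (rule nn_integral_distr[OF proj(1)]) (use that in simp)
  have ac: "absolutely_continuous \<nu> \<nu>1"
    unfolding absolutely_continuous_def
  proof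
    fix B assume B: "B \<in> null_sets \<nu>"
    then have Bb[measurable]: "B \<in> sets borel" using sets_\<nu> by auto
    have "emeasure \<nu>1 B = (\<integral>\<^sup>+t. indicator B t \<partial>\<nu>1)" using sets_\<nu> by simp
    also have "\<dots> = (\<integral>\<^sup>+\<eta>. indicator S' \<eta> * indicator B (\<eta> m) \<partial>?Y)" by (rule int_\<nu>1) simp
    also have "\<dots> \<le> (\<integral>\<^sup>+\<eta>. indicator B (\<eta> m) \<partial>?Y)" by (rule nn_integral_mono) (simp add: indicator_def)
    also have "\<dots> = (\<integral>\<^sup>+t. indicator B t \<partial>\<nu>)" by (rule int_\<nu>[symmetric]) simp
    also have "\<dots> = 0" using B sets_\<nu> by auto
    finally show "B \<in> null_sets \<nu>1" using sets_\<nu> by (simp add: null_sets_def)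
  qed
  \<comment> \<open>The conditional probability of \<open>S'\<close> given the observation at time \<open>m\<close>.\<close>
  define u where "u = RN_deriv \<nu> \<nu>1"
  have u[measurable]: "u \<in> borel_measurable borel"
    using borel_measurable_RN_deriv[of \<nu> \<nu>1] by (simp add: u_def measurable_cong_sets[OF sets_\<nu>(1) refl])
  have "density \<nu> u = \<nu>1" unfolding u_def by (rule \<nu>.density_RN_deriv[OF ac]) (simp add: sets_\<nu>)
  then have swap: "(\<integral>\<^sup>+\<eta>. indicator S' \<eta> * h (\<eta> m) \<partial>?Y) = (\<integral>\<^sup>+\<eta>. u (\<eta> m) * h (\<eta> m) \<partial>?Y)"
    if [measurable]: "h \<in> borel_measurable borel" for h
  proof -
    have "(\<integral>\<^sup>+\<eta>. indicator S' \<eta> * h (\<eta> m) \<partial>?Y) = (\<integral>\<^sup>+t. h t \<partial>density \<nu> u)"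
      using int_\<nu>1[OF that] \<open>density \<nu> u = \<nu>1\<close> by simp
    also have "\<dots> = (\<integral>\<^sup>+t. u t * h t \<partial>\<nu>)"
      by (rule nn_integral_density) (simp_all add: measurable_cong_sets[OF sets_\<nu>(1) refl])
    also have "\<dots> = (\<integral>\<^sup>+\<eta>. u (\<eta> m) * h (\<eta> m) \<partial>?Y)" by (rule int_\<nu>) simp
    finally show ?thesis .
  qed
  let ?q = "\<lambda>\<omega> :: nat \<Rightarrow> 'e \<times> 'f. u (snd (\<omega> m))"
  have q: "?q \<in> borel_measurable (future_field m)"
    by (rule measurable_compose[OF snd_component_future u]) simp
  show ?thesis
  proof (intro bexI[OF _ q] allI ballI)
    fix x and f :: "(nat \<Rightarrow> 'e \<times> 'f) \<Rightarrow> ennreal" assume f: "f \<in> borel_measurable (future_field m)"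
    define f' where "f' \<omega> = f (splice_path m (\<lambda>_. undefined) \<omega>)" for \<omega>
    have f_path [measurable]: "f \<in> borel_measurable path_space"
      by (rule measurable_from_subalg[OF _ f]) (use future_field_sub in \<open>simp add: subalgebra_def\<close>)
    have f'_meas [measurable]: "f' \<in> borel_measurable path_space"
      unfolding f'_def by (rule measurable_compose[OF splice_measurable2 f_path])
    have q_path [measurable]: "?q \<in> borel_measurable path_space"
      by (rule measurable_from_subalg[OF _ q]) (use future_field_sub in \<open>simp add: subalgebra_def\<close>)
    have f_splice: "f (splice_path m (zip_path \<xi> \<eta>) \<omega>) = f' \<omega>" for \<xi> \<eta> \<omega>
      unfolding f'_def by (rule field_of_cong_fun[OF range_local_state f]) (simp add: splice_path_def)
    have h_meas: "(\<lambda>t. \<integral>\<^sup>+\<omega>. f' \<omega> \<partial>P.path_from (a, t)) \<in> borel_measurable borel" for a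
      by (rule measurable_compose[OF measurable_compose[OF _ P.path_from_subprob] nn_integral_measurable_subprob_algebra[OF f'_meas]])
        (intro borel_measurable_Pair; simp)
    have f'P: "f' \<in> borel_measurable (P.path_from z)" for z by simp
    have "(\<integral>\<^sup>+\<omega>. indicator S \<omega> * f \<omega> \<partial>decoupled m x y)
        = (\<integral>\<^sup>+\<xi>. \<integral>\<^sup>+\<eta>. indicator S' \<eta> * (\<integral>\<^sup>+\<omega>. f' \<omega> \<partial>P.path_from (\<xi> m, \<eta> m)) \<partial>?Y \<partial>X.path_from x)"
    proof -
      have "indicator S (splice_path m (zip_path \<xi> \<eta>) \<omega>) = (indicator S' \<eta> :: ennreal)" for \<xi> \<eta> \<omega>
        using mem_S by (simp add: indicator_def)
      then show ?thesis using S_path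
        by (subst nn_integral_decoupled) (simp_all add: f_splice nn_integral_cmult f'P)
    qed
    also have "\<dots> = (\<integral>\<^sup>+\<xi>. \<integral>\<^sup>+\<eta>. u (\<eta> m) * (\<integral>\<^sup>+\<omega>. f' \<omega> \<partial>P.path_from (\<xi> m, \<eta> m)) \<partial>?Y \<partial>X.path_from x)"
      by (rule nn_integral_cong) (rule swap[OF h_meas])
    also have "\<dots> = (\<integral>\<^sup>+\<xi>. \<integral>\<^sup>+\<eta>. \<integral>\<^sup>+\<omega>. u (snd (\<omega> 0)) * f' \<omega> \<partial>P.path_from (\<xi> m, \<eta> m) \<partial>?Y \<partial>X.path_from x)"
    proof (intro nn_integral_cong)
      fix \<xi> \<eta>
      have "AE \<omega> in P.path_from (\<xi> m, \<eta> m). \<omega> 0 = (\<xi> m, \<eta> m)"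
        by (rule P.AE_path_from_initial) simp
      then have "(\<integral>\<^sup>+\<omega>. u (snd (\<omega> 0)) * f' \<omega> \<partial>P.path_from (\<xi> m, \<eta> m)) = (\<integral>\<^sup>+\<omega>. u (\<eta> m) * f' \<omega> \<partial>P.path_from (\<xi> m, \<eta> m))"
        by (intro nn_integral_cong_AE) (auto elim: eventually_mono)
      then show "u (\<eta> m) * (\<integral>\<^sup>+\<omega>. f' \<omega> \<partial>P.path_from (\<xi> m, \<eta> m)) = (\<integral>\<^sup>+\<omega>. u (snd (\<omega> 0)) * f' \<omega> \<partial>P.path_from (\<xi> m, \<eta> m))"
        by (simp add: nn_integral_cmult f'P)
    qed
    also have "\<dots> = (\<integral>\<^sup>+\<omega>. ?q \<omega> * f \<omega> \<partial>decoupled m x y)"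
    proof -
      have "snd (splice_path m \<zeta> \<omega> m) = snd (\<omega> 0)" for \<zeta> \<omega> :: "nat \<Rightarrow> 'e \<times> 'f" by (simp add: splice_path_def)
      then show ?thesis by (subst nn_integral_decoupled) (simp_all add: f_splice)
    qed
    finally show "(\<integral>\<^sup>+\<omega>. indicator S \<omega> * f \<omega> \<partial>decoupled m x y) = (\<integral>\<^sup>+\<omega>. ?q \<omega> * f \<omega> \<partial>decoupled m x y)" .
  qed
qed

text \<open>
  The event \<open>B\<close> is found for the decoupled chains; only its null events matter, so it serves for
  the original chain.
\<close>

lemma path_null_transfer:
  "\<exists>B\<in>sets (future_field m). emeasure (P.path_from (x, y)) B = 0 \<and>
    (\<forall>A\<in>sets (env_field m). emeasure (P.path_from (x, y)) A = 0 \<longrightarrow> emeasure (P.path_from (x', y)) (A - B) = 0)"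
proof -
  have sp: "space (decoupled m x y) = UNIV" using sets_eq_imp_space_eq[OF sets_decoupled] by simp
  have "\<exists>B\<in>sets (future_field m). emeasure (decoupled m x y) B = 0 \<and>
    (\<forall>A\<in>sets (env_field m). emeasure (decoupled m x y) A = 0 \<longrightarrow> emeasure (decoupled m x' y) (A - B) = 0)"
  proof (rule common_conditional_null_transfer[where \<S>="sets (obs_field {..<m})"])
    show "prob_space (decoupled m x y)" "prob_space (decoupled m x' y)" by (rule prob_space_decoupled)+
    show "sets (decoupled m x y) = sets (decoupled m x' y)" by (simp add: sets_decoupled)
    show "subalgebra (decoupled m x y) (future_field m)"
      using future_field_sub by (simp add: subalgebra_def sp sets_decoupled)
    show "subalgebra (decoupled m x y) (env_field m)"
      using env_field_sub by (simp add: subalgebra_def sp sets_decoupled) (simp add: env_field_def)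
    show "sets (env_field m) = sigma_sets (space (decoupled m x y)) {S \<inter> C |S C. S \<in> sets (obs_field {..<m}) \<and> C \<in> sets (future_field m)}"
      unfolding sp by (rule env_field_rectangles)
    show "space (decoupled m x y) \<in> sets (obs_field {..<m})"
      unfolding sp using sets.top[of "obs_field {..<m}"] by simp
    show "sets (obs_field {..<m}) \<subseteq> sets (decoupled m x y)" using obs_field_sub by (simp add: sets_decoupled)
    fix S assume "S \<in> sets (obs_field {..<m})"
    from decoupled_common_conditional[OF this, of y]
    show "\<exists>q\<in>borel_measurable (future_field m). \<forall>f\<in>borel_measurable (future_field m).
        (\<integral>\<^sup>+\<omega>. indicator S \<omega> * f \<omega> \<partial>decoupled m x y) = (\<integral>\<^sup>+\<omega>. q \<omega> * f \<omega> \<partial>decoupled m x y) \<and>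
        (\<integral>\<^sup>+\<omega>. indicator S \<omega> * f \<omega> \<partial>decoupled m x' y) = (\<integral>\<^sup>+\<omega>. q \<omega> * (f \<omega> :: ennreal) \<partial>decoupled m x' y)"
      by blast
  qed auto
  then obtain B where B: "B \<in> sets (future_field m)" "emeasure (decoupled m x y) B = 0"
    "\<And>A. A \<in> sets (env_field m) \<Longrightarrow> emeasure (decoupled m x y) A = 0 \<Longrightarrow> emeasure (decoupled m x' y) (A - B) = 0"
    by blast
  have BP: "B \<in> sets path_space" using B(1) future_field_sub by auto
  show ?thesis
  proof (intro bexI[OF _ B(1)] conjI ballI impI)
    show "emeasure (P.path_from (x, y)) B = 0"
      using B(2) null_iff_decoupled_null[OF BP] by blast
    fix A assume A: "A \<in> sets (env_field m)" "emeasure (P.path_from (x, y)) A = 0"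
    have AP: "A \<in> sets path_space" using A(1) env_field_sub by auto
    have "emeasure (decoupled m x y) A = 0" using A(2) null_iff_decoupled_null[OF AP] by blast
    from B(3)[OF A(1) this] show "emeasure (P.path_from (x', y)) (A - B) = 0"
      using null_iff_decoupled_null[of "A - B"] AP BP by blast
  qed
qed

text \<open>
  A tail event that is null under \<open>K (x, y)\<close> has, for every \<open>m\<close>, its \<open>K (x', y)\<close>-probability
  concentrated on a \<open>K (x, y)\<close>-null event of the local future after \<open>m\<close>, on which the two laws
  almost agree when \<open>m\<close> is large.
\<close>

theorem tail_null_transfer:
  assumes R: "prob_space R"
    and mix: "\<And>x. (\<lambda>n. tv_dist (sets (future_field n)) (P.path_from (x, y)) R) \<longlonglongrightarrow> 0"
    and A: "\<And>m. A \<in> sets (env_field m)" and null: "measure (P.path_from (x, y)) A = 0"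
  shows "measure (P.path_from (x', y)) A = 0"
proof -
  let ?p = "P.path_from (x, y)" and ?p' = "P.path_from (x', y)"
  interpret p: prob_space ?p by (rule P.prob_space_path_from)
  interpret p': prob_space ?p' by (rule P.prob_space_path_from)
  let ?t = "\<lambda>m. tv_dist (sets (future_field m)) ?p R / 2 + tv_dist (sets (future_field m)) ?p' R / 2"
  have AP: "A \<in> sets path_space" using A[of 0] env_field_sub by auto
  have "measure ?p' A \<le> ?t m" for m
  proof -
    obtain B where B: "B \<in> sets (future_field m)" "emeasure ?p B = 0"
      and AB: "emeasure ?p A = 0 \<Longrightarrow> emeasure ?p' (A - B) = 0"
      using path_null_transfer[of m x y x'] A[of m] by blast
    have BP: "B \<in> sets path_space" using B(1) future_field_sub by auto
    have "emeasure ?p' (A - B) = 0" using AB null by (simp add: p.emeasure_eq_measure)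
    then have ab0: "measure ?p' (A - B) = 0" by (simp add: p'.emeasure_eq_measure)
    have b0: "measure ?p B = 0" using B(2) by (simp add: p.emeasure_eq_measure)
    have "measure ?p' A \<le> measure ?p' ((A - B) \<union> B)"
      by (rule p'.finite_measure_mono) (use AP BP in auto)
    also have "\<dots> \<le> measure ?p' (A - B) + measure ?p' B"
      by (rule measure_Un_le) (use AP BP in auto)
    also have "\<dots> = measure ?p' B - measure ?p B" using ab0 b0 by simp
    also have "\<dots> \<le> \<bar>measure ?p B - measure R B\<bar> + \<bar>measure ?p' B - measure R B\<bar>" by linarith
    also have "\<dots> \<le> ?t m"
    proof (rule add_mono)
      show "\<bar>measure ?p B - measure R B\<bar> \<le> tv_dist (sets (future_field m)) ?p R / 2"
        "\<bar>measure ?p' B - measure R B\<bar> \<le> tv_dist (sets (future_field m)) ?p' R / 2"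
        using abs_measure_diff_le_tv_dist[OF P.prob_space_path_from R B(1)] by (simp_all add: le_divide_eq mult.commute)
    qed
    finally show ?thesis .
  qed
  moreover have "?t \<longlonglongrightarrow> 0 / 2 + 0 / 2"
    by (intro tendsto_intros mix) auto
  ultimately have "measure ?p' A \<le> 0" by (intro LIMSEQ_le_const[of ?t]) auto
  then show ?thesis by (simp add: measure_le_0_iff)
qed

section \<open>The tail field given the observations\<close>

lemma env_field_dec: "i \<le> j \<Longrightarrow> sets (env_field j) \<subseteq> sets (env_field i)"
  unfolding env_field_def
  by (rule join_field_least)
    (use join_field_upper(1)[of "obs_field UNIV" "future_field i"] join_field_upper(2)[of "future_field i" "obs_field UNIV"]
      field_of_mono[of "{j..}" "{i..}" local_state "L \<Otimes>\<^sub>M borel"] in auto)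

lemma splice_env_measurable: "splice_path n \<omega> \<in> env_field m \<rightarrow>\<^sub>M env_field (n + m)"
proof -
  have sub: "subalgebra (env_field m) (obs_field UNIV)" "subalgebra (env_field m) (future_field m)"
    using join_field_upper(1)[of "obs_field UNIV" "future_field m"] join_field_upper(2)[of "future_field m" "obs_field UNIV"]
    by (simp_all add: subalgebra_def env_field_def)
  have 1: "splice_path n \<omega> \<in> env_field m \<rightarrow>\<^sub>M obs_field UNIV"
  proof (rule measurable_field_of[OF range_snd])
    fix k
    have "(\<lambda>\<omega>'. snd (\<omega>' (k - n))) \<in> env_field m \<rightarrow>\<^sub>M borel"
      by (rule measurable_from_subalg[OF sub(1) field_of_component[OF range_snd]]) simp
    then show "(\<lambda>\<omega>'. snd (splice_path n \<omega> \<omega>' k)) \<in> env_field m \<rightarrow>\<^sub>M borel"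
      by (cases "k < n") (simp_all add: splice_path_def)
  qed
  have 2: "splice_path n \<omega> \<in> env_field m \<rightarrow>\<^sub>M future_field (n + m)"
  proof (rule measurable_field_of[OF range_local_state])
    fix k assume k: "k \<in> {n + m..}"
    have "(\<lambda>\<omega>'. local_state (\<omega>' (k - n))) \<in> env_field m \<rightarrow>\<^sub>M L \<Otimes>\<^sub>M borel"
      by (rule measurable_from_subalg[OF sub(2) field_of_component[OF range_local_state]]) (use k in auto)
    then show "(\<lambda>\<omega>'. local_state (splice_path n \<omega> \<omega>' k)) \<in> env_field m \<rightarrow>\<^sub>M L \<Otimes>\<^sub>M borel"
      using k by (simp add: splice_path_def)
  qed
  show ?thesis unfolding env_field_def[of "n + m"] by (rule measurable_join_field[OF 1 2])
qed

lemma space_env_field [simp]: "space (env_field m) = UNIV" by (simp add: env_field_def)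

text \<open>
  Shifting by \<open>n\<close> and freezing the first \<open>n\<close> states maps tail events to tail events.
\<close>

lemma tail_section:
  assumes "\<And>m. A \<in> sets (env_field m)"
  shows "splice_path n \<omega> -` A \<in> sets (env_field m)"
  using measurable_sets[OF splice_env_measurable assms, of n \<omega> m] by simp

lemma env_field_cong_mem:
  assumes A: "A \<in> sets (env_field n)" and "\<And>k. snd (\<omega> k) = snd (\<omega>' k)" and "\<And>k. n \<le> k \<Longrightarrow> \<omega> k = \<omega>' k"
  shows "\<omega> \<in> A \<longleftrightarrow> \<omega>' \<in> A"
proof (rule join_field_cong_mem[OF A[unfolded env_field_def]])
  show "\<omega> \<in> B \<longleftrightarrow> \<omega>' \<in> B" if "B \<in> sets (obs_field UNIV)" for B
    by (rule field_of_cong_mem[OF range_snd that]) (simp add: assms(2))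
  show "\<omega> \<in> B \<longleftrightarrow> \<omega>' \<in> B" if "B \<in> sets (future_field n)" for B
    by (rule field_of_cong_mem[OF range_local_state that]) (simp add: assms(3))
qed

text \<open>
  The law started from \<open>(x0, y)\<close> is absolutely continuous on the tail field with respect to the law
  started from \<open>(x, y)\<close>. The function \<open>a m\<close> makes this quantitative in a way that is measurable
  in the initial state: it is the largest excess of the one law over \<open>m\<close> times the other,
  on a countable algebra that generates \<open>env_field m\<close>. If it did not tend to zero, the upper limit
  of a sequence of events with large excess would be a tail event that is null for one of the laws but
  not for the other.
\<close>

lemma tail_domination:
  assumes R: "prob_space R" and L: "countably_generated L"
    and mix: "\<And>x y. (\<lambda>n. tv_dist (sets (future_field n)) (P.path_from (x, y)) R) \<longlonglongrightarrow> 0"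
  obtains a where "\<And>m. a m \<in> borel_measurable borel" "\<And>m z. 0 \<le> a m z" "\<And>m z. a m z \<le> 1"
    "\<And>m z C. C \<in> sets (env_field m) \<Longrightarrow>
      measure (P.path_from (x0, snd z)) C \<le> real m * measure (P.path_from z) C + (a m z :: real)"
    "\<And>z. (\<lambda>m. a m z) \<longlonglongrightarrow> 0"
proof -
  let ?K = "P.path_from"
  define K' where "K' z = ?K (x0, snd z)" for z :: "'e \<times> 'f"
  have x0_meas: "(\<lambda>z. (x0, snd z)) \<in> (borel :: ('e \<times> 'f) measure) \<rightarrow>\<^sub>M borel"
    by (intro borel_measurable_Pair) (simp_all add: snd_measurable_borel)
  have K'_meas: "K' \<in> borel \<rightarrow>\<^sub>M subprob_algebra path_space"
    unfolding K'_def by (rule measurable_compose[OF x0_meas P.path_from_subprob])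
  have K'_prob: "prob_space (K' z)" for z unfolding K'_def by (rule P.prob_space_path_from)
  have sK': "sets (K' z) = sets path_space" "space (K' z) = UNIV" for z unfolding K'_def by simp_all
  have K_le1: "measure (?K z) C \<le> 1" "measure (K' z) C \<le> 1" for z C
    by (rule prob_space.prob_le_1[OF P.prob_space_path_from], rule prob_space.prob_le_1[OF K'_prob])
  have "countably_generated (env_field m)" for m
  proof -
    have "countably_generated (L \<Otimes>\<^sub>M (borel :: 'f measure))"
      by (rule countably_generated_pair[OF L countably_generated_borel])
    then show ?thesis unfolding env_field_def
      by (intro countably_generated_join_field countably_generated_field_of countably_generated_borel range_local_state) simp_all
  qed
  then have "\<exists>\<C>. countable \<C> \<and> algebra UNIV \<C> \<and> sets (env_field m) = sigma_sets UNIV \<C>" for m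
    by (rule countably_generated_algebra) auto
  then obtain \<C> where \<C>: "\<And>m. countable (\<C> m)" "\<And>m. algebra UNIV (\<C> m)" "\<And>m. sets (env_field m) = sigma_sets UNIV (\<C> m)"
    by metis
  have \<C>_env: "\<C> m \<subseteq> sets (env_field m)" for m unfolding \<C>(3) by auto
  have \<C>_path: "\<C> m \<subseteq> sets path_space" for m using \<C>_env env_field_sub by blast
  have empty: "{} \<in> \<C> m" for m
  proof -
    interpret algebra UNIV "\<C> m" by (rule \<C>(2))
    show ?thesis by simp
  qed
  define a where "a m z = (SUP C\<in>\<C> m. measure (K' z) C - real m * measure (?K z) C)" for m z
  have bdd: "bdd_above ((\<lambda>C. measure (K' z) C - real m * measure (?K z) C) ` \<C> m)" for m z
  proof (rule bdd_aboveI[of _ 1])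
    fix t assume "t \<in> (\<lambda>C. measure (K' z) C - real m * measure (?K z) C) ` \<C> m"
    then obtain C where "t = measure (K' z) C - real m * measure (?K z) C" by blast
    moreover have "0 \<le> real m * measure (?K z) C" by simp
    ultimately show "t \<le> 1" using K_le1(2)[of z C] by linarith
  qed
  have a_meas: "a m \<in> borel_measurable borel" for m
    unfolding a_def
  proof (rule borel_measurable_cSUP[OF \<C>(1)])
    fix C assume "C \<in> \<C> m"
    then have C: "C \<in> sets path_space" using \<C>_path by blast
    show "(\<lambda>z. measure (K' z) C - real m * measure (?K z) C) \<in> borel_measurable borel"
      using measurable_compose[OF K'_meas measurable_measure_subprob_algebra[OF C]]
        measurable_compose[OF P.path_from_subprob measurable_measure_subprob_algebra[OF C]]
      by (intro borel_measurable_diff borel_measurable_times) simp_all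
  qed (rule bdd)
  have a_nonneg: "0 \<le> a m z" for m z
    unfolding a_def by (rule cSUP_upper2[OF bdd empty]) simp
  have a_le1: "a m z \<le> 1" for m z
    unfolding a_def
  proof (rule cSUP_least)
    show "\<C> m \<noteq> {}" using empty by blast
    fix C
    have "0 \<le> real m * measure (?K z) C" by simp
    then show "measure (K' z) C - real m * measure (?K z) C \<le> 1" using K_le1(2)[of z C] by linarith
  qed
  have a_bound: "measure (K' z) C \<le> real m * measure (?K z) C + a m z" if C: "C \<in> sets (env_field m)" for m z C
  proof (rule measure_bound_from_algebra[OF \<C>(2)])
    show "C \<in> sigma_sets UNIV (\<C> m)" using C \<C>(3) by simp
    show "finite_measure (K' z)" "finite_measure (?K z)"
      using K'_prob P.prob_space_path_from by (simp_all add: prob_space_def)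
    show "\<C> m \<subseteq> sets (K' z)" "\<C> m \<subseteq> sets (?K z)" using \<C>_path by (simp_all add: sK')
    fix B assume "B \<in> \<C> m"
    then have "measure (K' z) B - real m * measure (?K z) B \<le> a m z"
      unfolding a_def by (rule cSUP_upper[OF _ bdd])
    then show "measure (K' z) B \<le> real m * measure (?K z) B + a m z" by linarith
  qed (simp_all add: sK')
  have a_lim: "(\<lambda>m. a m z) \<longlonglongrightarrow> 0" for z
  proof (rule ccontr)
    assume "\<not> (\<lambda>m. a m z) \<longlonglongrightarrow> 0"
    then obtain \<delta> where \<delta>: "0 < \<delta>" and freq: "\<And>k. \<exists>m\<ge>k. \<not> \<bar>a m z\<bar> < \<delta>"
      unfolding LIMSEQ_iff by (auto simp: not_less) 
    \<comment> \<open>The index \<open>m \<ge> 2\<^sup>k\<close> makes the probabilities under \<open>K z\<close> summable and also places the event in \<open>env_field k\<close>.\<close>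
    have "\<exists>m C. 2 ^ k \<le> m \<and> C \<in> \<C> m \<and> \<delta> / 2 < measure (K' z) C - real m * measure (?K z) C" for k :: nat
    proof -
      obtain m where m: "2 ^ k \<le> m" "\<not> \<bar>a m z\<bar> < \<delta>" using freq by blast
      then have "\<delta> / 2 < a m z" using a_nonneg[of m z] \<delta> by linarith
      then show ?thesis unfolding a_def using m(1) empty[of m]
        by (subst (asm) less_cSUP_iff[OF _ bdd]) auto
    qed
    then obtain f D where f: "\<And>k. 2 ^ k \<le> f k" and D: "\<And>k. D k \<in> \<C> (f k)"
      and big: "\<And>k. \<delta> / 2 < measure (K' z) (D k) - real (f k) * measure (?K z) (D k)"
      by metis
    have D_env: "D k \<in> sets (env_field j)" if "j \<le> k" for j k
    proof -
      have "k < 2 ^ k" by (rule less_exp)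
      then have "j \<le> f k" using f[of k] that by linarith
      then show ?thesis using D[of k] \<C>_env env_field_dec by blast
    qed
    have D_path: "D k \<in> sets path_space" for k using D \<C>_path by blast
    define U where "U j = (\<Union>i. D (j + i))" for j
    have U_env: "U j \<in> sets (env_field j)" for j
      unfolding U_def by (intro sets.countable_UN) (auto intro: D_env)
    have U_dec: "U j \<subseteq> U i" if "i \<le> j" for i j
      unfolding U_def
    proof clarify
      fix \<omega> l assume "\<omega> \<in> D (j + l)"
      then have "\<omega> \<in> D (i + (j - i + l))" using that by simp
      then show "\<omega> \<in> (\<Union>l. D (i + l))" by blast
    qed
    define E where "E = (\<Inter>j. U j)"
    have E_env: "E \<in> sets (env_field m)" for m
    proof -
      have "E = (\<Inter>j. U (m + j))"
        unfolding E_def using U_dec by (auto, metis le_add2 subsetD)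
      moreover have "U (m + j) \<in> sets (env_field m)" for j
        using U_env[of "m + j"] env_field_dec[of m "m + j"] by auto
      ultimately show ?thesis by auto
    qed
    have U_path: "U j \<in> sets path_space" for j using U_env env_field_sub by blast
    have E_path: "E \<in> sets path_space" using E_env env_field_sub by blast
    interpret k: prob_space "?K z" by (rule P.prob_space_path_from)
    interpret k': prob_space "K' z" by (rule K'_prob)
    have small: "measure (?K z) (D k) \<le> (1 / 2) ^ k" for k
    proof -
      have "real (f k) * measure (?K z) (D k) \<le> 1" using big[of k] \<delta> K_le1(2)[of z "D k"] by linarith
      moreover have "2 ^ k * measure (?K z) (D k) \<le> real (f k) * measure (?K z) (D k)"
      proof (rule mult_right_mono)
        have "real (2 ^ k) \<le> real (f k)" using f[of k] by (simp only: of_nat_le_iff)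
        then show "2 ^ k \<le> real (f k)" by simp
      qed simp
      ultimately have "2 ^ k * measure (?K z) (D k) \<le> 1" by linarith
      then show ?thesis by (simp add: power_one_over field_simps)
    qed
    have UK: "measure (?K z) (U j) \<le> 2 * (1 / 2) ^ j" for j
    proof -
      have s: "(\<lambda>i. (1 / 2) ^ (j + i) :: real) sums (2 * (1 / 2) ^ j)"
        using sums_mult[OF geometric_sums[of "1 / 2 :: real"], of "(1 / 2) ^ j"] by (simp add: power_add mult.commute)
      have sm: "summable (\<lambda>i. measure (?K z) (D (j + i)))"
        by (rule summable_comparison_test'[OF sums_summable[OF s], of 0]) (simp add: small)
      have "measure (?K z) (U j) \<le> (\<Sum>i. measure (?K z) (D (j + i)))"
        unfolding U_def by (rule k.finite_measure_subadditive_countably[OF _ sm]) (use D_path in auto)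
      also have "\<dots> \<le> (\<Sum>i. (1 / 2) ^ (j + i))"
        by (rule suminf_le[OF small sm sums_summable[OF s]])
      also have "\<dots> = 2 * (1 / 2) ^ j" using s by (rule sums_unique[symmetric])
      finally show ?thesis .
    qed
    have "measure (?K z) E \<le> 2 * (1 / 2) ^ j" for j
    proof -
      have "E \<subseteq> U j" by (auto simp: E_def)
      then have "measure (?K z) E \<le> measure (?K z) (U j)"
        by (rule k.finite_measure_mono) (use U_path in simp)
      then show ?thesis using UK[of j] by linarith
    qed
    moreover have "(\<lambda>j. 2 * (1 / 2) ^ j :: real) \<longlonglongrightarrow> 2 * 0"
      by (intro tendsto_intros LIMSEQ_power_zero) simp
    ultimately have "measure (?K z) E \<le> 0"
      by (intro LIMSEQ_le_const[of "\<lambda>j. 2 * (1 / 2) ^ j"]) auto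
    then have "measure (?K (fst z, snd z)) E = 0" by (simp add: measure_le_0_iff)
    then have null: "measure (K' z) E = 0"
      unfolding K'_def by (rule tail_null_transfer[OF R mix E_env])
    have "(\<lambda>j. measure (K' z) (U j)) \<longlonglongrightarrow> measure (K' z) E"
      unfolding E_def by (rule k'.finite_Lim_measure_decseq) (use U_path U_dec in \<open>auto simp: sK' decseq_def\<close>)
    moreover have "\<delta> / 2 \<le> measure (K' z) (U j)" for j
    proof -
      have "0 \<le> real (f j) * measure (?K z) (D j)" by simp
      then have "\<delta> / 2 \<le> measure (K' z) (D j)" using big[of j] by linarith
      also have "\<dots> \<le> measure (K' z) (U j)"
      proof (rule k'.finite_measure_mono)
        show "D j \<subseteq> U j" unfolding U_def using UN_upper[of 0 UNIV "\<lambda>i. D (j + i)"] by simp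
      qed (use U_path in \<open>simp add: sK'\<close>)
      finally show ?thesis .
    qed
    ultimately have "\<delta> / 2 \<le> measure (K' z) E" by (intro LIMSEQ_le_const[of "\<lambda>j. measure (K' z) (U j)"]) auto
    with null \<delta> show False by simp
  qed
  show thesis
    by (rule that[OF a_meas a_nonneg a_le1 a_bound[unfolded K'_def] a_lim])
qed

text \<open>
  The random variable \<open>v n\<close> arises from the conditional probability \<open>u n\<close> of \<open>A\<close> given the
  path up to time \<open>n\<close> by replacing the current signal by a fixed point. It is a function of the
  observations, because a tail event depends on the past only through the observations, and it is close
  to the indicator of \<open>A\<close> by \<open>tail_domination\<close>.
\<close>

theorem tail_field_eq_obs_field:
  assumes lam: "lam \<in> space (prob_algebra borel)" and inv: "markov_invariant P lam"
    and L: "countably_generated L"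
    and mix: "\<And>x y. (\<lambda>n. tv_dist (sets (future_field n)) (P.path_from (x, y)) (chain_law P lam)) \<longlonglongrightarrow> 0"
    and A: "\<And>m. A \<in> sets (env_field m)"
  shows "\<exists>B\<in>sets (obs_field UNIV). measure (chain_law P lam) ((A - B) \<union> (B - A)) = 0"
proof -
  let ?\<Lambda> = "chain_law P lam" and ?K = "P.path_from"
  interpret \<Lambda>: prob_space ?\<Lambda> by (rule P.prob_space_chain_law[OF lam])
  note s\<Lambda> = P.sets_chain_law[OF lam]
  have sp\<Lambda>: "space ?\<Lambda> = UNIV" using sets_eq_imp_space_eq[OF s\<Lambda>] by simp
  have AP: "A \<in> sets path_space" using A[of 0] env_field_sub by auto
  define x0 :: 'e where "x0 = undefined"
  define K' where "K' z = ?K (x0, snd z)" for z :: "'e \<times> 'f"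
  have x0_meas: "(\<lambda>z. (x0, snd z)) \<in> (borel :: ('e \<times> 'f) measure) \<rightarrow>\<^sub>M borel"
    by (intro borel_measurable_Pair) (simp_all add: snd_measurable_borel)
  have K'_prob: "prob_space (K' z)" for z unfolding K'_def by (rule P.prob_space_path_from)
  have sK': "sets (K' z) = sets path_space" "space (K' z) = UNIV" for z unfolding K'_def by simp_all
  have K_le1: "measure (?K z) C \<le> 1" "measure (K' z) C \<le> 1" for z C
    by (rule prob_space.prob_le_1[OF P.prob_space_path_from], rule prob_space.prob_le_1[OF K'_prob])
  obtain a where a_meas: "\<And>m. a m \<in> borel_measurable borel" and a_nonneg: "\<And>m z. 0 \<le> a m z"
    and a_le1: "\<And>m z. a m z \<le> 1"
    and a_bound: "\<And>m z C. C \<in> sets (env_field m) \<Longrightarrow> measure (K' z) C \<le> real m * measure (?K z) C + a m z"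
    and a_lim: "\<And>z. (\<lambda>m. a m z) \<longlonglongrightarrow> 0"
    unfolding K'_def by (rule tail_domination[OF \<Lambda>.prob_space_axioms L mix, of x0]) blast
  define u where "u n \<omega> = measure (?K (\<omega> n)) (splice_path n \<omega> -` A)" for n \<omega>
  define v where "v n \<omega> = measure (K' (\<omega> n)) (splice_path n \<omega> -` A)" for n \<omega>
  have u_meas: "u n \<in> borel_measurable ?\<Lambda>" for n
    using P.splice_measure_measurable[OF AP, of "\<lambda>\<omega>. \<omega> n" n]
    by (simp add: u_def[abs_def] measurable_cong_sets[OF s\<Lambda> refl])
  have v_path: "v n \<in> borel_measurable path_space" for n
    unfolding v_def[abs_def] K'_def
    by (rule P.splice_measure_measurable[OF AP measurable_compose[OF _ x0_meas]]) simp
  then have v_meas: "v n \<in> borel_measurable ?\<Lambda>" for n by (simp add: measurable_cong_sets[OF s\<Lambda> refl])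
  have v_obs: "v n \<in> borel_measurable (obs_field UNIV)" for n
  proof -
    \<comment> \<open>Erasing the signal does not change the section of \<open>A\<close>.\<close>
    define e :: "(nat \<Rightarrow> 'e \<times> 'f) \<Rightarrow> nat \<Rightarrow> 'e \<times> 'f" where "e \<omega> k = (x0, snd (\<omega> k))" for \<omega> k
    have "e \<in> obs_field UNIV \<rightarrow>\<^sub>M path_space"
    proof (rule measurable_PiM_single')
      show "(\<lambda>\<omega>. e \<omega> k) \<in> obs_field UNIV \<rightarrow>\<^sub>M borel" for k
        unfolding e_def by (intro borel_measurable_Pair field_of_component[OF range_snd]) simp_all
    qed (simp add: PiE_UNIV_domain)
    from measurable_compose[OF this v_path]
    have "(\<lambda>\<omega>. v n (e \<omega>)) \<in> borel_measurable (obs_field UNIV)" .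
    moreover have "v n (e \<omega>) = v n \<omega>" for \<omega>
    proof -
      have "splice_path n (e \<omega>) \<omega>' \<in> A \<longleftrightarrow> splice_path n \<omega> \<omega>' \<in> A" for \<omega>'
        by (rule env_field_cong_mem[OF A[of n]]) (simp_all add: splice_path_def e_def)
      then have "splice_path n (e \<omega>) -` A = splice_path n \<omega> -` A" by auto
      then show ?thesis by (simp add: v_def K'_def e_def)
    qed
    ultimately show ?thesis by simp
  qed
  have uv01: "0 \<le> u n \<omega>" "u n \<omega> \<le> 1" "0 \<le> v n \<omega>" "v n \<omega> \<le> 1" for n \<omega>
    unfolding u_def v_def using K_le1 by simp_all
  have dom: "\<bar>v n \<omega> - indicator A \<omega>\<bar> \<le> real m * \<bar>u n \<omega> - indicator A \<omega>\<bar> + a m (\<omega> n)" for n m \<omega>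
  proof -
    interpret k: prob_space "?K (\<omega> n)" by (rule P.prob_space_path_from)
    interpret k': prob_space "K' (\<omega> n)" by (rule K'_prob)
    have sec: "splice_path n \<omega> -` A \<in> sets (env_field m)" by (rule tail_section[OF A])
    then have sec': "UNIV - splice_path n \<omega> -` A \<in> sets (env_field m)"
      using sets.compl_sets[of "splice_path n \<omega> -` A" "env_field m"] by simp
    have path: "splice_path n \<omega> -` A \<in> sets path_space" using AP by simp
    have "v n \<omega> \<le> real m * u n \<omega> + a m (\<omega> n)"
      unfolding u_def v_def by (rule a_bound[OF sec])
    moreover have "1 - v n \<omega> \<le> real m * (1 - u n \<omega>) + a m (\<omega> n)"
      using a_bound[OF sec', of "\<omega> n"] k.prob_compl[of "splice_path n \<omega> -` A"] k'.prob_compl[of "splice_path n \<omega> -` A"] path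
      by (simp add: u_def v_def sK')
    moreover have "\<bar>v n \<omega> - 1\<bar> = 1 - v n \<omega>" "\<bar>u n \<omega> - 1\<bar> = 1 - u n \<omega>" "\<bar>v n \<omega>\<bar> = v n \<omega>" "\<bar>u n \<omega>\<bar> = u n \<omega>"
      using uv01[of n \<omega>] by simp_all
    ultimately show ?thesis by (cases "\<omega> \<in> A") simp_all
  qed
  have ind: "(indicator A :: _ \<Rightarrow> real) \<in> borel_measurable ?\<Lambda>" using AP s\<Lambda> by simp
  have int_bdd: "integrable ?\<Lambda> f" if "f \<in> borel_measurable ?\<Lambda>" "\<And>\<omega>. \<bar>f \<omega>\<bar> \<le> 1" for f :: "_ \<Rightarrow> real"
    by (rule \<Lambda>.integrable_AE_bounded[OF that(1), of 1]) (simp add: that(2))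
  have diff_le1: "\<bar>u n \<omega> - indicator A \<omega>\<bar> \<le> 1" "\<bar>v n \<omega> - indicator A \<omega>\<bar> \<le> 1" for n \<omega>
    using uv01[of n \<omega>] by (auto simp: indicator_def abs_le_iff)
  have iu: "integrable ?\<Lambda> (\<lambda>\<omega>. \<bar>u n \<omega> - indicator A \<omega>\<bar>)" for n
    by (rule int_bdd[OF borel_measurable_abs[OF borel_measurable_diff[OF u_meas ind]]]) (simp add: diff_le1)
  have iv: "integrable ?\<Lambda> (\<lambda>\<omega>. v n \<omega> - indicator A \<omega>)" for n
    by (rule int_bdd[OF borel_measurable_diff[OF v_meas ind]]) (rule diff_le1)
  have aw_meas: "(\<lambda>\<omega>. a m (\<omega> n)) \<in> borel_measurable ?\<Lambda>" for m n
    unfolding measurable_cong_sets[OF s\<Lambda> refl] by (rule measurable_compose[OF _ a_meas]) simp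
  have ia: "integrable ?\<Lambda> (\<lambda>\<omega>. a m (\<omega> n))" for m n
    by (rule int_bdd[OF aw_meas]) (simp add: a_nonneg a_le1)
  have slam: "sets lam = sets borel" and plam: "prob_space lam" using lam by (simp_all add: space_prob_algebra)
  interpret lam: prob_space lam by (rule plam)
  have a_lam: "a m \<in> borel_measurable lam" for m using a_meas by (simp add: measurable_cong_sets[OF slam refl])
  have a_stat: "(\<integral>\<omega>. a m (\<omega> n) \<partial>?\<Lambda>) = (\<integral>z. a m z \<partial>lam)" for m n
  proof -
    have "(\<integral>\<^sup>+\<omega>. ennreal (a m (\<omega> n)) \<partial>?\<Lambda>) = (\<integral>\<^sup>+z. ennreal (a m z) \<partial>lam)"
      by (rule P.distr_chain_law_invariant[OF lam inv]) (use a_meas in measurable)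
    then show ?thesis
      by (simp add: integral_eq_nn_integral[OF aw_meas] integral_eq_nn_integral[OF a_lam] a_nonneg)
  qed
  have a_int_lim: "(\<lambda>m. \<integral>z. a m z \<partial>lam) \<longlonglongrightarrow> (\<integral>z. 0 \<partial>lam)"
    by (rule integral_dominated_convergence[where w="\<lambda>_. 1"]) (auto simp: a_lam a_lim a_nonneg a_le1)
  have u_lim: "(\<lambda>n. \<integral>\<omega>. \<bar>u n \<omega> - indicator A \<omega>\<bar> \<partial>?\<Lambda>) \<longlonglongrightarrow> 0"
    unfolding u_def by (rule P.splice_measure_tendsto_indicator[OF lam AP])
  have v_lim: "(\<lambda>n. \<integral>\<omega>. norm (v n \<omega> - indicator A \<omega>) \<partial>?\<Lambda>) \<longlonglongrightarrow> 0"
  proof (rule LIMSEQ_I)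
    fix r :: real assume r: "0 < r"
    obtain m where m: "(\<integral>z. a m z \<partial>lam) < r / 2"
    proof -
      have "eventually (\<lambda>m. (\<integral>z. a m z \<partial>lam) < r / 2) sequentially"
        using order_tendstoD(2)[OF a_int_lim, of "r / 2"] r by simp
      then show thesis using that by (auto simp: eventually_sequentially)
    qed
    obtain n0 where n0: "\<And>n. n0 \<le> n \<Longrightarrow> (\<integral>\<omega>. \<bar>u n \<omega> - indicator A \<omega>\<bar> \<partial>?\<Lambda>) < r / (2 * (real m + 1))"
    proof -
      have "eventually (\<lambda>n. (\<integral>\<omega>. \<bar>u n \<omega> - indicator A \<omega>\<bar> \<partial>?\<Lambda>) < r / (2 * (real m + 1))) sequentially"
        using order_tendstoD(2)[OF u_lim, of "r / (2 * (real m + 1))"] r by simp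
      then show thesis using that by (auto simp: eventually_sequentially)
    qed
    have "norm ((\<integral>\<omega>. norm (v n \<omega> - indicator A \<omega>) \<partial>?\<Lambda>) - 0) < r" if n: "n0 \<le> n" for n
    proof -
      have "(\<integral>\<omega>. norm (v n \<omega> - indicator A \<omega>) \<partial>?\<Lambda>) \<le> (\<integral>\<omega>. real m * \<bar>u n \<omega> - indicator A \<omega>\<bar> + a m (\<omega> n) \<partial>?\<Lambda>)"
        by (rule integral_mono) (use iu[of n] iv[of n] ia dom in auto)
      also have "\<dots> = real m * (\<integral>\<omega>. \<bar>u n \<omega> - indicator A \<omega>\<bar> \<partial>?\<Lambda>) + (\<integral>z. a m z \<partial>lam)"
        using iu[of n] ia by (simp add: a_stat)
      also have "real m * (\<integral>\<omega>. \<bar>u n \<omega> - indicator A \<omega>\<bar> \<partial>?\<Lambda>) \<le> real m * (r / (2 * (real m + 1)))"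
        using n0[OF n] by (intro mult_left_mono) auto
      also have "\<dots> \<le> r / 2" using r by (simp add: field_simps)
      finally have "(\<integral>\<omega>. norm (v n \<omega> - indicator A \<omega>) \<partial>?\<Lambda>) < r" using m by linarith
      moreover have "0 \<le> (\<integral>\<omega>. norm (v n \<omega> - indicator A \<omega>) \<partial>?\<Lambda>)" by simp
      ultimately show ?thesis by simp
    qed
    then show "\<exists>n0. \<forall>n\<ge>n0. norm ((\<integral>\<omega>. norm (v n \<omega> - indicator A \<omega>) \<partial>?\<Lambda>) - 0) < r" by blast
  qed
  obtain r where r: "strict_mono r" and ae: "AE \<omega> in ?\<Lambda>. (\<lambda>n. v (r n) \<omega> - indicator A \<omega>) \<longlonglongrightarrow> 0"
    using tendsto_L1_AE_subseq[OF iv v_lim] by blast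
  \<comment> \<open>Along a subsequence \<open>v\<close> converges almost surely; any level strictly between \<open>0\<close> and \<open>1\<close> separates the two limits.\<close>
  define B where "B = {\<omega> \<in> space (obs_field UNIV). \<exists>N. \<forall>n\<ge>N. 1 / 2 < v (r n) \<omega>}"
  have B: "B \<in> sets (obs_field UNIV)"
    unfolding B_def using v_obs by measurable
  have "AE \<omega> in ?\<Lambda>. \<omega> \<notin> (A - B) \<union> (B - A)"
    using ae
  proof eventually_elim
    case (elim \<omega>)
    then have lim: "(\<lambda>n. v (r n) \<omega>) \<longlonglongrightarrow> indicator A \<omega>" by (simp add: LIM_zero_iff)
    have "\<omega> \<in> A \<longleftrightarrow> \<omega> \<in> B"
    proof
      assume "\<omega> \<in> A"
      then have "eventually (\<lambda>n. 1 / 2 < v (r n) \<omega>) sequentially"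
        using order_tendstoD(1)[OF lim, of "1 / 2"] by simp
      then show "\<omega> \<in> B" by (simp add: B_def eventually_sequentially)
    next
      assume wB: "\<omega> \<in> B"
      show "\<omega> \<in> A"
      proof (rule ccontr)
        assume "\<omega> \<notin> A"
        then have "eventually (\<lambda>n. v (r n) \<omega> < 1 / 2) sequentially"
          using order_tendstoD(2)[OF lim, of "1 / 2"] by simp
        moreover have "eventually (\<lambda>n. 1 / 2 < v (r n) \<omega>) sequentially"
          using wB by (simp add: B_def eventually_sequentially)
        ultimately have "eventually (\<lambda>n::nat. False) sequentially" by eventually_elim simp
        then show False by simp
      qed
    qed
    then show ?case by auto
  qed
  moreover have "(A - B) \<union> (B - A) \<in> sets ?\<Lambda>" using AP B obs_field_sub s\<Lambda> by auto
  ultimately have "measure ?\<Lambda> ((A - B) \<union> (B - A)) = 0"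
    by (subst \<Lambda>.prob_eq_0) auto
  with B show ?thesis by blast
qed

text \<open>
  On the tail field only the observation marginal of the initial law matters for the null events.
\<close>

lemma tail_null_absolutely_continuous:
  assumes \<mu>1: "\<mu>1 \<in> space (prob_algebra borel)" and \<mu>2: "\<mu>2 \<in> space (prob_algebra borel)"
    and ac: "absolutely_continuous (distr \<mu>2 borel snd) (distr \<mu>1 borel snd)"
    and R: "prob_space R"
    and mix: "\<And>x y. (\<lambda>n. tv_dist (sets (future_field n)) (P.path_from (x, y)) R) \<longlonglongrightarrow> 0"
    and A: "\<And>m. A \<in> sets (env_field m)" and null: "measure (chain_law P \<mu>2) A = 0"
  shows "measure (chain_law P \<mu>1) A = 0"
proof -
  have AP: "A \<in> sets path_space" using A[of 0] env_field_sub by auto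
  have s: "sets \<mu>1 = sets borel" "sets \<mu>2 = sets borel" using \<mu>1 \<mu>2 by (simp_all add: space_prob_algebra)
  interpret c1: prob_space "chain_law P \<mu>1" by (rule P.prob_space_chain_law[OF \<mu>1])
  interpret c2: prob_space "chain_law P \<mu>2" by (rule P.prob_space_chain_law[OF \<mu>2])
  have K_meas: "(\<lambda>z. emeasure (P.path_from z) A) \<in> borel_measurable borel"
    by (rule measurable_compose[OF P.path_from_subprob measurable_emeasure_subprob_algebra[OF AP]])
  have transfer: "emeasure (P.path_from (x', y)) A = 0" if "emeasure (P.path_from (x, y)) A = 0" for x x' y
    using tail_null_transfer[OF R mix A, where x=x and x'=x' and y=y] that P.prob_space_path_from
    by (simp add: finite_measure.emeasure_eq_measure prob_space_def)
  define x0 :: 'e where "x0 = undefined"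
  have fy: "(\<lambda>y. emeasure (P.path_from (x0, y)) A) \<in> borel_measurable borel"
    by (rule measurable_compose[OF _ K_meas]) (intro borel_measurable_Pair; simp)
  have snd1: "snd \<in> \<mu>1 \<rightarrow>\<^sub>M borel" "snd \<in> \<mu>2 \<rightarrow>\<^sub>M borel"
    using snd_measurable_borel by (simp_all add: measurable_cong_sets[OF s(1) refl] measurable_cong_sets[OF s(2) refl])
  have setN: "{y \<in> space borel. emeasure (P.path_from (x0, y)) A = 0} \<in> sets borel" using fy by measurable
  have "(\<integral>\<^sup>+z. emeasure (P.path_from z) A \<partial>\<mu>2) = 0"
    using null P.emeasure_chain_law_mixture[OF \<mu>2 AP] by (simp add: c2.emeasure_eq_measure)
  then have "AE z in \<mu>2. emeasure (P.path_from z) A = 0"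
    using K_meas by (subst (asm) nn_integral_0_iff_AE) (simp_all add: measurable_cong_sets[OF s(2) refl])
  then have "AE z in \<mu>2. emeasure (P.path_from (x0, snd z)) A = 0"
    by eventually_elim (metis prod.collapse transfer)
  then have "AE y in distr \<mu>2 borel snd. emeasure (P.path_from (x0, y)) A = 0"
    by (subst AE_distr_iff[OF snd1(2)]) (use setN in simp_all)
  then have "AE y in distr \<mu>1 borel snd. emeasure (P.path_from (x0, y)) A = 0"
    by (rule absolutely_continuous_AE[OF _ ac, rotated]) simp
  then have "AE z in \<mu>1. emeasure (P.path_from (x0, snd z)) A = 0"
    by (subst (asm) AE_distr_iff[OF snd1(1)]) (use setN in simp_all)
  then have "AE z in \<mu>1. emeasure (P.path_from z) A = 0"
    by eventually_elim (metis prod.collapse transfer)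
  then have "(\<integral>\<^sup>+z. emeasure (P.path_from z) A \<partial>\<mu>1) = (\<integral>\<^sup>+z. 0 \<partial>\<mu>1)" by (rule nn_integral_cong_AE)
  then show ?thesis
    using P.emeasure_chain_law_mixture[OF \<mu>1 AP] by (simp add: c1.emeasure_eq_measure)
qed

section \<open>Stability of the filter\<close>

text \<open>
  The hypotheses of \<open>conditional_laws_merge\<close> hold for the laws of the chain with two initial laws: the
  tail field reduces to the observations under the stationary law, and absolute continuity of the
  observation marginals carries this over.
\<close>

theorem conditional_laws_merge_given_observations:
  fixes N :: "nat \<Rightarrow> 'd measure"
  assumes lam: "lam \<in> space (prob_algebra borel)" and inv: "markov_invariant P lam"
    and L: "countably_generated L"
    and mix: "\<And>x y. (\<lambda>n. tv_dist (sets (future_field n)) (P.path_from (x, y)) (chain_law P lam)) \<longlonglongrightarrow> 0"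
    and \<mu>: "\<mu>1 \<in> space (prob_algebra borel)" "\<mu>2 \<in> space (prob_algebra borel)"
    and ac: "absolutely_continuous (distr lam borel snd) (distr \<mu>1 borel snd)"
      "absolutely_continuous (distr lam borel snd) (distr \<mu>2 borel snd)"
      "absolutely_continuous (distr \<mu>2 borel snd) (distr \<mu>1 borel snd)"
    and loc: "\<And>n. space (\<A> n) = space (N n)" "\<And>n. sets (\<A> n) \<subseteq> sets (N n)" "\<And>n. countably_generated (\<A> n)"
    and Z: "\<And>n A. A \<in> sets (\<A> n) \<Longrightarrow> Z n -` A \<in> sets (env_field (n - r))"
    and reg: "\<And>n. regular_cond_law (chain_law P \<mu>1) (field_Y {0..n}) (N n) (Z n) (\<kappa>1 n)"
      "\<And>n. regular_cond_law (chain_law P \<mu>2) (field_Y {0..n}) (N n) (Z n) (\<kappa>2 n)"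
  shows "AE \<omega> in chain_law P \<mu>1. (\<lambda>n. tv_dist (sets (\<A> n)) (\<kappa>1 n \<omega>) (\<kappa>2 n \<omega>)) \<longlonglongrightarrow> 0"
proof (rule conditional_laws_merge[where F="\<lambda>n. obs_field {0..n}" and Finf="obs_field UNIV" and G=env_field and Z=Z and r=r and N=N])
  note s1 = P.sets_chain_law[OF \<mu>(1)] and s2 = P.sets_chain_law[OF \<mu>(2)]
  have sp1: "space (chain_law P \<mu>1) = UNIV" using sets_eq_imp_space_eq[OF s1] by simp
  have R: "prob_space (chain_law P lam)" by (rule P.prob_space_chain_law[OF lam])
  show "prob_space (chain_law P \<mu>1)" "prob_space (chain_law P \<mu>2)"
    by (rule P.prob_space_chain_law; fact \<mu>)+
  show "sets (chain_law P \<mu>1) = sets (chain_law P \<mu>2)" by (simp add: s1 s2)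
  show "subalgebra (chain_law P \<mu>1) (obs_field {0..n})" "subalgebra (chain_law P \<mu>1) (obs_field UNIV)"
    "subalgebra (chain_law P \<mu>1) (env_field n)" for n
    using obs_field_sub env_field_sub by (simp_all add: subalgebra_def sp1 s1)
  show "i \<le> j \<Longrightarrow> sets (obs_field {0..i}) \<subseteq> sets (obs_field {0..j})" for i j :: nat
    by (rule field_of_mono) auto
  show "sets (obs_field UNIV) = sigma_sets (space (chain_law P \<mu>1)) (\<Union>n. sets (obs_field {0..n}))"
    unfolding sp1
  proof
    show "sigma_sets UNIV (\<Union>n. sets (obs_field {0..n})) \<subseteq> sets (obs_field UNIV)"
      using sets.sigma_sets_subset[of "\<Union>n. sets (obs_field {0..n})" "obs_field UNIV"] field_of_mono[of _ UNIV snd borel]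
      by auto
    have "(\<lambda>\<omega>. \<omega>) \<in> sigma UNIV (\<Union>n. sets (obs_field {0..n})) \<rightarrow>\<^sub>M obs_field UNIV"
    proof (rule measurable_field_of[OF range_snd])
      fix k
      have "sets (obs_field {0..k}) \<subseteq> sigma_sets UNIV (\<Union>n. sets (obs_field {0..n}))"
        by (auto intro: sigma_sets.Basic)
      then show "(\<lambda>\<omega>. snd (\<omega> k)) \<in> sigma UNIV (\<Union>n. sets (obs_field {0..n})) \<rightarrow>\<^sub>M borel"
        by (intro measurable_from_subalg[OF _ field_of_component[OF range_snd, of k "{0..k}"]])
          (simp_all add: subalgebra_def)
    qed
    from measurable_sets[OF this]
    show "sets (obs_field UNIV) \<subseteq> sigma_sets UNIV (\<Union>n. sets (obs_field {0..n}))" by auto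
  qed
  show "i \<le> j \<Longrightarrow> sets (env_field j) \<subseteq> sets (env_field i)" for i j by (rule env_field_dec)
  show obs_env: "sets (obs_field UNIV) \<subseteq> sets (env_field n)" for n
    unfolding env_field_def by (rule join_field_upper(1))
  show "\<exists>B\<in>sets (obs_field UNIV). measure (chain_law P \<mu>1) ((A - B) \<union> (B - A)) = 0
      \<and> measure (chain_law P \<mu>2) ((A - B) \<union> (B - A)) = 0" if A: "\<And>n. A \<in> sets (env_field n)" for A
  proof -
    obtain B where B: "B \<in> sets (obs_field UNIV)" "measure (chain_law P lam) ((A - B) \<union> (B - A)) = 0"
      using tail_field_eq_obs_field[OF lam inv L mix A] by blast
    have AB: "(A - B) \<union> (B - A) \<in> sets (env_field m)" for m
      using A[of m] B(1) obs_env[of m] by auto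
    from tail_null_absolutely_continuous[OF \<mu>(1) lam ac(1) R mix AB B(2)]
      tail_null_absolutely_continuous[OF \<mu>(2) lam ac(2) R mix AB B(2)] B(1)
    show ?thesis by blast
  qed
  show "measure (chain_law P \<mu>1) A = 0" if "A \<in> sets (obs_field UNIV)" "measure (chain_law P \<mu>2) A = 0" for A
    by (rule tail_null_absolutely_continuous[OF \<mu> ac(3) R mix _ that(2)]) (use that(1) obs_env in auto)
  show "Z n -` A \<inter> space (chain_law P \<mu>1) \<in> sets (env_field (n - r))" if "A \<in> sets (\<A> n)" for n A
    using Z[OF that] by (simp add: sp1)
qed (use loc reg in \<open>simp_all add: field_Y_eq\<close>)

end

theorem corollary4p11:
  fixes I :: "'i set"
    and T :: "'i \<Rightarrow> 'b topology"
    and emb :: "'e::polish_space \<Rightarrow> 'i \<Rightarrow> 'b"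
    and P :: "'e \<times> 'f::polish_space \<Rightarrow> ('e \<times> 'f) measure"
    and lam mu :: "('e \<times> 'f) measure"
    and Post :: "('e \<times> 'f) measure \<Rightarrow> nat \<Rightarrow> (nat \<Rightarrow> 'e \<times> 'f) \<Rightarrow> (nat \<Rightarrow> 'e \<times> 'f) measure"
    and Filt :: "('e \<times> 'f) measure \<Rightarrow> nat \<Rightarrow> (nat \<Rightarrow> 'e \<times> 'f) \<Rightarrow> 'e measure"
  assumes "countable I"
    and "\<And>i. i \<in> I \<Longrightarrow> polish_topology (T i)"
    and "coordinate_inclusion I T emb"
    and "P \<in> borel \<rightarrow>\<^sub>M prob_algebra borel"
    and "lam \<in> space (prob_algebra borel)"
    and "markov_invariant P lam"
    and "\<And>\<nu> n. \<nu> \<in> space (prob_algebra borel) \<Longrightarrow>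
           regular_cond_law (chain_law P \<nu>) (field_Y {0..n}) path_space (\<lambda>\<omega>. \<omega>) (Post \<nu> n)"
    and "\<And>\<nu> n. \<nu> \<in> space (prob_algebra borel) \<Longrightarrow>
           regular_cond_law (chain_law P \<nu>) (field_Y {0..n}) borel (\<lambda>\<omega>. fst (\<omega> n)) (Filt \<nu> n)"
    and "locally_mixing I T emb P lam"
    and "nondegenerate P"
    and "mu \<in> space (prob_algebra borel)"
    and "absolutely_continuous (distr lam borel snd) (distr mu borel snd)"
  shows "(\<forall>r. AE \<omega> in chain_law P mu. \<forall>J. J \<subseteq> I \<longrightarrow> finite J \<longrightarrow>
            (\<lambda>n. tv_dist (sets (field_XY T emb J {n - r..})) (Post mu n \<omega>) (Post lam n \<omega>))
              \<longlonglongrightarrow> 0) \<and>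
         (AE \<omega> in chain_law P mu. \<forall>J. J \<subseteq> I \<longrightarrow> finite J \<longrightarrow>
            (\<lambda>n. tv_dist (sets (local_field T emb J)) (Filt mu n \<omega>) (Filt lam n \<omega>))
              \<longlonglongrightarrow> 0) \<and>
         (absolutely_continuous (distr lam borel snd) (distr mu borel snd) \<and>
          absolutely_continuous (distr mu borel snd) (distr lam borel snd) \<longrightarrow>
            (\<forall>r. AE \<omega> in chain_law P lam. \<forall>J. J \<subseteq> I \<longrightarrow> finite J \<longrightarrow>
               (\<lambda>n. tv_dist (sets (field_XY T emb J {n - r..})) (Post mu n \<omega>) (Post lam n \<omega>))
                 \<longlonglongrightarrow> 0) \<and>
            (AE \<omega> in chain_law P lam. \<forall>J. J \<subseteq> I \<longrightarrow> finite J \<longrightarrow>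
               (\<lambda>n. tv_dist (sets (local_field T emb J)) (Filt mu n \<omega>) (Filt lam n \<omega>))
                 \<longlonglongrightarrow> 0))"
proof -
  note lam = assms(5) and inv = assms(6) and Post = assms(7) and Filt = assms(8) and mu = assms(11)
  obtain P0 Q g where nondeg: "P0 \<in> borel \<rightarrow>\<^sub>M prob_algebra borel" "Q \<in> borel \<rightarrow>\<^sub>M prob_algebra borel"
    "g \<in> borel_measurable borel" "\<And>z z'. 0 < g (z, z')"
    "\<And>x y. P (x, y) = density (P0 x \<Otimes>\<^sub>M Q y) (\<lambda>z'. ennreal (g ((x, y), z')))"
    using assms(10) unfolding nondegenerate_def by blast
  have mixing: "(\<lambda>n. tv_dist (sets (field_XY T emb J {n..})) (chain_law P (return borel (x, y))) (chain_law P lam)) \<longlonglongrightarrow> 0"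
    if "J \<subseteq> I" "finite J" for J x y
    using assms(9) that unfolding locally_mixing_def by simp
  have for_J: "(\<forall>r. AE \<omega> in chain_law P \<mu>1.
        (\<lambda>n. tv_dist (sets (field_XY T emb J {n - r..})) (Post \<mu>1 n \<omega>) (Post \<mu>2 n \<omega>)) \<longlonglongrightarrow> 0) \<and>
      (AE \<omega> in chain_law P \<mu>1.
        (\<lambda>n. tv_dist (sets (local_field T emb J)) (Filt \<mu>1 n \<omega>) (Filt \<mu>2 n \<omega>)) \<longlonglongrightarrow> 0)"
    if J: "J \<subseteq> I" "finite J"
      and \<mu>: "\<mu>1 \<in> space (prob_algebra borel)" "\<mu>2 \<in> space (prob_algebra borel)"
      and ac: "absolutely_continuous (distr lam borel snd) (distr \<mu>1 borel snd)"
        "absolutely_continuous (distr lam borel snd) (distr \<mu>2 borel snd)"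
        "absolutely_continuous (distr \<mu>2 borel snd) (distr \<mu>1 borel snd)" for J \<mu>1 \<mu>2
  proof -
    define L where "L = (\<Pi>\<^sub>M i\<in>J. borel_of (T i))"
    define \<phi> where "\<phi> x = restrict (emb x) J" for x
    have "emb \<in> borel \<rightarrow>\<^sub>M (\<Pi>\<^sub>M i\<in>I. borel_of (T i))"
    proof -
      have "space (borel_of (T i)) = topspace (T i)" for i by (simp add: borel_of_def space_measure_of_conv)
      then have "emb \<in> UNIV \<rightarrow> space (\<Pi>\<^sub>M i\<in>I. borel_of (T i))"
        using assms(3) by (auto simp: coordinate_inclusion_def space_PiM)
      then have "emb \<in> vimage_algebra UNIV emb (\<Pi>\<^sub>M i\<in>I. borel_of (T i)) \<rightarrow>\<^sub>M (\<Pi>\<^sub>M i\<in>I. borel_of (T i))"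
        by (rule measurable_vimage_algebra1)
      then show ?thesis
        using assms(3) by (simp add: coordinate_inclusion_def cong: measurable_cong_sets)
    qed
    then have \<phi>_meas: "\<phi> \<in> borel \<rightarrow>\<^sub>M L"
      unfolding \<phi>_def L_def by (rule measurable_compose[OF _ measurable_restrict_subset[OF J(1)]])
    have L: "countably_generated L"
      unfolding L_def using J assms(2)
      by (intro countably_generated_PiM countably_generated_borel_of)
        (auto simp: polish_topology_def countable_finite)
    interpret local_observation P P0 Q g \<phi> L
      by unfold_locales (use assms(4) nondeg \<phi>_meas in auto)
    have future: "field_XY T emb J {n..} = future_field n" for n
      unfolding field_XY_eq L_def \<phi>_def local_state_def[abs_def] by simp
    have mix: "(\<lambda>n. tv_dist (sets (future_field n)) (P.path_from (x, y)) (chain_law P lam)) \<longlonglongrightarrow> 0" for x y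
      using mixing[OF J, of x y] unfolding future P.path_from_def .
    have range_\<phi>: "\<phi> \<in> UNIV \<rightarrow> space L" using measurable_space[OF \<phi>_meas] by auto
    have lf: "local_field T emb J = vimage_algebra UNIV \<phi> L"
      unfolding local_field_def L_def \<phi>_def ..
    have cg: "countably_generated (future_field n)" for n
      by (rule countably_generated_field_of[OF countably_generated_pair[OF L countably_generated_borel] range_local_state])
    have future_env: "sets (future_field n) \<subseteq> sets (env_field n)" for n
      unfolding env_field_def by (rule join_field_upper(2))
    have "AE \<omega> in chain_law P \<mu>1. (\<lambda>n. tv_dist (sets (field_XY T emb J {n - r..})) (Post \<mu>1 n \<omega>) (Post \<mu>2 n \<omega>)) \<longlonglongrightarrow> 0" for r
      unfolding future
    proof (rule conditional_laws_merge_given_observations[OF lam inv L mix \<mu> ac,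
          where r=r and N="\<lambda>_. path_space" and Z="\<lambda>_ \<omega>. \<omega>"])
      show "(\<lambda>\<omega>. \<omega>) -` A \<in> sets (env_field (n - r))" if "A \<in> sets (future_field (n - r))" for n A
        using that future_env by auto
    qed (use cg future_field_sub Post \<mu> in auto)
    moreover have "AE \<omega> in chain_law P \<mu>1. (\<lambda>n. tv_dist (sets (local_field T emb J)) (Filt \<mu>1 n \<omega>) (Filt \<mu>2 n \<omega>)) \<longlonglongrightarrow> 0"
      unfolding lf
    proof (rule conditional_laws_merge_given_observations[OF lam inv L mix \<mu> ac,
          where r=0 and N="\<lambda>_. borel" and Z="\<lambda>n \<omega>. fst (\<omega> n)"])
      show "sets (vimage_algebra UNIV \<phi> L) \<subseteq> sets borel"
        unfolding sets_vimage_algebra2[OF range_\<phi>] using measurable_sets[OF \<phi>_meas] by auto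
      show "(\<lambda>\<omega>. fst (\<omega> n)) -` A \<in> sets (env_field (n - 0))" if A: "A \<in> sets (vimage_algebra UNIV \<phi> L)" for n A
      proof -
        obtain B where B: "B \<in> sets L" "A = \<phi> -` B"
          using A unfolding sets_vimage_algebra2[OF range_\<phi>] by auto
        have "(\<lambda>\<omega>. fst (local_state (\<omega> n))) \<in> future_field n \<rightarrow>\<^sub>M L"
          by (rule measurable_compose[OF field_of_component[OF range_local_state] measurable_fst]) simp
        from measurable_sets[OF this B(1)] have "(\<lambda>\<omega>. \<phi> (fst (\<omega> n))) -` B \<in> sets (future_field n)"
          by (simp add: local_state_def)
        then show ?thesis using future_env[of n] unfolding B(2) by (auto simp: vimage_def)
      qed
      show "countably_generated (vimage_algebra UNIV \<phi> L)"
        by (rule countably_generated_vimage_algebra[OF L range_\<phi>])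
    qed (use Filt \<mu> in auto)
    ultimately show ?thesis by blast
  qed
  have all_J: "AE \<omega> in M. \<forall>J. J \<subseteq> I \<longrightarrow> finite J \<longrightarrow> Q J \<omega>"
    if "\<And>J. J \<subseteq> I \<Longrightarrow> finite J \<Longrightarrow> AE \<omega> in M. Q J \<omega>" for Q and M :: "(nat \<Rightarrow> 'e \<times> 'f) measure"
  proof -
    have "AE \<omega> in M. \<forall>J\<in>{J. finite J \<and> J \<subseteq> I}. Q J \<omega>"
      by (subst AE_ball_countable) (use countable_Collect_finite_subset[OF assms(1)] that in auto)
    then show ?thesis by eventually_elim auto
  qed
  have ac_refl: "absolutely_continuous M M" for M :: "'f measure" by (simp add: absolutely_continuous_def)
  show ?thesis
  proof (intro conjI allI impI)
    show "AE \<omega> in chain_law P mu. \<forall>J. J \<subseteq> I \<longrightarrow> finite J \<longrightarrow>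
        (\<lambda>n. tv_dist (sets (field_XY T emb J {n - r..})) (Post mu n \<omega>) (Post lam n \<omega>)) \<longlonglongrightarrow> 0" for r
      by (rule all_J) (rule for_J[OF _ _ mu lam assms(12) ac_refl assms(12), THEN conjunct1, THEN spec])
    show "AE \<omega> in chain_law P mu. \<forall>J. J \<subseteq> I \<longrightarrow> finite J \<longrightarrow>
        (\<lambda>n. tv_dist (sets (local_field T emb J)) (Filt mu n \<omega>) (Filt lam n \<omega>)) \<longlonglongrightarrow> 0"
      by (rule all_J) (rule for_J[OF _ _ mu lam assms(12) ac_refl assms(12), THEN conjunct2])
  next
    fix r
    assume "absolutely_continuous (distr lam borel snd) (distr mu borel snd) \<and>
      absolutely_continuous (distr mu borel snd) (distr lam borel snd)"
    then have ac: "absolutely_continuous (distr mu borel snd) (distr lam borel snd)" by simp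
    show "AE \<omega> in chain_law P lam. \<forall>J. J \<subseteq> I \<longrightarrow> finite J \<longrightarrow>
        (\<lambda>n. tv_dist (sets (field_XY T emb J {n - r..})) (Post mu n \<omega>) (Post lam n \<omega>)) \<longlonglongrightarrow> 0"
      by (rule all_J, subst tv_dist_commute) (rule for_J[OF _ _ lam mu ac_refl assms(12) ac, THEN conjunct1, THEN spec])
  next
    assume "absolutely_continuous (distr lam borel snd) (distr mu borel snd) \<and>
      absolutely_continuous (distr mu borel snd) (distr lam borel snd)"
    then have ac: "absolutely_continuous (distr mu borel snd) (distr lam borel snd)" by simp
    show "AE \<omega> in chain_law P lam. \<forall>J. J \<subseteq> I \<longrightarrow> finite J \<longrightarrow>
        (\<lambda>n. tv_dist (sets (local_field T emb J)) (Filt mu n \<omega>) (Filt lam n \<omega>)) \<longlonglongrightarrow> 0"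
      by (rule all_J, subst tv_dist_commute) (rule for_J[OF _ _ lam mu ac_refl assms(12) ac, THEN conjunct2])
  qed
qed

end
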